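(* Let $p\in\mathbb N$ with $(p+1)\alpha>1$, let $\mathbf X=(X,\mathbb X)$ be an $\alpha$-Hölder rough path over $\mathbb R^d$ on $[0,T]$, let $\mathbf Z=(Z,Z')\in\mathcal D^\alpha_{\mathbf X}([0,T];\mathbb R^m)$, and let $F_a\in C_b^{p+1}(\mathbb R^e;\mathbb R^e)$ for $a\in\mathcal A=\{1,\dots,m\}$. Let $(Y,Y')\in\mathcal D^\alpha_{\mathbf X}([0,T];\mathbb R^e)$ be the solution of $dY_t=\sum_{a=1}^mF_a(Y_t)\,d\mathbf Z^a_t$, $Y_0=y_0$. Then, for every $0\le s\le t\le T$, $$Y_t=Y_s+\sum_{\tau\in\mathcal T_{\le p}}\frac1{\sigma(\tau)}F(\tau)(Y_s)\,Z^\tau_{s,t}+R^{(p+1)}_{s,t},$$ where the remainder satisfies $|R^{(p+1)}_{s,t}|\le C_{p,T}|t-s|^{(p+1)\alpha}$ with a constant $C_{p,T}$ independent of $s,t$. (The sum of the first two terms on the right is the truncated controlled B-series $B_p(1;Y_s,\mathcal Z_{s,t})$ with constant weight map $1$.)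
   Context: Fix $\alpha\in(1/3,1/2]$, $T>0$ and $d,m,e\in\mathbb N=\{1,2,\dots\}$. Write $X_{s,t}:=X_t-X_s$. $C_b^k$ denotes $k$ times continuously differentiable maps with all derivatives of orders $0,\dots,k$ bounded. Rough and controlled paths. An $\alpha$-Hölder rough path over $\mathbb R^d$ is a pair $\mathbf X=(X,\mathbb X)$ with $X\in C^\alpha([0,T];\mathbb R^d)$ and $\mathbb X:\{0\le s\le t\le T\}\to\mathbb R^{d\times d}$ with $\sup_{s<t}|\mathbb X_{s,t}|/|t-s|^{2\alpha}<\infty$ and $\mathbb X_{s,t}=\mathbb X_{s,u}+\mathbb X_{u,t}+X_{s,u}\otimes X_{u,t}$ for $s\le u\le t$. $\mathcal D^\alpha_{\mathbf X}([0,T];V)$ is the set of pairs $(Y,Y')$ ($\mathbf X$-controlled rough paths) with $Y\in C^\alpha([0,T];V)$, $Y'\in C^\alpha([0,T];\mathcal L(\mathbb R^d,V))$ (the Gubinelli derivative) and $R^Y_{s,t}:=Y_{s,t}-Y'_sX_{s,t}$ satisfying $\sup_{s<t}|R^Y_{s,t}|/|t-s|^{2\alpha}<\infty$. Controlled rough integral. For controlled $(H,H')$ with values in $\mathcal L(\mathbb R^k,V)$ and controlled $(W,W')$ with values in $\mathbb R^k$, $$\int_s^tH_r\,d\mathbf W_r:=\lim_{|P|\to0}\sum_{[u,v]\in P}\bigl(H_uW_{u,v}+(H'_u\diamond W'_u)\mathbb X_{u,v}\bigr),$$ over partitions $P$ of $[s,t]$ (the limit exists), where $(A\diamond B)(x\otimes\tilde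 x):=A(x)(B\tilde x)$. The indefinite integral is controlled with Gubinelli derivative $H_tW'_t$. Solution. With $F(y)e_a=F_a(y)$, $F:\mathbb R^e\to\mathcal L(\mathbb R^m,\mathbb R^e)$, a solution is $(Y,Y')\in\mathcal D^\alpha_{\mathbf X}([0,T];\mathbb R^e)$ with $Y_t=y_0+\int_0^tF(Y_r)\,d\mathbf Z_r$ and $Y'_t=F(Y_t)Z'_t$, where $F(Y)$ is controlled with Gubinelli derivative $DF(Y_t)Y'_t$. Trees. $\mathcal T$ is the set of (nonplanar) rooted trees with vertices decorated by $\mathcal A$; $\mathcal F^0$ is the free commutative monoid generated by $\mathcal T$ with unit the empty forest $\mathbf 1$. $[\tau_1\cdots\tau_n]_a$ is the tree obtained by joining the roots of $\tau_1,\dots,\tau_n$ to a new root decorated by $a$; $\bullet_a=[\mathbf 1]_a$. $|\tau|$ is the number of vertices; $\mathcal T_{\le p}=\{\tau\in\mathcal T:|\tau|\le p\}$. Symmetry factor: $\sigma(\mathbf 1)=\sigma(\bullet_a)=1$, and $\sigma([\rho_1^{m_1}\cdots\rho_\ell^{m_\ell}]_a)=\prod_jm_j!\,\sigma(\rho_j)^{m_j}$ for distinct $\rho_j$ with multiplicities $m_j$. Elementary differentials: $F(\bullet_a)(y)=F_a(y)$ and $F([\tau_1\cdots\tau_n]_a)(y)=D^nF_a(y)[F(\tau_1)(y),\dots,F(\tau_n)(y)]$. Controlled coefficients. For fixed $s$ and $t\in[s,T]$: $Z^{\mathbf 1}_{s,t}:=1$; $Z^{\tau_1\cdots\tau_n}_{s,t}:=\prod_jZ^{\tau_j}_{s,t}$;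 $Z^{[\eta]_a}_{s,t}:=\int_s^tZ^\eta_{s,u}\,d\mathbf Z^a_u$ (controlled rough integral), with Gubinelli derivatives $(Z^{\mathbf 1}_{s,\cdot})'=0$, $(Z^{\tau_1\cdots\tau_n}_{s,\cdot})'_r=\sum_j(Z^{\tau_j}_{s,\cdot})'_r\prod_{i\ne j}Z^{\tau_i}_{s,r}$, $(Z^{[\eta]_a}_{s,\cdot})'_r=Z^\eta_{s,r}(Z^a)'_r$. $B_p(\phi;y,\mathcal Z_{s,t}):=y+\sum_{\tau\in\mathcal T_{\le p}}\frac{\phi(\tau)}{\sigma(\tau)}F(\tau)(y)Z^\tau_{s,t}$. *)

theory Defs
  imports "HOL-Analysis.Analysis" "HOL-Library.Multiset"
begin

text \<open>
  Paths on \<open>[0,T]\<close> are total functions on \<open>real\<close>; every condition below only constrains their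
  values on \<open>{0..T}\<close>. Two-parameter functions are only constrained for \<open>s \<le> t\<close>.
  The spaces \<open>\<real>\<^sup>d\<close>, \<open>\<real>\<^sup>m\<close>, \<open>\<real>\<^sup>e\<close> are \<open>real ^ 'd\<close>, \<open>real ^ 'm\<close>, \<open>real ^ 'e\<close>.
\<close>

text \<open>\<open>sup\<^bsub>s<t\<^esub> |A\<^bsub>s,t\<^esub>| / |t - s|\<^sup>\<beta> < \<infinity>\<close>\<close>
definition finite_holder_sup :: "real \<Rightarrow> real \<Rightarrow> (real \<Rightarrow> real \<Rightarrow> 'v::real_normed_vector) \<Rightarrow> bool" where
  "finite_holder_sup \<beta> T A \<longleftrightarrow>
     (\<exists>C. \<forall>s t. 0 \<le> s \<and> s < t \<and> t \<le> T \<longrightarrow> norm (A s t) / (t - s) powr \<beta> \<le> C)"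

definition holder_paths :: "real \<Rightarrow> real \<Rightarrow> (real \<Rightarrow> 'v::real_normed_vector) set" where
  "holder_paths \<alpha> T = {f. finite_holder_sup \<alpha> T (\<lambda>s t. f t - f s)}"

definition tensor :: "real ^ 'd \<Rightarrow> real ^ 'd \<Rightarrow> real ^ 'd ^ 'd" (infixr "\<otimes>\<^sub>v" 75) where
  "x \<otimes>\<^sub>v y = (\<chi> i j. x $ i * y $ j)"

definition rough_paths ::
    "real \<Rightarrow> real \<Rightarrow> ((real \<Rightarrow> real ^ 'd) \<times> (real \<Rightarrow> real \<Rightarrow> real ^ 'd ^ 'd)) set" where
  "rough_paths \<alpha> T = {(X, XX).
     X \<in> holder_paths \<alpha> T \<and>
     finite_holder_sup (2 * \<alpha>) T XX \<and>
     (\<forall>s u t. 0 \<le> s \<and> s \<le> u \<and> u \<le> t \<and> t \<le> T \<longrightarrow>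
        XX s t = XX s u + XX u t + (X u - X s) \<otimes>\<^sub>v (X t - X u))}"

text \<open>A path together with its Gubinelli derivative.\<close>
type_synonym ('d, 'v) cpath = "(real \<Rightarrow> 'v) \<times> (real \<Rightarrow> (real ^ 'd) \<Rightarrow>\<^sub>L 'v)"

definition controlled_paths ::
    "real \<Rightarrow> real \<Rightarrow> (real \<Rightarrow> real ^ 'd) \<Rightarrow> ('d::finite, 'v::real_normed_vector) cpath set" where
  "controlled_paths \<alpha> T X = {(Y, Y').
     Y \<in> holder_paths \<alpha> T \<and>
     Y' \<in> holder_paths \<alpha> T \<and>
     finite_holder_sup (2 * \<alpha>) T (\<lambda>s t. (Y t - Y s) - blinfun_apply (Y' s) (X t - X s))}"

text \<open>Partitions of \<open>[s,t]\<close> are given by their increasing lists of points.\<close>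
definition partitions :: "real \<Rightarrow> real \<Rightarrow> real list set" where
  "partitions s t = {P. P \<noteq> [] \<and> sorted_wrt (<) P \<and> hd P = s \<and> last P = t}"

definition cells :: "real list \<Rightarrow> (real \<times> real) list" where
  "cells P = zip P (tl P)"

text \<open>The filter \<open>|P| \<rightarrow> 0\<close>.\<close>
definition mesh_filter :: "real \<Rightarrow> real \<Rightarrow> real list filter" where
  "mesh_filter s t =
     (INF \<delta>\<in>{0<..}. principal {P \<in> partitions s t. \<forall>(u, v)\<in>set (cells P). v - u < \<delta>})"

text \<open>
  \<open>diamond A B\<close> is the linear map on \<open>\<real>\<^sup>d\<^sup>\<times>\<^sup>d\<close> with
  \<open>diamond A B (x \<otimes>\<^sub>v y) = A x (B y)\<close>, written out on the basis of elementary tensors.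
\<close>
definition diamond ::
    "((real ^ 'd::finite) \<Rightarrow>\<^sub>L ('w::real_normed_vector \<Rightarrow>\<^sub>L 'v::real_normed_vector))
       \<Rightarrow> ((real ^ 'd) \<Rightarrow>\<^sub>L 'w) \<Rightarrow> real ^ 'd ^ 'd \<Rightarrow> 'v" where
  "diamond A B M =
     (\<Sum>i\<in>UNIV. \<Sum>j\<in>UNIV. (M $ i $ j) *\<^sub>R A (axis i 1) (B (axis j 1)))"

lemma diamond_tensor: "diamond A B (x \<otimes>\<^sub>v y) = A x (B y)"
proof -
  have x: "A x = (\<Sum>i\<in>UNIV. x $ i *\<^sub>R A (axis i 1))"
    by (subst basis_expansion[of x, symmetric], unfold scalar_mult_eq_scaleR)
       (simp add: blinfun.sum_right blinfun.scaleR_right)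
  have y: "B y = (\<Sum>j\<in>UNIV. y $ j *\<^sub>R B (axis j 1))"
    by (subst basis_expansion[of y, symmetric], unfold scalar_mult_eq_scaleR)
       (simp add: blinfun.sum_right blinfun.scaleR_right)
  show ?thesis
    unfolding diamond_def tensor_def x y
    by (subst sum.swap) (simp add: blinfun.sum_right blinfun.sum_left
        blinfun.scaleR_right blinfun.scaleR_left scaleR_sum_right mult.commute)
qed

definition rough_sum ::
    "(real \<Rightarrow> real \<Rightarrow> real ^ 'd ^ 'd) \<Rightarrow> ('d::finite, 'w::real_normed_vector \<Rightarrow>\<^sub>L 'v::real_normed_vector) cpath
       \<Rightarrow> ('d, 'w) cpath \<Rightarrow> real list \<Rightarrow> 'v" where
  "rough_sum XX HH WW P = (case HH of (H, H') \<Rightarrow> case WW of (W, W') \<Rightarrow>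
     (\<Sum>(u, v)\<leftarrow>cells P. blinfun_apply (H u) (W v - W u) + diamond (H' u) (W' u) (XX u v)))"

definition rough_integral ::
    "(real \<Rightarrow> real \<Rightarrow> real ^ 'd ^ 'd) \<Rightarrow> real \<Rightarrow> real \<Rightarrow> ('d::finite, 'w::real_normed_vector \<Rightarrow>\<^sub>L 'v::real_normed_vector) cpath
       \<Rightarrow> ('d, 'w) cpath \<Rightarrow> 'v" where
  "rough_integral XX s t HH WW = Lim (mesh_filter s t) (rough_sum XX HH WW)"

text \<open>
  A scalar controlled path seen as an \<open>L(\<real>,\<real>)\<close>-valued one (acting by multiplication), so that it
  can be integrated against a scalar controlled path.
\<close>
definition scalar_integrand ::
    "('d::finite, real) cpath \<Rightarrow> ('d, real \<Rightarrow>\<^sub>L real) cpath" where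
  "scalar_integrand = (\<lambda>(h, h').
     (\<lambda>r. blinfun_mult_right (h r), \<lambda>r. Blinfun blinfun_mult_right o\<^sub>L h' r))"

text \<open>
  \<open>nderiv f [v\<^sub>1, \<dots>, v\<^sub>n] y = D\<^sup>n f(y)[v\<^sub>1, \<dots>, v\<^sub>n]\<close>: the \<open>(n+1)\<close>-st derivative is the Frechet
  derivative of the \<open>n\<close>-th. As the space of \<open>n\<close>-linear maps is not a type depending on \<open>n\<close>, the
  \<open>n\<close>-th derivative is represented by its values on all \<open>n\<close>-tuples of arguments.
\<close>
primrec nderiv ::
    "('a::euclidean_space \<Rightarrow> 'b::real_normed_vector) \<Rightarrow> 'a list \<Rightarrow> 'a \<Rightarrow> 'b" where
  "nderiv f [] = f"
| "nderiv f (v # vs) = (\<lambda>y. frechet_derivative (nderiv f vs) (at y) v)"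

text \<open>
  The class \<open>C\<^sub>b\<^sup>k\<close>. Since the domain is finite-dimensional, differentiability and continuity of
  \<open>y \<mapsto> D\<^sup>j f(y)\<close> as a map into the \<open>j\<close>-linear maps are those of \<open>y \<mapsto> D\<^sup>j f(y)[v\<^sub>1, \<dots>, v\<^sub>j]\<close> for
  all fixed arguments. The last clause bounds the operator norm of \<open>D\<^sup>j f\<close> uniformly.
\<close>
definition Cb :: "nat \<Rightarrow> ('a::euclidean_space \<Rightarrow> 'b::real_normed_vector) set" where
  "Cb k = {f.
     (\<forall>vs y. length vs < k \<longrightarrow> nderiv f vs differentiable (at y)) \<and>
     (\<forall>vs. length vs \<le> k \<longrightarrow> continuous_on UNIV (nderiv f vs)) \<and>
     (\<forall>j\<le>k. \<exists>B. \<forall>vs y. length vs = j \<longrightarrow> norm (nderiv f vs y) \<le> B * (\<Prod>v\<leftarrow>vs. norm v))}"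

text \<open>The map \<open>F : \<real>\<^sup>e \<rightarrow> L(\<real>\<^sup>m, \<real>\<^sup>e)\<close> with \<open>F(y) e\<^sub>a = F\<^sub>a(y)\<close>.\<close>
definition vfield ::
    "('m::finite \<Rightarrow> real ^ 'e \<Rightarrow> real ^ 'e) \<Rightarrow> real ^ 'e \<Rightarrow> (real ^ 'm) \<Rightarrow>\<^sub>L (real ^ 'e)" where
  "vfield F y = Blinfun (\<lambda>z. \<Sum>a\<in>UNIV. z $ a *\<^sub>R F a y)"

definition vfield_path ::
    "('m::finite \<Rightarrow> real ^ 'e \<Rightarrow> real ^ 'e) \<Rightarrow> ('d::finite, real ^ 'e) cpath
       \<Rightarrow> ('d, (real ^ 'm) \<Rightarrow>\<^sub>L (real ^ 'e)) cpath" where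
  "vfield_path F = (\<lambda>(Y, Y').
     (\<lambda>t. vfield F (Y t),
      \<lambda>t. Blinfun (frechet_derivative (vfield F) (at (Y t))) o\<^sub>L Y' t))"

definition rde_solution ::
    "real \<Rightarrow> real \<Rightarrow> (real \<Rightarrow> real ^ 'd) \<Rightarrow> (real \<Rightarrow> real \<Rightarrow> real ^ 'd ^ 'd)
       \<Rightarrow> ('m::finite \<Rightarrow> real ^ 'e \<Rightarrow> real ^ 'e) \<Rightarrow> ('d::finite, real ^ 'm) cpath \<Rightarrow> real ^ 'e
       \<Rightarrow> ('d, real ^ 'e) cpath \<Rightarrow> bool" where
  "rde_solution \<alpha> T X XX F ZZ y0 YY \<longleftrightarrow>
     YY \<in> controlled_paths \<alpha> T X \<and>
     (\<forall>t\<in>{0..T}.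
        fst YY t = y0 + rough_integral XX 0 t (vfield_path F YY) ZZ \<and>
        snd YY t = vfield F (fst YY t) o\<^sub>L snd ZZ t)"

text \<open>
  \<open>Node a \<eta>\<close> is the tree \<open>[\<eta>]\<^sub>a\<close>. Forests, i.e. elements of the free commutative monoid over the
  trees, are multisets of trees, \<open>{#}\<close> being the empty forest; thus trees are nonplanar.
\<close>
datatype 'a rtree = Node 'a "'a rtree multiset"

primrec vertices :: "'a rtree \<Rightarrow> nat" where
  "vertices (Node a \<eta>) = Suc (\<Sum>\<^sub># (image_mset vertices \<eta>))"

function symfac :: "'a rtree \<Rightarrow> nat" where
  "symfac (Node a \<eta>) =
     (\<Prod>\<rho>\<in>set_mset \<eta>. fact (count \<eta> \<rho>) * symfac \<rho> ^ count \<eta> \<rho>)"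
  by pat_completeness auto
termination
proof (relation "Wellfounded.measure vertices")
  fix a :: 'a and \<eta> :: "'a rtree multiset" and \<rho> assume "\<rho> \<in># \<eta>"
  then obtain \<eta>' where "\<eta> = add_mset \<rho> \<eta>'" by (meson mset_add)
  then show "(\<rho>, Node a \<eta>) \<in> Wellfounded.measure vertices" by simp
qed simp

definition trees_upto :: "nat \<Rightarrow> 'a rtree set" where
  "trees_upto p = {\<tau>. vertices \<tau> \<le> p}"

lemma finite_trees_upto: "finite (trees_upto p :: 'a::finite rtree set)"
proof (induction p)
  case 0
  have "vertices \<tau> \<noteq> 0" for \<tau> :: "'a rtree" by (cases \<tau>) simp
  then have "trees_upto 0 = ({} :: 'a rtree set)" by (auto simp: trees_upto_def)
  then show ?case by simp
next
  case (Suc p)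
  let ?L = "{xs. set xs \<subseteq> (trees_upto p :: 'a rtree set) \<and> length xs \<le> p}"
  have pos: "1 \<le> vertices \<tau>" for \<tau> :: "'a rtree" by (cases \<tau>) simp
  have sz: "size \<eta> \<le> \<Sum>\<^sub># (image_mset vertices \<eta>)" for \<eta> :: "'a rtree multiset"
  proof (induction \<eta>)
    case (add \<tau> \<eta>)
    then show ?case using pos[of \<tau>] by simp
  qed simp
  have "trees_upto (Suc p) \<subseteq> (\<lambda>(a, xs). Node a (mset xs)) ` (UNIV \<times> ?L)"
  proof
    fix \<tau> :: "'a rtree" assume \<tau>: "\<tau> \<in> trees_upto (Suc p)"
    obtain a \<eta> where [simp]: "\<tau> = Node a \<eta>" by (cases \<tau>)
    obtain xs where xs: "mset xs = \<eta>" using ex_mset by blast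
    have le: "\<Sum>\<^sub># (image_mset vertices \<eta>) \<le> p" using \<tau> by (simp add: trees_upto_def)
    have "vertices \<rho> \<le> p" if "\<rho> \<in># \<eta>" for \<rho>
    proof -
      from that obtain \<eta>' where "\<eta> = add_mset \<rho> \<eta>'" by (meson mset_add)
      with le show ?thesis by simp
    qed
    then have "xs \<in> ?L" using le sz[of \<eta>] xs by (auto simp: trees_upto_def)
    with xs show "\<tau> \<in> (\<lambda>(a, xs). Node a (mset xs)) ` (UNIV \<times> ?L)"
      by (intro image_eqI[of _ _ "(a, xs)"]) auto
  qed
  moreover have "finite ?L" by (rule finite_lists_length_le[OF Suc])
  ultimately show ?case by (meson finite_SigmaI finite finite_imageI finite_subset)
qed

text \<open>
  \<open>F([\<tau>\<^sub>1 \<cdots> \<tau>\<^sub>n]\<^sub>a)(y) = D\<^sup>n F\<^sub>a(y)[F(\<tau>\<^sub>1)(y), \<dots>, F(\<tau>\<^sub>n)(y)]\<close>. The branches form a multiset,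
  which is enumerated as a list in some order; the order is immaterial as soon as \<open>F\<^sub>a\<close> is
  \<open>n\<close> times continuously differentiable.
\<close>
primrec elem_diff ::
    "('m \<Rightarrow> 'a::euclidean_space \<Rightarrow> 'a) \<Rightarrow> 'm rtree \<Rightarrow> 'a \<Rightarrow> 'a" where
  "elem_diff F (Node a \<eta>) = (\<lambda>y.
     nderiv (F a) (map (\<lambda>g. g y) (SOME gs. mset gs = image_mset (elem_diff F) \<eta>)) y)"

text \<open>Product of scalar controlled paths, with the Leibniz rule for the Gubinelli derivative.\<close>
definition cpath_prod :: "('d::finite, real) cpath multiset \<Rightarrow> ('d, real) cpath" where
  "cpath_prod M =
     (\<lambda>t. \<Prod>h\<in>#M. fst h t,
      \<lambda>r. \<Sum>h\<in>#M. (\<Prod>g\<in>#M - {#h#}. fst g r) *\<^sub>R snd h r)"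

definition component :: "('d::finite, real ^ 'm) cpath \<Rightarrow> 'm::finite \<Rightarrow> ('d, real) cpath" where
  "component ZZ a =
     (\<lambda>t. fst ZZ t $ a, \<lambda>t. Blinfun (\<lambda>z. z $ a) o\<^sub>L snd ZZ t)"

text \<open>
  \<open>tree_coeff XX ZZ s \<tau>\<close> is the path \<open>t \<mapsto> Z\<^sup>\<tau>\<^bsub>s,t\<^esub>\<close> with its Gubinelli derivative; in the recursion
  \<open>H\<close> is \<open>Z\<^sup>\<eta>\<^bsub>s,\<cdot>\<^esub>\<close>.
\<close>
primrec tree_coeff ::
    "(real \<Rightarrow> real \<Rightarrow> real ^ 'd ^ 'd) \<Rightarrow> ('d::finite, real ^ 'm) cpath \<Rightarrow> real
       \<Rightarrow> 'm::finite rtree \<Rightarrow> ('d, real) cpath" where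
  "tree_coeff XX ZZ s (Node a \<eta>) =
     (let H = cpath_prod (image_mset (tree_coeff XX ZZ s) \<eta>)
      in (\<lambda>t. rough_integral XX s t (scalar_integrand H) (component ZZ a),
          \<lambda>r. fst H r *\<^sub>R snd (component ZZ a) r))"

definition B_series ::
    "nat \<Rightarrow> ('m::finite rtree \<Rightarrow> real) \<Rightarrow> ('m \<Rightarrow> real ^ 'e \<Rightarrow> real ^ 'e)
       \<Rightarrow> (real \<Rightarrow> real \<Rightarrow> real ^ 'd ^ 'd) \<Rightarrow> ('d::finite, real ^ 'm) cpath
       \<Rightarrow> real ^ 'e \<Rightarrow> real \<Rightarrow> real \<Rightarrow> real ^ 'e" where
  "B_series p \<phi> F XX ZZ y s t =
     y + (\<Sum>\<tau>\<in>trees_upto p.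
            (\<phi> \<tau> / real (symfac \<tau>) * fst (tree_coeff XX ZZ s \<tau>) t) *\<^sub>R elem_diff F \<tau> y)"

end

theory Submission
  imports Defs "HOL-Combinatorics.Multiset_Permutations"
begin

text \<open>
  Write \<open>B\<^sub>q(s, r)\<close> for the series truncated to trees with at most \<open>q\<close> vertices and expanded at \<open>Y s\<close>.
  The claim is an instance of a statement about controlled paths that can be proved by induction on
  \<open>q\<close>: the path \<open>r \<mapsto> Y r - B\<^sub>q(s, r)\<close>, started at \<open>s\<close> and taken together with its Gubinelli
  derivative, has order \<open>q + 1\<close>. Order \<open>k\<close> (\<open>rough_path.order\<close>) means that, uniformly in the
  starting time, the value is \<open>O(|r - s|\<^bsup>k \<alpha>\<^esup>)\<close>, the derivative \<open>O(|r - s|\<^bsup>(k - 1) \<alpha>\<^esup>)\<close>, and the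
  increment of the derivative and the controlled remainder over \<open>[u, v] \<subseteq> [s, r]\<close> are
  \<open>O(|r - s|\<^bsup>(k - 2) \<alpha>\<^esup>)\<close> times \<open>|v - u|\<^bsup>\<alpha>\<^esup>\<close> and \<open>|v - u|\<^bsup>2 \<alpha>\<^esup>\<close>, where \<open>k - 1\<close> and \<open>k - 2\<close>
  are cut off at zero. Carrying the derivative and the
  remainder along is what makes the induction possible, because the rough integral sees both.

  Two facts about orders do the analysis. Orders add under multiplication (\<open>order_mult\<close>), and
  integration against a component of \<open>Z\<close> raises the order by one (\<open>order_integral\<close>). The second is the
  sewing lemma (\<open>sewing\<close>): the compensated Riemann sums have an additivity defect of order \<open>3 \<alpha> > 1\<close>
  in the length of a cell, with the factor \<open>|r - s|\<^bsup>(k - 2) \<alpha>\<^esup>\<close> in front. In particular the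
  coefficient \<open>Z\<^sup>\<tau>\<close> of a tree has order \<open>|\<tau>|\<close> (\<open>order_tree\<close>).

  For the inductive step, expand \<open>F\<^sub>a\<close> along \<open>Y\<close> around \<open>Y s\<close> by Taylor's formula. The Taylor
  remainder of degree \<open>q\<close> has order \<open>q + 1\<close> (\<open>order_taylor_rem\<close>), since differentiating it lowers its
  degree of vanishing by one, exactly as the definition of order demands. In the Taylor polynomial
  replace \<open>Y - Y s\<close> by \<open>B\<^sub>q - Y s\<close>, at the cost of a term of order \<open>q + 1\<close>, and multiply out. Products
  of coefficients of trees with more than \<open>q\<close> vertices in total have order \<open>q + 1\<close>. The remaining ones
  are indexed by lists of trees; as the derivatives of \<open>F\<^sub>a\<close> are symmetric, the lists that enumerate the
  same forest \<open>\<eta>\<close> give equal terms, and counting them turns \<open>1 / n!\<close> into \<open>1 / \<sigma>([\<eta>]\<^sub>a)\<close>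
  (\<open>symfac_Node_reciprocal\<close>). So \<open>F\<^sub>a(Y)\<close> equals a sum over forests with at most \<open>q\<close> vertices up to
  order \<open>q + 1\<close> (\<open>order_field_expansion\<close>). Integrating against \<open>Z\<^sup>a\<close> and summing over \<open>a\<close> produces
  \<open>Y - Y s\<close> on the left and \<open>B\<^bsub>q + 1\<^esub> - Y s\<close> on the right, up to order \<open>q + 2\<close> (\<open>order_series_step\<close>).

  Values and Gubinelli derivatives are paired into jets, which form a commutative ring, and all
  identities are proved for scalar components; vectors appear only in the last step.
\<close>

section \<open>Sewing along partitions\<close>

definition germ_sum :: "(real \<Rightarrow> real \<Rightarrow> 'b::comm_monoid_add) \<Rightarrow> real list \<Rightarrow> 'b" where
  "germ_sum \<Xi> P = (\<Sum>(u, v)\<leftarrow>cells P. \<Xi> u v)"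

definition mesh_less :: "real \<Rightarrow> real list \<Rightarrow> bool" where
  "mesh_less \<delta> P \<longleftrightarrow> (\<forall>(u, v)\<in>set (cells P). v - u < \<delta>)"

text \<open>
  The solution \<open>C\<close> of \<open>C = 2\<^bsup>1 - \<theta>\<^esup> C + 2\<close>, which is positive for \<open>\<theta> > 1\<close>.
\<close>
definition sewing_const :: "real \<Rightarrow> real" where
  "sewing_const \<theta> = 2 / (1 - 2 powr (1 - \<theta>))"

lemma sewing_const_pos: "1 < \<theta> \<Longrightarrow> 0 < sewing_const \<theta>"
  using powr_less_mono[of "1 - \<theta>" 0 2] by (simp add: sewing_const_def)

lemma sewing_const_fixed_point: "1 < \<theta> \<Longrightarrow> sewing_const \<theta> * 2 powr (1 - \<theta>) + 2 = sewing_const \<theta>"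
  using powr_less_mono[of "1 - \<theta>" 0 2] by (simp add: sewing_const_def field_simps)

lemma cells_simps [simp]:
  "cells [] = []" "cells [x] = []" "cells (x # y # zs) = (x, y) # cells (y # zs)"
  by (simp_all add: cells_def)

lemma germ_sum_simps [simp]:
  "germ_sum \<Xi> [] = 0" "germ_sum \<Xi> [x] = 0"
  "germ_sum \<Xi> (x # y # zs) = \<Xi> x y + germ_sum \<Xi> (y # zs)"
  by (simp_all add: germ_sum_def)

lemma mesh_less_simps [simp]:
  "mesh_less \<delta> []" "mesh_less \<delta> [x]"
  "mesh_less \<delta> (x # y # zs) \<longleftrightarrow> y - x < \<delta> \<and> mesh_less \<delta> (y # zs)"
  by (simp_all add: mesh_less_def)

lemma cells_append:
  "A \<noteq> [] \<Longrightarrow> B \<noteq> [] \<Longrightarrow> cells (A @ B) = cells A @ (last A, hd B) # cells B"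
proof (induction A rule: induct_list012)
  case (2 x)
  then show ?case by (cases B) auto
qed auto

lemma germ_sum_append:
  "A \<noteq> [] \<Longrightarrow> B \<noteq> [] \<Longrightarrow> germ_sum \<Xi> (A @ B) = germ_sum \<Xi> A + \<Xi> (last A) (hd B) + germ_sum \<Xi> B"
  by (simp add: germ_sum_def cells_append add.assoc)

lemma cells_join: "cells (A @ y # B) = cells (A @ [y]) @ cells (y # B)"
  by (cases "A = []") (simp_all add: cells_append)

lemma germ_sum_join: "germ_sum \<Xi> (A @ y # B) = germ_sum \<Xi> (A @ [y]) + germ_sum \<Xi> (y # B)"
  unfolding germ_sum_def by (subst cells_join) simp

lemma mesh_less_join: "mesh_less \<delta> (A @ y # B) \<longleftrightarrow> mesh_less \<delta> (A @ [y]) \<and> mesh_less \<delta> (y # B)"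
  unfolding mesh_less_def by (subst cells_join) auto

lemma sorted_hd_le_last:
  fixes P :: "real list"
  shows "sorted_wrt (<) P \<Longrightarrow> P \<noteq> [] \<Longrightarrow> hd P \<le> last P"
  by (cases P) (auto dest!: last_in_set simp: order_less_imp_le split: if_splits)

text \<open>
  Induction on the number of points gives a constant that does not depend on it. The midpoint of
  the interval lies in one cell \<open>(u, v)\<close>; cutting that cell out leaves two sub-partitions of at most
  half the length, and since \<open>\<theta> > 1\<close> the resulting recursion \<open>C \<mapsto> 2\<^bsup>1 - \<theta>\<^esup> C + 2\<close> for the constant has the fixed point
  \<^const>\<open>sewing_const\<close>.
\<close>
lemma germ_sum_bound:
  fixes \<Xi> :: "real \<Rightarrow> real \<Rightarrow> 'b::real_normed_vector"
  assumes \<theta>: "1 < \<theta>" and K: "0 \<le> K"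
    and \<delta>: "\<And>u m v. s \<le> u \<Longrightarrow> u \<le> m \<Longrightarrow> m \<le> v \<Longrightarrow> v \<le> t \<Longrightarrow>
               norm (\<Xi> u v - \<Xi> u m - \<Xi> m v) \<le> K * (v - u) powr \<theta>"
  shows "sorted_wrt (<) P \<Longrightarrow> P \<noteq> [] \<Longrightarrow> s \<le> hd P \<Longrightarrow> last P \<le> t \<Longrightarrow>
     norm (germ_sum \<Xi> P - \<Xi> (hd P) (last P)) \<le> sewing_const \<theta> * K * (last P - hd P) powr \<theta>"
proof (induction P rule: length_induct)
  case (1 P)
  note IH = 1(1)[rule_format] and prems = 1(2-5)
  let ?C = "sewing_const \<theta>"
  have C: "0 < ?C" using sewing_const_pos[OF \<theta>] .
  show ?case
  proof (cases "length P = 1")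
    case True
    then obtain x where P: "P = [x]" by (auto simp: length_Suc_conv)
    have "norm (\<Xi> x x - \<Xi> x x - \<Xi> x x) \<le> 0" using \<delta>[of x x x] prems P by simp
    then show ?thesis using P by simp
  next
    case False
    then have len: "2 \<le> length P" using prems by (cases P) (auto simp: Suc_le_eq)
    have hl: "hd P < last P"
    proof -
      obtain x y zs where P: "P = x # y # zs" using len
        by (metis One_nat_def Suc_1 Suc_le_length_iff)
      have "last P \<in> set (y # zs)" using P by (metis last_ConsR last_in_set list.distinct(1))
      then show ?thesis using prems(1) P by auto
    qed
    \<comment> \<open>\<open>A\<close> ends and \<open>B\<close> begins at the two ends of the cell containing the midpoint.\<close>
    define m where "m = (hd P + last P) / 2"
    define A where "A = takeWhile (\<lambda>x. x \<le> m) P"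
    define B where "B = dropWhile (\<lambda>x. x \<le> m) P"
    have P: "P = A @ B" by (simp add: A_def B_def)
    have A: "A \<noteq> []" using prems(2) hl by (cases P) (auto simp: A_def m_def)
    have B: "B \<noteq> []"
    proof
      assume "B = []"
      then have "\<forall>x\<in>set P. x \<le> m" by (simp add: B_def dropWhile_eq_Nil_conv)
      then have "last P \<le> m" using prems(2) by simp
      then show False using hl by (simp add: m_def)
    qed
    define u v where "u = last A" and "v = hd B"
    have um: "u \<le> m" using set_takeWhileD[of u] A unfolding u_def A_def by (metis last_in_set)
    have mv: "m < v" using hd_dropWhile[of "\<lambda>x. x \<le> m" P] B unfolding v_def B_def by simp
    have hd: "hd A = hd P" "last B = last P" using P A B by auto
    have srt: "sorted_wrt (<) A" "sorted_wrt (<) B" using prems(1) P by (auto simp: sorted_wrt_append)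
    have ord: "hd P \<le> u" "v \<le> last P"
      using sorted_hd_le_last[OF srt(1) A] sorted_hd_le_last[OF srt(2) B] hd
      by (auto simp: u_def v_def)
    let ?L = "last P - hd P"
    have half: "x powr \<theta> \<le> ?L powr \<theta> * 2 powr (- \<theta>)" if "0 \<le> x" "x \<le> ?L / 2" for x
    proof -
      have "x powr \<theta> \<le> (?L * (1/2)) powr \<theta>" using that \<theta> by (intro powr_mono2) auto
      also have "\<dots> = ?L powr \<theta> * (1/2) powr \<theta>" by (rule powr_mult)
      also have "(1/2) powr \<theta> = 2 powr (- \<theta>)" by (simp add: powr_minus powr_divide divide_simps)
      finally show ?thesis .
    qed
    have "norm (germ_sum \<Xi> A - \<Xi> (hd P) u) \<le> ?C * K * (u - hd P) powr \<theta>"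
      by (rule IH[of A, folded u_def, unfolded hd]) (use srt A B P ord um mv prems in \<open>auto simp: u_def\<close>)
    also have "\<dots> \<le> ?C * K * (?L powr \<theta> * 2 powr (- \<theta>))"
      using C K um ord by (intro mult_left_mono half) (auto simp: m_def field_simps)
    finally have iA: "norm (germ_sum \<Xi> A - \<Xi> (hd P) u) \<le> ?C * K * (?L powr \<theta> * 2 powr (- \<theta>))" .
    have "norm (germ_sum \<Xi> B - \<Xi> v (last P)) \<le> ?C * K * (last P - v) powr \<theta>"
      by (rule IH[of B, folded v_def, unfolded hd]) (use srt A B P ord um mv prems in \<open>auto simp: v_def\<close>)
    also have "\<dots> \<le> ?C * K * (?L powr \<theta> * 2 powr (- \<theta>))"
      using C K mv ord by (intro mult_left_mono half) (auto simp: m_def field_simps)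
    finally have iB: "norm (germ_sum \<Xi> B - \<Xi> v (last P)) \<le> ?C * K * (?L powr \<theta> * 2 powr (- \<theta>))" .
    have d1: "norm (\<Xi> (hd P) (last P) - \<Xi> (hd P) u - \<Xi> u (last P)) \<le> K * ?L powr \<theta>"
      using \<delta>[of "hd P" u "last P"] ord um mv prems by auto
    have "norm (\<Xi> u (last P) - \<Xi> u v - \<Xi> v (last P)) \<le> K * (last P - u) powr \<theta>"
      using \<delta>[of u v "last P"] ord um mv prems by auto
    also have "\<dots> \<le> K * ?L powr \<theta>" using K ord um mv \<theta> by (intro mult_left_mono powr_mono2) auto
    finally have d2: "norm (\<Xi> u (last P) - \<Xi> u v - \<Xi> v (last P)) \<le> K * ?L powr \<theta>" .
    have "germ_sum \<Xi> P - \<Xi> (hd P) (last P)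
        = (germ_sum \<Xi> A - \<Xi> (hd P) u) + (germ_sum \<Xi> B - \<Xi> v (last P))
          - (\<Xi> (hd P) (last P) - \<Xi> (hd P) u - \<Xi> u (last P))
          - (\<Xi> u (last P) - \<Xi> u v - \<Xi> v (last P))"
      using germ_sum_append[OF A B, of \<Xi>] P[symmetric] unfolding u_def v_def by simp
    also have "norm \<dots> \<le> norm (germ_sum \<Xi> A - \<Xi> (hd P) u) + norm (germ_sum \<Xi> B - \<Xi> v (last P))
        + norm (\<Xi> (hd P) (last P) - \<Xi> (hd P) u - \<Xi> u (last P))
        + norm (\<Xi> u (last P) - \<Xi> u v - \<Xi> v (last P))"
      by (intro order_trans[OF norm_triangle_ineq4] add_right_mono norm_triangle_ineq)
    also have "\<dots> \<le> 2 * (?C * K * (?L powr \<theta> * 2 powr (- \<theta>))) + 2 * (K * ?L powr \<theta>)"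
      using iA iB d1 d2 by simp
    also have "\<dots> = (?C * (2 * 2 powr (- \<theta>)) + 2) * (K * ?L powr \<theta>)" by (simp add: algebra_simps)
    also have "2 * 2 powr (- \<theta>) = (2::real) powr (1 - \<theta>)" using powr_add[of "2::real" 1 "-\<theta>"] by simp
    finally show ?thesis by (simp add: sewing_const_fixed_point[OF \<theta>] mult.assoc)
  qed
qed

text \<open>
  Each cell of \<open>P\<close> is partitioned by \<open>Q\<close>, so the previous bound applies cell by cell; a cell of
  length \<open>l < \<eta>\<close> contributes \<open>l\<^bsup>\<theta>\<^esup> \<le> \<eta>\<^bsup>\<theta> - 1\<^esup> l\<close>, and the lengths add up.
\<close>
lemma germ_sum_refinement_bound:
  fixes \<Xi> :: "real \<Rightarrow> real \<Rightarrow> 'b::real_normed_vector"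
  assumes \<theta>: "1 < \<theta>" and K: "0 \<le> K"
    and \<delta>: "\<And>u m v. s \<le> u \<Longrightarrow> u \<le> m \<Longrightarrow> m \<le> v \<Longrightarrow> v \<le> t \<Longrightarrow>
               norm (\<Xi> u v - \<Xi> u m - \<Xi> m v) \<le> K * (v - u) powr \<theta>"
  shows "sorted_wrt (<) P \<Longrightarrow> P \<noteq> [] \<Longrightarrow> sorted_wrt (<) Q \<Longrightarrow> Q \<noteq> [] \<Longrightarrow> set P \<subseteq> set Q \<Longrightarrow>
     hd P = hd Q \<Longrightarrow> last P = last Q \<Longrightarrow> s \<le> hd P \<Longrightarrow> last P \<le> t \<Longrightarrow> mesh_less \<eta> P \<Longrightarrow>
     norm (germ_sum \<Xi> Q - germ_sum \<Xi> P) \<le> sewing_const \<theta> * K * \<eta> powr (\<theta> - 1) * (last P - hd P)"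
proof (induction P arbitrary: Q rule: induct_list012)
  case (2 x)
  have "Q = [x]"
  proof (cases Q)
    case (Cons y ys)
    have "ys = []"
    proof (rule ccontr)
      assume "ys \<noteq> []"
      then have "last Q \<in> set ys" using Cons by simp
      then show False using 2 Cons by auto
    qed
    then show ?thesis using 2 Cons by simp
  qed (use 2 in simp)
  then show ?case by simp
next
  case (3 x y zs)
  note prems = "3.prems"
  let ?C = "sewing_const \<theta>"
  have C: "0 < ?C" using sewing_const_pos[OF \<theta>] .
  have xy: "x < y" using prems by simp
  have "y \<in> set Q" using prems by simp
  then obtain A B where Q: "Q = A @ y # B" by (meson split_list)
  have A: "A \<noteq> []" using prems Q xy by (cases A) auto
  then have hdA: "hd A = x" using prems Q by simp
  have srt: "sorted_wrt (<) (A @ [y])" "sorted_wrt (<) (y # B)" and lt: "\<forall>a\<in>set A. a < y"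
    using prems(3) Q by (auto simp: sorted_wrt_append)
  have le: "y \<le> last (y # zs)" using prems sorted_hd_le_last[of "y # zs"] by auto
  have lastB: "last (y # B) = last (y # zs)" using prems Q by auto
  have \<eta>: "y - x < \<eta>" using prems by simp
  have "norm (germ_sum \<Xi> (A @ [y]) - \<Xi> (hd (A @ [y])) (last (A @ [y])))
      \<le> ?C * K * (last (A @ [y]) - hd (A @ [y])) powr \<theta>"
    by (rule germ_sum_bound[OF \<theta> K \<delta>]) (use srt A hdA prems le in auto)
  then have "norm (germ_sum \<Xi> (A @ [y]) - \<Xi> x y) \<le> ?C * K * (y - x) powr \<theta>"
    using A hdA by simp
  also have "(y - x) powr \<theta> = (y - x) powr (\<theta> - 1) * (y - x)"
    using powr_add[of "y - x" "\<theta> - 1" 1] xy by simp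
  also have "?C * K * \<dots> \<le> ?C * K * (\<eta> powr (\<theta> - 1) * (y - x))"
    using C K xy \<eta> \<theta> by (intro mult_left_mono mult_right_mono powr_mono2) auto
  finally have b1: "norm (germ_sum \<Xi> (A @ [y]) - \<Xi> x y) \<le> ?C * K * \<eta> powr (\<theta> - 1) * (y - x)"
    by (simp add: mult.assoc)
  have "set (y # zs) \<subseteq> set (y # B)"
  proof
    fix z assume z: "z \<in> set (y # zs)"
    then have "z \<in> set Q" "y \<le> z" using prems by auto
    then show "z \<in> set (y # B)" using Q lt by auto
  qed
  then have "norm (germ_sum \<Xi> (y # B) - germ_sum \<Xi> (y # zs))
      \<le> ?C * K * \<eta> powr (\<theta> - 1) * (last (y # zs) - hd (y # zs))"
    using prems srt lastB xy by (intro "3.IH") auto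
  then have b2: "norm (germ_sum \<Xi> (y # B) - germ_sum \<Xi> (y # zs))
      \<le> ?C * K * \<eta> powr (\<theta> - 1) * (last (y # zs) - y)" by simp
  have "germ_sum \<Xi> Q - germ_sum \<Xi> (x # y # zs)
      = (germ_sum \<Xi> (A @ [y]) - \<Xi> x y) + (germ_sum \<Xi> (y # B) - germ_sum \<Xi> (y # zs))"
    using germ_sum_join[of \<Xi> A y B] Q by simp
  also have "norm \<dots> \<le> ?C * K * \<eta> powr (\<theta> - 1) * (y - x) + ?C * K * \<eta> powr (\<theta> - 1) * (last (y # zs) - y)"
    using norm_triangle_mono[OF b1 b2] .
  also have "\<dots> = ?C * K * \<eta> powr (\<theta> - 1) * (last (y # zs) - x)" by (simp add: algebra_simps)
  finally show ?case by simp
qed simp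

lemma partition_with_small_mesh:
  assumes "0 < \<delta>" "s \<le> t"
  obtains P where "P \<in> partitions s t" "mesh_less \<delta> P"
proof -
  have "\<exists>P\<in>partitions s t. mesh_less \<delta> P" if "s \<le> t" "t - s \<le> real n * (\<delta> / 2)" for n s
    using that
  proof (induction n arbitrary: s)
    case 0
    then have "[s] \<in> partitions s t" by (auto simp: partitions_def)
    then show ?case using mesh_less_simps(2) by blast
  next
    case (Suc n)
    show ?case
    proof (cases "t - s < \<delta> / 2")
      case True
      show ?thesis
      proof (cases "s = t")
        case True
        then have "[s] \<in> partitions s t" by (auto simp: partitions_def)
        then show ?thesis using mesh_less_simps(2) by blast
      next
        case False
        then have "[s, t] \<in> partitions s t" using Suc by (auto simp: partitions_def)
        then show ?thesis using True assms(1) by (intro bexI[of _ "[s, t]"]) auto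
      qed
    next
      case False
      then obtain P where P: "P \<in> partitions (s + \<delta> / 2) t" "mesh_less \<delta> P"
        using Suc.IH[of "s + \<delta> / 2"] Suc.prems by (auto simp: algebra_simps)
      then obtain zs where zs: "P = (s + \<delta> / 2) # zs" by (cases P) (auto simp: partitions_def)
      have "s # P \<in> partitions s t" using P zs assms(1) by (force simp: partitions_def)
      moreover have "mesh_less \<delta> (s # P)" using P zs assms(1) by simp
      ultimately show ?thesis by blast
    qed
  qed
  moreover obtain n :: nat where "(t - s) / (\<delta> / 2) \<le> real n" using real_arch_simple by blast
  then have "t - s \<le> real n * (\<delta> / 2)" using assms(1) by (simp add: field_simps)
  ultimately show thesis using assms(2) that by blast
qed

lemma eventually_mesh_filter:
  "eventually Q (mesh_filter s t) \<longleftrightarrow> (\<exists>\<delta>>0. \<forall>P\<in>partitions s t. mesh_less \<delta> P \<longrightarrow> Q P)"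
  unfolding mesh_filter_def
proof (subst eventually_INF_base)
  fix a b :: real assume "a \<in> {0<..}" "b \<in> {0<..}"
  then show "\<exists>x\<in>{0<..}. principal {P \<in> partitions s t. \<forall>(u, v)\<in>set (cells P). v - u < x}
     \<le> inf (principal {P \<in> partitions s t. \<forall>(u, v)\<in>set (cells P). v - u < a})
        (principal {P \<in> partitions s t. \<forall>(u, v)\<in>set (cells P). v - u < b})"
    by (intro bexI[of _ "min a b"]) auto
qed (auto simp: eventually_principal mesh_less_def)

lemma mesh_filter_neq_bot: "s \<le> t \<Longrightarrow> mesh_filter s t \<noteq> bot"
  unfolding trivial_limit_def eventually_mesh_filter using partition_with_small_mesh by metis

text \<open>
  Two partitions of small mesh are compared through their common refinement, so the Riemann
  sums of a germ whose defect of additivity is of order \<open>\<theta> > 1\<close> form a Cauchy net.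
\<close>
theorem sewing:
  fixes \<Xi> :: "real \<Rightarrow> real \<Rightarrow> 'b::banach"
  assumes st: "s \<le> t" and \<theta>: "1 < \<theta>" and K: "0 \<le> K"
    and \<delta>: "\<And>u m v. s \<le> u \<Longrightarrow> u \<le> m \<Longrightarrow> m \<le> v \<Longrightarrow> v \<le> t \<Longrightarrow>
               norm (\<Xi> u v - \<Xi> u m - \<Xi> m v) \<le> K * (v - u) powr \<theta>"
  obtains I where "(germ_sum \<Xi> \<longlongrightarrow> I) (mesh_filter s t)"
    and "norm (I - \<Xi> s t) \<le> sewing_const \<theta> * K * (t - s) powr \<theta>"
proof -
  let ?C = "sewing_const \<theta>"
  have C: "0 < ?C" using sewing_const_pos[OF \<theta>] .
  have close: "norm (germ_sum \<Xi> P - germ_sum \<Xi> Q) \<le> 2 * (?C * K * \<eta> powr (\<theta> - 1) * (t - s))"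
    if P: "P \<in> partitions s t" "mesh_less \<eta> P" and Q: "Q \<in> partitions s t" "mesh_less \<eta> Q" for P Q \<eta>
  proof -
    define R where "R = sorted_list_of_set (set P \<union> set Q)"
    have R: "sorted_wrt (<) R" "set R = set P \<union> set Q" by (auto simp: R_def)
    have mem: "s \<le> x \<and> x \<le> t" if "A \<in> partitions s t" "x \<in> set A" for A x
    proof -
      obtain B C where A: "A = B @ x # C" using split_list[OF \<open>x \<in> set A\<close>] by blast
      have 1: "s \<le> x" using that A by (cases B) (auto simp: partitions_def sorted_wrt_append)
      have "last (x # C) = t" using that A by (auto simp: partitions_def)
      then have "x \<le> t" using that A sorted_hd_le_last[of "x # C"]
        by (auto simp: partitions_def sorted_wrt_append)
      with 1 show ?thesis ..
    qed
    have ends: "s \<in> set A \<and> t \<in> set A" if "A \<in> partitions s t" for A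
      using that by (auto simp: partitions_def)
    have Rne: "R \<noteq> []" using R ends[OF P(1)] by auto
    have hdR: "hd R = s"
    proof (cases R)
      case (Cons x xs)
      then have "s \<le> x" using R(2) mem P(1) Q(1) by (metis UnE list.set_intros(1))
      moreover have "s \<in> set R" using R(2) ends[OF P(1)] by simp
      ultimately show ?thesis using Cons R(1) by auto
    qed (use Rne in simp)
    have lastR: "last R = t"
    proof (cases R rule: rev_cases)
      case (snoc xs x)
      then have "x \<in> set R" by simp
      then have "x \<le> t" using R(2) mem P(1) Q(1) by blast
      moreover have "t \<in> set R" using R(2) ends[OF P(1)] by simp
      ultimately show ?thesis using snoc R(1) by (auto simp: sorted_wrt_append)
    qed (use Rne in simp)
    have ref: "norm (germ_sum \<Xi> R - germ_sum \<Xi> A) \<le> ?C * K * \<eta> powr (\<theta> - 1) * (t - s)"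
      if A: "A \<in> partitions s t" "mesh_less \<eta> A" "set A \<subseteq> set R" for A
      using germ_sum_refinement_bound[OF \<theta> K \<delta>, of s t A R \<eta>] A R Rne hdR lastR
      by (auto simp: partitions_def)
    have "norm ((germ_sum \<Xi> R - germ_sum \<Xi> Q) - (germ_sum \<Xi> R - germ_sum \<Xi> P))
        \<le> ?C * K * \<eta> powr (\<theta> - 1) * (t - s) + ?C * K * \<eta> powr (\<theta> - 1) * (t - s)"
      using ref[OF P] ref[OF Q] R(2) by (intro order_trans[OF norm_triangle_ineq4 add_mono]) auto
    then show ?thesis by (simp add: mult_ac)
  qed
  have small: "\<exists>\<eta>>0. 2 * (?C * K * \<eta> powr (\<theta> - 1) * (t - s)) < e" if "0 < e" for e
  proof -
    have "((\<lambda>\<eta>. 2 * (?C * K * \<eta> powr (\<theta> - 1) * (t - s))) \<longlongrightarrow> 2 * (?C * K * 0 * (t - s))) (at_right 0)"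
    proof (intro tendsto_intros)
      have "((\<lambda>\<eta>::real. \<eta> powr (\<theta> - 1)) \<longlongrightarrow> 0 powr (\<theta> - 1)) (at_right 0)"
        by (rule tendsto_powr') (use \<theta> in \<open>auto simp: eventually_at_right_less eventually_mono[OF eventually_at_right_less]\<close>)
      then show "((\<lambda>\<eta>::real. \<eta> powr (\<theta> - 1)) \<longlongrightarrow> 0) (at_right 0)" by simp
    qed
    then have "eventually (\<lambda>\<eta>. 2 * (?C * K * \<eta> powr (\<theta> - 1) * (t - s)) < e) (at_right 0)"
      using that by (intro order_tendstoD) auto
    moreover have "eventually (\<lambda>\<eta>::real. 0 < \<eta>) (at_right 0)" by (simp add: eventually_at_right_less)
    ultimately have "eventually (\<lambda>\<eta>. 0 < \<eta> \<and> 2 * (?C * K * \<eta> powr (\<theta> - 1) * (t - s)) < e) (at_right 0)"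
      by eventually_elim simp
    from eventually_happens'[OF trivial_limit_at_right_real this] show ?thesis .
  qed
  have ne: "filtermap (germ_sum \<Xi>) (mesh_filter s t) \<noteq> bot"
    using mesh_filter_neq_bot[OF st] by (simp add: filtermap_bot_iff)
  have "cauchy_filter (filtermap (germ_sum \<Xi>) (mesh_filter s t))"
    unfolding cauchy_filter_metric_filtermap
  proof (intro allI impI)
    fix e :: real assume "0 < e"
    then obtain \<eta> where \<eta>: "\<eta> > 0" "2 * (?C * K * \<eta> powr (\<theta> - 1) * (t - s)) < e" using small by blast
    show "\<exists>P. eventually P (mesh_filter s t) \<and> (\<forall>x y. P x \<and> P y \<longrightarrow> dist (germ_sum \<Xi> x) (germ_sum \<Xi> y) < e)"
    proof (intro exI[of _ "\<lambda>P. P \<in> partitions s t \<and> mesh_less \<eta> P"] conjI allI impI)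
      show "\<forall>\<^sub>F P in mesh_filter s t. P \<in> partitions s t \<and> mesh_less \<eta> P"
        using \<eta> unfolding eventually_mesh_filter by blast
      show "dist (germ_sum \<Xi> P) (germ_sum \<Xi> Q) < e"
        if "(P \<in> partitions s t \<and> mesh_less \<eta> P) \<and> (Q \<in> partitions s t \<and> mesh_less \<eta> Q)" for P Q
        using close[of P \<eta> Q] that \<eta> by (auto simp: dist_norm)
    qed
  qed
  then obtain I where I: "(germ_sum \<Xi> \<longlongrightarrow> I) (mesh_filter s t)"
    using complete_UNIV[where ?'a = 'b] ne unfolding complete_uniform filterlim_def by auto
  have "norm (I - \<Xi> s t) \<le> ?C * K * (t - s) powr \<theta>"
  proof (rule tendsto_upperbound[OF _ _ mesh_filter_neq_bot[OF st]])
    show "((\<lambda>P. norm (germ_sum \<Xi> P - \<Xi> s t)) \<longlongrightarrow> norm (I - \<Xi> s t)) (mesh_filter s t)"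
      by (intro tendsto_intros I)
    have "norm (germ_sum \<Xi> P - \<Xi> s t) \<le> ?C * K * (t - s) powr \<theta>" if "P \<in> partitions s t" for P
      using germ_sum_bound[OF \<theta> K \<delta>, of s t P] that by (auto simp: partitions_def)
    then show "\<forall>\<^sub>F P in mesh_filter s t. norm (germ_sum \<Xi> P - \<Xi> s t) \<le> ?C * K * (t - s) powr \<theta>"
      unfolding eventually_mesh_filter by (intro exI[of _ 1]) auto
  qed
  with I show thesis using that by blast
qed

text \<open>
  Fine partitions of \<open>[s, u]\<close> and \<open>[u, t]\<close> concatenate to fine partitions of \<open>[s, t]\<close>, along which
  the sums are exactly additive.
\<close>
lemma germ_sum_limit_additive:
  fixes \<Xi> :: "real \<Rightarrow> real \<Rightarrow> 'b::real_normed_vector"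
  assumes "s \<le> u" "u \<le> t"
    and I: "(germ_sum \<Xi> \<longlongrightarrow> I) (mesh_filter s u)" and J: "(germ_sum \<Xi> \<longlongrightarrow> J) (mesh_filter u t)"
    and L: "(germ_sum \<Xi> \<longlongrightarrow> L) (mesh_filter s t)"
  shows "L = I + J"
proof (rule ccontr)
  assume "L \<noteq> I + J"
  define e where "e = norm (L - (I + J)) / 3"
  have e: "0 < e" using \<open>L \<noteq> I + J\<close> by (simp add: e_def)
  obtain a where a: "a > 0" "\<And>P. P \<in> partitions s u \<Longrightarrow> mesh_less a P \<Longrightarrow> dist (germ_sum \<Xi> P) I < e"
    using tendstoD[OF I e] unfolding eventually_mesh_filter by blast
  obtain b where b: "b > 0" "\<And>P. P \<in> partitions u t \<Longrightarrow> mesh_less b P \<Longrightarrow> dist (germ_sum \<Xi> P) J < e"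
    using tendstoD[OF J e] unfolding eventually_mesh_filter by blast
  obtain c where c: "c > 0" "\<And>P. P \<in> partitions s t \<Longrightarrow> mesh_less c P \<Longrightarrow> dist (germ_sum \<Xi> P) L < e"
    using tendstoD[OF L e] unfolding eventually_mesh_filter by blast
  define \<delta> where "\<delta> = min a (min b c)"
  have \<delta>: "0 < \<delta>" using a b c by (simp add: \<delta>_def)
  have mono: "mesh_less x P" if "mesh_less \<delta> P" "\<delta> \<le> x" for x P
    using that unfolding mesh_less_def by fastforce
  obtain P where P: "P \<in> partitions s u" "mesh_less \<delta> P"
    using partition_with_small_mesh[OF \<delta> assms(1)] by blast
  obtain Q where Q: "Q \<in> partitions u t" "mesh_less \<delta> Q"
    using partition_with_small_mesh[OF \<delta> assms(2)] by blast
  obtain A where A: "P = A @ [u]" using P(1) by (cases P rule: rev_cases) (auto simp: partitions_def)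
  obtain B where B: "Q = u # B" using Q(1) by (cases Q) (auto simp: partitions_def)
  have "A @ u # B \<in> partitions s t" using P(1) Q(1) A B
    by (cases A) (force simp: partitions_def sorted_wrt_append)+
  moreover have "mesh_less c (A @ u # B)" using A B
    using mono[OF P(2), of c] mono[OF Q(2), of c] by (subst mesh_less_join) (simp add: \<delta>_def)
  ultimately have "dist (germ_sum \<Xi> P + germ_sum \<Xi> Q) L < e"
    using c(2)[of "A @ u # B"] germ_sum_join[of \<Xi> A u B] A B by simp
  moreover have "dist (germ_sum \<Xi> P) I < e" using a(2)[OF P(1) mono[OF P(2)]] by (simp add: \<delta>_def)
  moreover have "dist (germ_sum \<Xi> Q) J < e" using b(2)[OF Q(1) mono[OF Q(2)]] by (simp add: \<delta>_def)
  moreover have "norm (L - (I + J)) \<le> dist (germ_sum \<Xi> P + germ_sum \<Xi> Q) L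
      + (dist (germ_sum \<Xi> P) I + dist (germ_sum \<Xi> Q) J)"
  proof -
    have "L - (I + J) = (germ_sum \<Xi> P - I + (germ_sum \<Xi> Q - J)) - (germ_sum \<Xi> P + germ_sum \<Xi> Q - L)" by simp
    also have "norm \<dots> \<le> norm (germ_sum \<Xi> P - I) + norm (germ_sum \<Xi> Q - J) + norm (germ_sum \<Xi> P + germ_sum \<Xi> Q - L)"
      by (intro order_trans[OF norm_triangle_ineq4] add_right_mono norm_triangle_ineq)
    finally show ?thesis by (simp add: dist_norm)
  qed
  ultimately have "norm (L - (I + J)) < 3 * e" by linarith
  then show False by (simp add: e_def)
qed

section \<open>Iterated derivatives and Taylor remainders\<close>

lemma nderiv_append: "nderiv f (vs @ ws) = nderiv (nderiv f ws) vs"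
  by (induction vs) auto

lemma Cb_bound:
  assumes "f \<in> Cb k" "j \<le> k"
  obtains B where "0 \<le> B" "\<And>vs y. length vs = j \<Longrightarrow> norm (nderiv f vs y) \<le> B * (\<Prod>v\<leftarrow>vs. norm v)"
proof -
  obtain B where B: "\<And>vs y. length vs = j \<Longrightarrow> norm (nderiv f vs y) \<le> B * (\<Prod>v\<leftarrow>vs. norm v)"
    using assms unfolding Cb_def by blast
  show thesis
  proof (rule that[of "\<bar>B\<bar>"])
    fix vs :: "'a list" and y assume "length vs = j"
    then have "norm (nderiv f vs y) \<le> B * (\<Prod>v\<leftarrow>vs. norm v)" by (rule B)
    also have "\<dots> \<le> \<bar>B\<bar> * (\<Prod>v\<leftarrow>vs. norm v)"
      by (intro mult_right_mono prod_list_nonneg) auto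
    finally show "norm (nderiv f vs y) \<le> \<bar>B\<bar> * (\<Prod>v\<leftarrow>vs. norm v)" .
  qed simp
qed

lemma nderiv_Cb:
  assumes f: "f \<in> Cb k" and ws: "length ws \<le> k"
  shows "nderiv f ws \<in> Cb (k - length ws)"
  unfolding Cb_def
proof (safe; unfold nderiv_append[symmetric])
  show "nderiv f (vs @ ws) differentiable at y" if "length vs < k - length ws" for vs y
    using f that unfolding Cb_def by simp
  show "continuous_on UNIV (nderiv f (vs @ ws))" if "length vs \<le> k - length ws" for vs
    using f that ws unfolding Cb_def by simp
  fix j assume j: "j \<le> k - length ws"
  then have "j + length ws \<le> k" using ws by simp
  from Cb_bound[OF f this] obtain B where
    B: "0 \<le> B" "\<And>vs y. length vs = j + length ws \<Longrightarrow> norm (nderiv f vs y) \<le> B * (\<Prod>v\<leftarrow>vs. norm v)"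
    by blast
  show "\<exists>B. \<forall>vs y. length vs = j \<longrightarrow> norm (nderiv f (vs @ ws) y) \<le> B * (\<Prod>v\<leftarrow>vs. norm v)"
    using B(2)[of "_ @ ws"] by (intro exI[of _ "B * (\<Prod>v\<leftarrow>ws. norm v)"]) (simp add: mult_ac)
qed

lemma nderiv_has_derivative:
  assumes "f \<in> Cb k" "length vs < k"
  shows "(nderiv f vs has_derivative (\<lambda>v. nderiv f (v # vs) y)) (at y)"
  using assms frechet_derivative_works[of "nderiv f vs" "at y"] by (simp add: Cb_def)

lemma nderiv_continuous:
  "f \<in> Cb k \<Longrightarrow> length vs \<le> k \<Longrightarrow> isCont (nderiv f vs) y"
  by (auto simp: Cb_def continuous_on_eq_continuous_at)

text \<open>
  The mean value theorem, first along \<open>u\<close> for the difference of \<open>f\<close> in direction \<open>v\<close>, then along \<open>v\<close>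
  for the derivative of \<open>f\<close> in direction \<open>u\<close>.
\<close>
lemma second_difference_mean_value:
  fixes f :: "'a::euclidean_space \<Rightarrow> real"
  assumes f: "f \<in> Cb k" "2 \<le> k" and h: "0 < h"
  obtains a b where "0 < a" "a < h" "0 < b" "b < h"
    "f (y + h *\<^sub>R u + h *\<^sub>R v) - f (y + h *\<^sub>R u) - f (y + h *\<^sub>R v) + f y
       = h * (h * nderiv f [v, u] (y + a *\<^sub>R u + b *\<^sub>R v))"
proof -
  have d1: "(f has_derivative (\<lambda>w. nderiv f [w] z)) (at z)" for z
    using nderiv_has_derivative[of f k "[]" z] f by simp
  have d2: "(nderiv f [u] has_derivative (\<lambda>w. nderiv f [w, u] z)) (at z)" for z
    using nderiv_has_derivative[of f k "[u]" z] f by simp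
  have lin1: "nderiv f [c *\<^sub>R w] z = c * nderiv f [w] z" for c w z
    using linear_cmul[OF has_derivative_linear[OF d1]] by simp
  have lin2: "nderiv f [c *\<^sub>R w, u] z = c * nderiv f [w, u] z" for c w z
    using linear_cmul[OF has_derivative_linear[OF d2]] by simp
  have D1: "((\<lambda>a. f (y + a *\<^sub>R u + c)) has_real_derivative nderiv f [u] (y + a *\<^sub>R u + c)) (at a)" for a c
    unfolding has_field_derivative_def
    by (rule has_derivative_eq_rhs[OF has_derivative_compose[OF _ d1]], (rule derivative_intros)+)
      (auto simp: lin1 mult.commute simp del: nderiv.simps)
  have D2: "((\<lambda>b. nderiv f [u] (c + b *\<^sub>R v)) has_real_derivative nderiv f [v, u] (c + b *\<^sub>R v)) (at b)" for b c
    unfolding has_field_derivative_def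
    by (rule has_derivative_eq_rhs[OF has_derivative_compose[OF _ d2]], (rule derivative_intros)+)
      (auto simp: lin2 mult.commute simp del: nderiv.simps)
  let ?\<phi> = "\<lambda>a. f (y + a *\<^sub>R u + h *\<^sub>R v) - f (y + a *\<^sub>R u + 0)"
  obtain a where a: "0 < a" "a < h"
    "?\<phi> h - ?\<phi> 0 = (h - 0) * (nderiv f [u] (y + a *\<^sub>R u + h *\<^sub>R v) - nderiv f [u] (y + a *\<^sub>R u + 0))"
    using MVT2[OF h, of ?\<phi> "\<lambda>a. nderiv f [u] (y + a *\<^sub>R u + h *\<^sub>R v) - nderiv f [u] (y + a *\<^sub>R u + 0)"]
      DERIV_diff[OF D1 D1] by blast
  let ?\<psi> = "\<lambda>b. nderiv f [u] (y + a *\<^sub>R u + b *\<^sub>R v)"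
  obtain b where b: "0 < b" "b < h" "?\<psi> h - ?\<psi> 0 = (h - 0) * nderiv f [v, u] (y + a *\<^sub>R u + b *\<^sub>R v)"
    using MVT2[OF h, of ?\<psi> "\<lambda>b. nderiv f [v, u] (y + a *\<^sub>R u + b *\<^sub>R v)"] D2 by blast
  show thesis
    by (rule that[OF a(1,2) b(1,2)]) (use a(3) b(3) in \<open>simp add: algebra_simps del: nderiv.simps\<close>)
qed

text \<open>
  The mixed second difference over the parallelogram spanned by
  \<open>h u\<close> and \<open>h v\<close> is \<open>h\<^sup>2\<close> times a value of either mixed derivative near \<open>y\<close>, and \<open>h\<close> is arbitrary.
\<close>
lemma nderiv_swap2:
  fixes f :: "'a::euclidean_space \<Rightarrow> real"
  assumes f: "f \<in> Cb k" "2 \<le> k"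
  shows "nderiv f [u, v] y = nderiv f [v, u] y"
proof (rule ccontr)
  assume neq: "nderiv f [u, v] y \<noteq> nderiv f [v, u] y"
  define e where "e = \<bar>nderiv f [u, v] y - nderiv f [v, u] y\<bar> / 2"
  have e: "0 < e" using neq by (simp add: e_def del: nderiv.simps)
  have "\<exists>\<delta>>0. \<forall>z. dist z y < \<delta> \<longrightarrow> dist (nderiv f [u, v] z) (nderiv f [u, v] y) < e"
    "\<exists>\<delta>>0. \<forall>z. dist z y < \<delta> \<longrightarrow> dist (nderiv f [v, u] z) (nderiv f [v, u] y) < e"
    using nderiv_continuous[of f k "[u, v]" y] nderiv_continuous[of f k "[v, u]" y] f e
    unfolding continuous_at_eps_delta by (simp_all del: nderiv.simps)
  then obtain \<delta>1 \<delta>2 where \<delta>: "0 < \<delta>1" "0 < \<delta>2"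
    "\<And>z. dist z y < \<delta>1 \<Longrightarrow> dist (nderiv f [u, v] z) (nderiv f [u, v] y) < e"
    "\<And>z. dist z y < \<delta>2 \<Longrightarrow> dist (nderiv f [v, u] z) (nderiv f [v, u] y) < e" by blast
  define h where "h = min \<delta>1 \<delta>2 / (norm u + norm v + 1)"
  have h: "0 < h" using \<delta> by (simp add: h_def add_nonneg_pos)
  have near: "dist (y + a *\<^sub>R w + b *\<^sub>R w') y < min \<delta>1 \<delta>2"
    if "0 < a" "a < h" "0 < b" "b < h" "norm w + norm w' = norm u + norm v" for a b w w'
  proof -
    have "dist (y + a *\<^sub>R w + b *\<^sub>R w') y = norm (a *\<^sub>R w + b *\<^sub>R w')" by (simp add: dist_norm)
    also have "\<dots> \<le> norm (a *\<^sub>R w) + norm (b *\<^sub>R w')" by (rule norm_triangle_ineq)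
    also have "\<dots> = a * norm w + b * norm w'" using that by simp
    also have "\<dots> \<le> h * norm w + h * norm w'" using that by (intro add_mono mult_right_mono) auto
    also have "\<dots> < h * (norm u + norm v + 1)" using h unfolding that(5)[symmetric] by (simp add: distrib_left)
    also have "\<dots> = min \<delta>1 \<delta>2" unfolding h_def using add_nonneg_pos[of "norm u + norm v" 1] by simp
    finally show ?thesis .
  qed
  obtain a b where ab: "0 < a" "a < h" "0 < b" "b < h"
    "f (y + h *\<^sub>R u + h *\<^sub>R v) - f (y + h *\<^sub>R u) - f (y + h *\<^sub>R v) + f y
       = h * (h * nderiv f [v, u] (y + a *\<^sub>R u + b *\<^sub>R v))"
    by (rule second_difference_mean_value[OF f h])
  obtain c d where cd: "0 < c" "c < h" "0 < d" "d < h"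
    "f (y + h *\<^sub>R v + h *\<^sub>R u) - f (y + h *\<^sub>R v) - f (y + h *\<^sub>R u) + f y
       = h * (h * nderiv f [u, v] (y + c *\<^sub>R v + d *\<^sub>R u))"
    by (rule second_difference_mean_value[OF f h])
  have "f (y + h *\<^sub>R v + h *\<^sub>R u) - f (y + h *\<^sub>R v) - f (y + h *\<^sub>R u) + f y
      = f (y + h *\<^sub>R u + h *\<^sub>R v) - f (y + h *\<^sub>R u) - f (y + h *\<^sub>R v) + f y"
    by (simp add: add.assoc add.commute[of "h *\<^sub>R u"])
  then have "h * (h * nderiv f [v, u] (y + a *\<^sub>R u + b *\<^sub>R v)) = h * (h * nderiv f [u, v] (y + c *\<^sub>R v + d *\<^sub>R u))"
    unfolding ab(5) cd(5) by (rule sym)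
  then have "nderiv f [v, u] (y + a *\<^sub>R u + b *\<^sub>R v) = nderiv f [u, v] (y + c *\<^sub>R v + d *\<^sub>R u)"
    using h by (simp del: nderiv.simps)
  moreover have "dist (nderiv f [u, v] (y + c *\<^sub>R v + d *\<^sub>R u)) (nderiv f [u, v] y) < e"
    using near[OF cd(1-4), of v u] by (intro \<delta>) auto
  moreover have "dist (nderiv f [v, u] (y + a *\<^sub>R u + b *\<^sub>R v)) (nderiv f [v, u] y) < e"
    using near[OF ab(1-4), of u v] by (intro \<delta>) auto
  ultimately have "\<bar>nderiv f [u, v] y - nderiv f [v, u] y\<bar> < 2 * e"
    by (simp add: dist_real_def del: nderiv.simps)
  then show False by (simp add: e_def del: nderiv.simps)
qed

lemma nderiv_move_to_front:
  fixes f :: "'a::euclidean_space \<Rightarrow> real"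
  assumes f: "f \<in> Cb k"
  shows "length (us @ v # ws) \<le> k \<Longrightarrow> nderiv f (us @ v # ws) = nderiv f (v # us @ ws)"
proof (induction us)
  case (Cons u us)
  have "nderiv f ((u # us) @ v # ws) = nderiv f (u # v # us @ ws)" using Cons by simp
  also have "\<dots> = nderiv (nderiv f (us @ ws)) [u, v]" using nderiv_append[of f "[u, v]"] by simp
  also have "\<dots> = nderiv (nderiv f (us @ ws)) [v, u]"
  proof
    fix y
    show "nderiv (nderiv f (us @ ws)) [u, v] y = nderiv (nderiv f (us @ ws)) [v, u] y"
      by (rule nderiv_swap2[OF nderiv_Cb[OF f]]) (use Cons in auto)
  qed
  also have "\<dots> = nderiv f (v # (u # us) @ ws)" using nderiv_append[of f "[v, u]"] by simp
  finally show ?case .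
qed simp

lemma nderiv_permute:
  fixes f :: "'a::euclidean_space \<Rightarrow> real"
  assumes f: "f \<in> Cb k"
  shows "mset vs = mset ws \<Longrightarrow> length vs \<le> k \<Longrightarrow> nderiv f vs = nderiv f ws"
proof (induction vs arbitrary: ws)
  case (Cons v vs)
  have "v \<in> set ws" using Cons.prems(1) by (metis list.set_intros(1) set_mset_mset)
  then obtain as bs where ws: "ws = as @ v # bs" by (meson split_list)
  have "mset vs = mset (as @ bs)" using Cons.prems(1) ws by simp
  then have "nderiv f vs = nderiv f (as @ bs)" using Cons by simp
  moreover have "length ws \<le> k" using Cons.prems mset_eq_length by fastforce
  ultimately show ?case using nderiv_move_to_front[OF f, of as v bs] ws by simp
qed simp

lemma nderiv_Basis_expansion_head:
  fixes f :: "'a::euclidean_space \<Rightarrow> real"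
  assumes f: "f \<in> Cb k" and vs: "length vs < k"
  shows "nderiv f (v # vs) y = (\<Sum>b\<in>Basis. (v \<bullet> b) * nderiv f (b # vs) y)"
proof -
  have lin: "linear (\<lambda>v. nderiv f (v # vs) y)"
    by (rule has_derivative_linear[OF nderiv_has_derivative[OF assms]])
  have "nderiv f (v # vs) y = nderiv f ((\<Sum>b\<in>Basis. (v \<bullet> b) *\<^sub>R b) # vs) y"
    by (simp only: euclidean_representation)
  also have "\<dots> = (\<Sum>b\<in>Basis. (v \<bullet> b) * nderiv f (b # vs) y)"
    using linear_sum[OF lin, of "\<lambda>b. (v \<bullet> b) *\<^sub>R b" Basis] linear_cmul[OF lin]
    by (simp del: nderiv.simps)
  finally show ?thesis .
qed

text \<open>The words of length \<open>n\<close> over an alphabet index the terms of an \<open>n\<close>-fold product of sums.\<close>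
definition words :: "nat \<Rightarrow> 'x set \<Rightarrow> 'x list set" where
  "words n S = {xs. set xs \<subseteq> S \<and> length xs = n}"

lemma finite_words: "finite S \<Longrightarrow> finite (words n S)"
  by (simp add: words_def finite_lists_length_eq)

lemma sum_words_0 [simp]: "(\<Sum>xs\<in>words 0 S. g xs) = g []"
proof -
  have "words 0 S = {[]}" by (auto simp: words_def)
  then show ?thesis by simp
qed

lemma sum_words_Suc:
  "(\<Sum>xs\<in>words (Suc n) S. g xs) = (\<Sum>x\<in>S. \<Sum>xs\<in>words n S. g (x # xs))"
proof -
  have eq: "words (Suc n) S = (\<lambda>(x, xs). x # xs) ` (S \<times> words n S)"
    by (auto simp: words_def length_Suc_conv image_iff)
  have "inj_on (\<lambda>(x, xs). x # xs) (S \<times> words n S)" by (auto simp: inj_on_def)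
  then show ?thesis unfolding eq by (simp add: sum.reindex sum.cartesian_product case_prod_unfold)
qed

lemma prod_list_sum_eq_sum_words:
  fixes g :: "'i \<Rightarrow> 'x \<Rightarrow> 'r::comm_semiring_1"
  shows "(\<Prod>i\<leftarrow>is. \<Sum>x\<in>S. g i x) = (\<Sum>xs\<in>words (length is) S. \<Prod>(i, x)\<leftarrow>zip is xs. g i x)"
proof (induction "is")
  case (Cons i "is")
  then show ?case
    by (simp add: sum_words_Suc sum_distrib_left sum_distrib_right) (rule sum.swap)
qed (simp del: sum_constant)

text \<open>
  Every direction is the outermost one at the moment when it is added to the list, and a derivative
  is linear in its outermost direction.
\<close>
lemma nderiv_Basis_expansion:
  fixes f :: "'a::euclidean_space \<Rightarrow> real"
  assumes f: "f \<in> Cb k"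
  shows "length vs \<le> k \<Longrightarrow>
    nderiv f vs = (\<lambda>y. \<Sum>is\<in>words (length vs) Basis. (\<Prod>(i, v)\<leftarrow>zip is vs. v \<bullet> i) * nderiv f is y)"
proof (induction vs)
  case (Cons v vs)
  show ?case
  proof
    fix y
    let ?c = "\<lambda>is. \<Prod>(i, v)\<leftarrow>zip is vs. v \<bullet> i"
    have IH: "nderiv f vs = (\<lambda>y. \<Sum>is\<in>words (length vs) Basis. ?c is * nderiv f is y)"
      using Cons by simp
    have "((\<lambda>y. \<Sum>is\<in>words (length vs) Basis. ?c is * nderiv f is y)
        has_derivative (\<lambda>b. \<Sum>is\<in>words (length vs) Basis. ?c is * nderiv f (b # is) y)) (at y)"
      by (intro has_derivative_sum has_derivative_mult_right nderiv_has_derivative[OF f])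
        (use Cons.prems in \<open>auto simp: words_def\<close>)
    moreover have "(nderiv f vs has_derivative (\<lambda>b. nderiv f (b # vs) y)) (at y)"
      using Cons.prems by (intro nderiv_has_derivative[OF f]) simp
    then have "((\<lambda>y. \<Sum>is\<in>words (length vs) Basis. ?c is * nderiv f is y)
        has_derivative (\<lambda>b. nderiv f (b # vs) y)) (at y)"
      by (subst IH[symmetric])
    ultimately have d: "(\<lambda>b. nderiv f (b # vs) y) = (\<lambda>b. \<Sum>is\<in>words (length vs) Basis. ?c is * nderiv f (b # is) y)"
      by (rule has_derivative_unique[rotated])
    have "nderiv f (v # vs) y = (\<Sum>b\<in>Basis. (v \<bullet> b) * nderiv f (b # vs) y)"
      using Cons.prems by (intro nderiv_Basis_expansion_head[OF f]) simp
    also have "\<dots> = (\<Sum>b\<in>Basis. (v \<bullet> b) * (\<Sum>is\<in>words (length vs) Basis. ?c is * nderiv f (b # is) y))"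
      using fun_cong[OF d] by (simp del: nderiv.simps)
    also have "\<dots> = (\<Sum>is\<in>words (length (v # vs)) Basis. (\<Prod>(i, v)\<leftarrow>zip is (v # vs). v \<bullet> i) * nderiv f is y)"
      by (simp add: sum_words_Suc sum_distrib_left mult.assoc del: nderiv.simps)
    finally show "nderiv f (v # vs) y = \<dots>" .
  qed
qed simp

text \<open>
  One of the factors \<open>w\<close> of the polynomial \<open>w \<mapsto> D\<^sup>n\<^sup>+\<^sup>m f(x)[w, \<dots>, w, vs]\<close> is expanded in
  the basis and moved into the fixed directions \<open>vs\<close>; this is why the induction has to carry them. The product rule then gives one term from that factor and, by induction and
  symmetry, \<open>n\<close> equal terms from the others.
\<close>
lemma nderiv_replicate_has_derivative:
  fixes f :: "'a::euclidean_space \<Rightarrow> real"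
  assumes f: "f \<in> Cb k"
  shows "n + length vs \<le> k \<Longrightarrow>
    ((\<lambda>w. nderiv f (replicate n w @ vs) x) has_derivative
      (\<lambda>h. real n * nderiv f (h # replicate (n - 1) w @ vs) x)) (at w)"
proof (induction n arbitrary: vs)
  case (Suc n)
  have expand: "nderiv f (replicate (Suc n) w @ vs) x = (\<Sum>b\<in>Basis. (w \<bullet> b) * nderiv f (replicate n w @ b # vs) x)" for w
  proof -
    have "nderiv f (replicate n w @ b # vs) = nderiv f (b # replicate n w @ vs)" for b
      by (rule nderiv_permute[OF f]) (use Suc.prems in auto)
    then show ?thesis using nderiv_Basis_expansion_head[OF f, of "replicate n w @ vs" w x] Suc.prems
      by (simp del: nderiv.simps)
  qed
  have "((\<lambda>w. \<Sum>b\<in>Basis. (w \<bullet> b) * nderiv f (replicate n w @ b # vs) x) has_derivative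
      (\<lambda>h. \<Sum>b\<in>Basis. (w \<bullet> b) * (real n * nderiv f (h # replicate (n - 1) w @ b # vs) x)
            + (h \<bullet> b) * nderiv f (replicate n w @ b # vs) x)) (at w)"
    by (intro has_derivative_sum has_derivative_mult has_derivative_inner_left has_derivative_ident Suc.IH)
      (use Suc.prems in auto)
  moreover have "(\<Sum>b\<in>Basis. (w \<bullet> b) * (real n * nderiv f (h # replicate (n - 1) w @ b # vs) x)
            + (h \<bullet> b) * nderiv f (replicate n w @ b # vs) x)
       = real (Suc n) * nderiv f (h # replicate (Suc n - 1) w @ vs) x" for h
  proof -
    have p1: "nderiv f (replicate n w @ b # vs) = nderiv f (b # replicate n w @ vs)" for b
      by (rule nderiv_permute[OF f]) (use Suc.prems in auto)
    have p2: "nderiv f (h # replicate (n - 1) w @ b # vs) = nderiv f (b # h # replicate (n - 1) w @ vs)" if "n > 0" for b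
      by (rule nderiv_permute[OF f]) (use Suc.prems that in auto)
    have p3: "nderiv f (w # h # replicate (n - 1) w @ vs) = nderiv f (h # replicate n w @ vs)" if "n > 0"
    proof (rule nderiv_permute[OF f])
      show "mset (w # h # replicate (n - 1) w @ vs) = mset (h # replicate n w @ vs)"
        using that by (cases n) auto
    qed (use Suc.prems that in auto)
    have s1: "(\<Sum>b\<in>Basis. (h \<bullet> b) * nderiv f (replicate n w @ b # vs) x) = nderiv f (h # replicate n w @ vs) x"
      unfolding p1 using Suc.prems by (intro nderiv_Basis_expansion_head[OF f, symmetric]) simp
    have s2: "(\<Sum>b\<in>Basis. (w \<bullet> b) * (real n * nderiv f (h # replicate (n - 1) w @ b # vs) x))
        = real n * nderiv f (h # replicate n w @ vs) x"
    proof (cases "n > 0")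
      case True
      have "(\<Sum>b\<in>Basis. (w \<bullet> b) * nderiv f (b # h # replicate (n - 1) w @ vs) x) = nderiv f (w # h # replicate (n - 1) w @ vs) x"
        using Suc.prems True by (intro nderiv_Basis_expansion_head[OF f, symmetric]) simp
      then show ?thesis unfolding p2[OF True] p3[OF True, symmetric]
        by (simp add: mult.left_commute[of _ "real n"] flip: sum_distrib_left del: nderiv.simps)
    qed simp
    show ?thesis unfolding sum.distrib s1 s2 by (simp add: algebra_simps del: nderiv.simps)
  qed
  ultimately show ?case unfolding expand by (simp del: nderiv.simps)
qed simp

definition taylor_rem :: "nat \<Rightarrow> ('a::euclidean_space \<Rightarrow> real) \<Rightarrow> 'a \<Rightarrow> 'a \<Rightarrow> real" where
  "taylor_rem k f x y = f y - (\<Sum>n<k. nderiv f (replicate n (y - x)) x / fact n)"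

text \<open>
  Differentiating a Taylor remainder in \<open>y\<close> gives the Taylor remainder, one order lower, of the
  directional derivative. With the truncated subtraction this includes the case \<open>k = 0\<close>.
\<close>
lemma taylor_rem_has_derivative:
  fixes f :: "'a::euclidean_space \<Rightarrow> real"
  assumes f: "f \<in> Cb j" and kj: "k \<le> j" "1 \<le> j"
  shows "(taylor_rem k f x has_derivative (\<lambda>h. taylor_rem (k - 1) (nderiv f [h]) x y)) (at y)"
proof -
  have d: "((\<lambda>y. nderiv f (replicate n (y - x)) x) has_derivative
      (\<lambda>h. real n * nderiv f (h # replicate (n - 1) (y - x)) x)) (at y)" if "n < k" for n
    using has_derivative_compose[OF has_derivative_diff[OF has_derivative_ident has_derivative_const]
        nderiv_replicate_has_derivative[OF f, of n "[]" x]] that kj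
    by (simp del: nderiv.simps)
  have "(taylor_rem k f x has_derivative
      (\<lambda>h. nderiv f [h] y - (\<Sum>n<k. real n * nderiv f (h # replicate (n - 1) (y - x)) x / fact n))) (at y)"
    unfolding taylor_rem_def
    by (intro has_derivative_diff has_derivative_sum bounded_linear.has_derivative[OF bounded_linear_divide d]
        nderiv_has_derivative[of f j "[]", unfolded nderiv.simps(1)])
      (use f kj in auto)
  moreover have "(\<Sum>n<k. real n * nderiv f (h # replicate (n - 1) (y - x)) x / fact n)
      = (\<Sum>n<k - 1. nderiv (nderiv f [h]) (replicate n (y - x)) x / fact n)" for h
  proof (cases k)
    case (Suc l)
    have "nderiv f (h # replicate n (y - x)) = nderiv (nderiv f [h]) (replicate n (y - x))" if "n < l" for n
      unfolding nderiv_append[symmetric] by (rule nderiv_permute[OF f]) (use that Suc kj in auto)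
    moreover have "real (Suc n) * c / fact (Suc n) = c / fact n" for n c
      by (simp add: fact_Suc del: of_nat_Suc)
    ultimately show ?thesis unfolding Suc sum.lessThan_Suc_shift
      by (auto simp del: nderiv.simps fact_Suc of_nat_Suc intro!: sum.cong)
  qed simp
  ultimately show ?thesis by (simp add: taylor_rem_def del: nderiv.simps)
qed

lemma segment_onorm_bound:
  fixes f :: "'a::euclidean_space \<Rightarrow> real"
  assumes "\<And>z. (f has_derivative f' z) (at z)"
    and "\<And>z h. z \<in> closed_segment u v \<Longrightarrow> \<bar>f' z h\<bar> \<le> B * norm h"
  shows "\<bar>f v - f u\<bar> \<le> B * norm (v - u)"
  using differentiable_bound[of "closed_segment u v" f f' B v u] assms
  by (simp add: has_derivative_at_withinI onorm_le)

lemma segment_linearization_bound: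
  fixes f :: "'a::euclidean_space \<Rightarrow> real"
  assumes f': "\<And>z. (f has_derivative f' z) (at z)"
    and B: "\<And>z h. z \<in> closed_segment u v \<Longrightarrow> \<bar>f' z h - f' u h\<bar> \<le> B * norm h"
  shows "\<bar>f v - f u - f' u (v - u)\<bar> \<le> B * norm (v - u)"
proof -
  have "norm (f v - f u - f' u (v - u)) \<le> norm (v - u) * B"
  proof (rule differentiable_bound_linearization)
    show "u + t *\<^sub>R (v - u) \<in> closed_segment u v" if "t \<in> {0..1}" for t
      using that unfolding closed_segment_def by (auto simp: algebra_simps intro!: exI[of _ t])
    show "onorm (f' z - f' u) \<le> B" if "z \<in> closed_segment u v" for z
      using B[OF that] by (intro onorm_le) simp
  qed (auto intro: has_derivative_at_withinI f')
  then show ?thesis by (simp add: mult.commute)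
qed

text \<open>
  Induction on \<open>k\<close> through the preceding lemma: the slope of the remainder is a remainder of lower
  order, the remainder vanishes at \<open>x\<close>, and the mean value inequality integrates the slope.
\<close>
lemma taylor_rem_bound:
  fixes f :: "'a::euclidean_space \<Rightarrow> real"
  shows "f \<in> Cb j \<Longrightarrow> k \<le> j \<Longrightarrow> 0 \<le> B \<Longrightarrow>
    (\<And>vs y. length vs = k \<Longrightarrow> \<bar>nderiv f vs y\<bar> \<le> B * (\<Prod>v\<leftarrow>vs. norm v)) \<Longrightarrow>
    \<bar>taylor_rem k f x y\<bar> \<le> B * norm (y - x) ^ k"
proof (induction k arbitrary: f j B y)
  case 0
  then show ?case using "0.prems"(4)[of "[]" y] by (simp add: taylor_rem_def)
next
  case (Suc k)
  have slope: "\<bar>taylor_rem (Suc k - 1) (nderiv f [h]) x z\<bar> \<le> B * norm (y - x) ^ k * norm h"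
    if z: "z \<in> closed_segment x y" for z h
  proof -
    have "\<bar>taylor_rem k (nderiv f [h]) x z\<bar> \<le> (B * norm h) * norm (z - x) ^ k"
    proof (rule Suc.IH)
      show "nderiv f [h] \<in> Cb (j - 1)" using nderiv_Cb[of f j "[h]"] Suc.prems by simp
      fix vs :: "'a list" and y assume "length vs = k"
      then show "\<bar>nderiv (nderiv f [h]) vs y\<bar> \<le> B * norm h * (\<Prod>v\<leftarrow>vs. norm v)"
        using Suc.prems(4)[of "vs @ [h]" y] unfolding nderiv_append[symmetric] by (simp add: mult_ac)
    qed (use Suc.prems in auto)
    also have "\<dots> \<le> B * norm h * norm (y - x) ^ k"
      using segment_bound(1)[OF z] Suc.prems(3) by (intro mult_left_mono power_mono) auto
    finally show ?thesis by (simp add: mult_ac)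
  qed
  have "\<bar>taylor_rem (Suc k) f x y - taylor_rem (Suc k) f x x\<bar> \<le> B * norm (y - x) ^ k * norm (y - x)"
    by (rule segment_onorm_bound[OF taylor_rem_has_derivative[OF Suc.prems(1)]]) (use Suc.prems(2) slope in simp_all)
  moreover have "taylor_rem (Suc k) f x x = 0"
  proof -
    have "nderiv f (replicate n 0) x = 0" if "0 < n" "n \<le> k" for n
    proof -
      obtain l where n: "n = Suc l" using \<open>0 < n\<close> gr0_implies_Suc by blast
      have "nderiv f (0 # replicate l 0) x = 0"
        using nderiv_Basis_expansion_head[OF Suc.prems(1), of "replicate l 0" 0 x] n Suc.prems(2) \<open>n \<le> k\<close>
        by (simp del: nderiv.simps)
      then show ?thesis using n by (simp del: nderiv.simps)
    qed
    then show ?thesis unfolding taylor_rem_def sum.lessThan_Suc_shift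
      by (simp del: nderiv.simps replicate.simps add: nderiv.simps(1) replicate.simps(1))
  qed
  ultimately show ?case by (simp add: mult_ac)
qed

text \<open>
  These four bounds are exactly what is needed to read the Taylor remainder at a moving base point
  along a controlled path as a controlled quantity of order \<open>k\<close>.
\<close>
lemma taylor_rem_estimates:
  fixes f :: "'a::euclidean_space \<Rightarrow> real"
  assumes f: "f \<in> Cb j" and j: "2 \<le> j" "k \<le> j"
  obtains C where "0 \<le> C"
    and "\<And>x y r. norm (y - x) \<le> r \<Longrightarrow> \<bar>taylor_rem k f x y\<bar> \<le> C * r ^ k"
    and "\<And>x y r h. norm (y - x) \<le> r \<Longrightarrow> \<bar>taylor_rem (k - 1) (nderiv f [h]) x y\<bar> \<le> C * r ^ (k - 1) * norm h"
    and "\<And>x u v r h. norm (u - x) \<le> r \<Longrightarrow> norm (v - x) \<le> r \<Longrightarrow>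
      \<bar>taylor_rem (k - 1) (nderiv f [h]) x v - taylor_rem (k - 1) (nderiv f [h]) x u\<bar>
        \<le> C * r ^ (k - 2) * norm (v - u) * norm h"
    and "\<And>x u v r. norm (u - x) \<le> r \<Longrightarrow> norm (v - x) \<le> r \<Longrightarrow>
      \<bar>taylor_rem k f x v - taylor_rem k f x u - taylor_rem (k - 1) (nderiv f [v - u]) x u\<bar>
        \<le> C * r ^ (k - 2) * norm (v - u) ^ 2"
proof -
  obtain B0 where B0: "0 \<le> B0" "\<And>vs y. length vs = k \<Longrightarrow> \<bar>nderiv f vs y\<bar> \<le> B0 * (\<Prod>v\<leftarrow>vs. norm v)"
    using Cb_bound[OF f j(2)] unfolding real_norm_def by blast
  \<comment> \<open>The second derivative of the remainder of order \<open>k\<close> is a remainder of order \<open>k - 2\<close>, which is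
     governed by the derivatives of \<open>f\<close> of order \<open>(k - 2) + 2\<close>; for \<open>k < 2\<close> this is not \<open>k\<close>.\<close>
  have "(k - 1) + 1 \<le> j" "(k - 2) + 2 \<le> j" using j by auto
  note bounds = this[THEN Cb_bound[OF f]]
  obtain B1 where B1: "0 \<le> B1" "\<And>vs y. length vs = (k - 1) + 1 \<Longrightarrow> \<bar>nderiv f vs y\<bar> \<le> B1 * (\<Prod>v\<leftarrow>vs. norm v)"
    using bounds(1) unfolding real_norm_def by blast
  obtain B2 where B2: "0 \<le> B2" "\<And>vs y. length vs = (k - 2) + 2 \<Longrightarrow> \<bar>nderiv f vs y\<bar> \<le> B2 * (\<Prod>v\<leftarrow>vs. norm v)"
    using bounds(2) unfolding real_norm_def by blast
  define C where "C = B0 + B1 + B2"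
  have C: "0 \<le> C" "B0 \<le> C" "B1 \<le> C" "B2 \<le> C" using B0 B1 B2 by (auto simp: C_def)
  have e0: "\<bar>taylor_rem k f x y\<bar> \<le> C * r ^ k" if "norm (y - x) \<le> r" for x y r
  proof -
    have "\<bar>taylor_rem k f x y\<bar> \<le> B0 * norm (y - x) ^ k"
      using taylor_rem_bound[OF f j(2) B0] .
    also have "\<dots> \<le> C * r ^ k" using that C B0 by (intro mult_mono power_mono) auto
    finally show ?thesis .
  qed
  have e1: "\<bar>taylor_rem (k - 1) (nderiv f [h]) x y\<bar> \<le> C * r ^ (k - 1) * norm h" if "norm (y - x) \<le> r" for x y r h
  proof -
    have "\<bar>taylor_rem (k - 1) (nderiv f [h]) x y\<bar> \<le> (B1 * norm h) * norm (y - x) ^ (k - 1)"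
    proof (rule taylor_rem_bound)
      show "nderiv f [h] \<in> Cb (j - 1)" using nderiv_Cb[OF f, of "[h]"] j by simp
      show "\<bar>nderiv (nderiv f [h]) vs y\<bar> \<le> B1 * norm h * (\<Prod>v\<leftarrow>vs. norm v)" if "length vs = k - 1" for vs y
        using B1(2)[of "vs @ [h]" y] that unfolding nderiv_append[symmetric] by (simp add: mult_ac)
    qed (use j B1 in auto)
    also have "\<dots> \<le> (C * norm h) * r ^ (k - 1)" using that C B1 by (intro mult_mono power_mono) auto
    finally show ?thesis by (simp add: mult_ac)
  qed
  have e2: "\<bar>taylor_rem (k - 2) (nderiv f [h', h]) x y\<bar> \<le> C * r ^ (k - 2) * norm h * norm h'"
    if "norm (y - x) \<le> r" for x y r h h'
  proof -
    have "\<bar>taylor_rem (k - 2) (nderiv f [h', h]) x y\<bar> \<le> (B2 * norm h' * norm h) * norm (y - x) ^ (k - 2)"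
    proof (rule taylor_rem_bound)
      show "nderiv f [h', h] \<in> Cb (j - 2)" using nderiv_Cb[OF f, of "[h', h]"] j by (simp add: numeral_2_eq_2)
      show "\<bar>nderiv (nderiv f [h', h]) vs y\<bar> \<le> B2 * norm h' * norm h * (\<Prod>v\<leftarrow>vs. norm v)" if "length vs = k - 2" for vs y
        using B2(2)[of "vs @ [h', h]" y] that unfolding nderiv_append[symmetric] by (simp add: mult_ac)
    qed (use j B2 in auto)
    also have "\<dots> \<le> (C * norm h' * norm h) * r ^ (k - 2)" using that C B2 by (intro mult_mono power_mono) auto
    finally show ?thesis by (simp add: mult_ac)
  qed
  have seg: "norm (z - x) \<le> r" if "z \<in> closed_segment u v" "norm (u - x) \<le> r" "norm (v - x) \<le> r" for x z u v :: 'a and r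
  proof -
    have "closed_segment u v \<subseteq> cball x r"
      using that by (intro closed_segment_subset) (auto simp: dist_norm norm_minus_commute)
    then show ?thesis using that by (auto simp: dist_norm norm_minus_commute)
  qed
  have e3: "\<bar>taylor_rem (k - 1) (nderiv f [h]) x v - taylor_rem (k - 1) (nderiv f [h]) x u\<bar>
        \<le> C * r ^ (k - 2) * norm (v - u) * norm h" if "norm (u - x) \<le> r" "norm (v - x) \<le> r" for x u v r h
  proof -
    have "\<bar>taylor_rem (k - 1) (nderiv f [h]) x v - taylor_rem (k - 1) (nderiv f [h]) x u\<bar>
        \<le> (C * r ^ (k - 2) * norm h) * norm (v - u)"
    proof (rule segment_onorm_bound)
      show "(taylor_rem (k - 1) (nderiv f [h]) x has_derivative
          (\<lambda>h'. taylor_rem (k - 1 - 1) (nderiv (nderiv f [h]) [h']) x z)) (at z)" for z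
        using nderiv_Cb[OF f, of "[h]"] j by (intro taylor_rem_has_derivative[of _ "j - 1"]) auto
      show "\<bar>taylor_rem (k - 1 - 1) (nderiv (nderiv f [h]) [h']) x z\<bar> \<le> C * r ^ (k - 2) * norm h * norm h'"
        if "z \<in> closed_segment u v" for z h'
        using e2[OF seg[OF that \<open>norm (u - x) \<le> r\<close> \<open>norm (v - x) \<le> r\<close>], of h' h]
        unfolding nderiv_append[symmetric] by (simp add: numeral_2_eq_2)
    qed
    then show ?thesis by (simp add: mult_ac)
  qed
  have e4: "\<bar>taylor_rem k f x v - taylor_rem k f x u - taylor_rem (k - 1) (nderiv f [v - u]) x u\<bar>
        \<le> C * r ^ (k - 2) * norm (v - u) ^ 2" if uv: "norm (u - x) \<le> r" "norm (v - x) \<le> r" for x u v r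
  proof -
    have r: "0 \<le> r" using uv(1) norm_ge_zero order_trans by blast
    have "\<bar>taylor_rem k f x v - taylor_rem k f x u - taylor_rem (k - 1) (nderiv f [v - u]) x u\<bar>
        \<le> (C * r ^ (k - 2) * norm (v - u)) * norm (v - u)"
    proof (rule segment_linearization_bound)
      show "(taylor_rem k f x has_derivative (\<lambda>h. taylor_rem (k - 1) (nderiv f [h]) x z)) (at z)" for z
        using j by (intro taylor_rem_has_derivative[OF f]) auto
      fix z h assume z: "z \<in> closed_segment u v"
      have "\<bar>taylor_rem (k - 1) (nderiv f [h]) x z - taylor_rem (k - 1) (nderiv f [h]) x u\<bar>
          \<le> C * r ^ (k - 2) * norm (z - u) * norm h"
        by (rule e3[OF uv(1) seg[OF z uv]])
      also have "\<dots> \<le> C * r ^ (k - 2) * norm (v - u) * norm h"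
        using segment_bound(1)[OF z] C r by (intro mult_right_mono mult_left_mono) auto
      finally show "\<bar>taylor_rem (k - 1) (nderiv f [h]) x z - taylor_rem (k - 1) (nderiv f [h]) x u\<bar>
          \<le> C * r ^ (k - 2) * norm (v - u) * norm h" .
    qed
    then show ?thesis by (simp add: power2_eq_square mult.assoc)
  qed
  show thesis by (rule that[OF C(1) e0 e1 e3 e4])
qed

definition taylor_rem_deriv ::
    "nat \<Rightarrow> ('a::euclidean_space \<Rightarrow> real) \<Rightarrow> 'a \<Rightarrow> 'a \<Rightarrow> 'a \<Rightarrow>\<^sub>L real" where
  "taylor_rem_deriv k f x y = Blinfun (\<lambda>h. taylor_rem (k - 1) (nderiv f [h]) x y)"

lemma taylor_rem_deriv_apply:
  fixes f :: "'a::euclidean_space \<Rightarrow> real"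
  assumes "f \<in> Cb j" "k \<le> j" "1 \<le> j"
  shows "taylor_rem_deriv k f x y h = taylor_rem (k - 1) (nderiv f [h]) x y"
  unfolding taylor_rem_deriv_def
  by (subst bounded_linear_Blinfun_apply)
    (use has_derivative_bounded_linear[OF taylor_rem_has_derivative[OF assms]] in simp_all)

section \<open>Jets: values together with Gubinelli derivatives\<close>

text \<open>
  A value and a Gubinelli derivative at one time, with the ring structure of the dual numbers: the
  product is the Leibniz rule. Identities between controlled paths then become identities in a
  commutative ring, so that one computation serves both components.
\<close>
datatype 'd jet = Jet (val: real) (grad: "(real ^ 'd::finite) \<Rightarrow>\<^sub>L real")

lemma jet_eq_iff: "a = b \<longleftrightarrow> val a = val b \<and> grad a = grad b"
  by (cases a; cases b) auto

instantiation jet :: (finite) "{comm_ring_1, real_algebra_1}"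
begin

definition "0 = Jet 0 0"
definition "1 = Jet 1 0"
definition "a + b = Jet (val a + val b) (grad a + grad b)"
definition "- a = Jet (- val a) (- grad a)"
definition "a - b = Jet (val a - val b) (grad a - grad b)"
definition "a * b = Jet (val a * val b) (val a *\<^sub>R grad b + val b *\<^sub>R grad a)"
definition "c *\<^sub>R a = Jet (c * val a) (c *\<^sub>R grad a)"

lemmas jet_ops = zero_jet_def one_jet_def plus_jet_def uminus_jet_def minus_jet_def times_jet_def
  scaleR_jet_def

instance
  by standard (auto simp: jet_ops jet_eq_iff algebra_simps)

end

lemma jet_simps [simp]:
  "val 0 = 0" "val 1 = 1" "val (a + b) = val a + val b" "val (a - b) = val a - val b"
  "val (a * b) = val a * val b" "val (c *\<^sub>R a) = c * val a"
  "grad 0 = 0" "grad 1 = 0" "grad (a + b) = grad a + grad b" "grad (a - b) = grad a - grad b"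
  "grad (a * b) = val a *\<^sub>R grad b + val b *\<^sub>R grad a" "grad (c *\<^sub>R a) = c *\<^sub>R grad a"
  by (simp_all add: jet_ops)

lemma val_of_real [simp]: "val (of_real c) = c" and grad_of_real [simp]: "grad (of_real c) = 0"
  by (simp_all add: of_real_def)

lemma val_sum [simp]: "val (\<Sum>i\<in>I. f i) = (\<Sum>i\<in>I. val (f i))"
  by (induction I rule: infinite_finite_induct) auto

lemma grad_sum [simp]: "grad (\<Sum>i\<in>I. f i) = (\<Sum>i\<in>I. grad (f i))"
  by (induction I rule: infinite_finite_induct) auto

definition jet_at :: "('d::finite, real) cpath \<Rightarrow> real \<Rightarrow> 'd jet" where
  "jet_at H r = Jet (fst H r) (snd H r)"

text \<open>
  The Leibniz rule over a multiset is the product formula for dual numbers.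
\<close>
lemma jet_at_cpath_prod: "jet_at (cpath_prod M) r = (\<Prod>h\<in>#M. jet_at h r)"
proof (induction M)
  case empty
  show ?case by (simp add: jet_at_def cpath_prod_def one_jet_def)
next
  case (add h M)
  have "(\<Sum>g\<in>#M. (\<Prod>k\<in>#add_mset h M - {#g#}. fst k r) *\<^sub>R snd g r)
      = fst h r *\<^sub>R (\<Sum>g\<in>#M. (\<Prod>k\<in>#M - {#g#}. fst k r) *\<^sub>R snd g r)"
  proof -
    have "(\<Prod>k\<in>#add_mset h M - {#g#}. fst k r) = fst h r * (\<Prod>k\<in>#M - {#g#}. fst k r)" if "g \<in># M" for g
      using that by simp
    then have "(\<Sum>g\<in>#M. (\<Prod>k\<in>#add_mset h M - {#g#}. fst k r) *\<^sub>R snd g r)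
      = (\<Sum>g\<in>#M. fst h r *\<^sub>R ((\<Prod>k\<in>#M - {#g#}. fst k r) *\<^sub>R snd g r))"
      by (intro arg_cong[of _ _ sum_mset] image_mset_cong) simp
    also have "\<dots> = fst h r *\<^sub>R (\<Sum>g\<in>#M. (\<Prod>k\<in>#M - {#g#}. fst k r) *\<^sub>R snd g r)"
    proof -
      have "(\<Sum>g\<in>#N. c *\<^sub>R f g) = c *\<^sub>R (\<Sum>g\<in>#N. f g)" for c N and f :: "('a, real) cpath \<Rightarrow> (real ^ 'a) \<Rightarrow>\<^sub>L real"
        by (induction N) (simp_all add: scaleR_add_right)
      then show ?thesis .
    qed
    finally show ?thesis .
  qed
  then show ?case using add.IH
    by (simp add: jet_at_def cpath_prod_def times_jet_def jet_eq_iff flip: add.IH)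
qed

section \<open>Two-scale bounds and the order of a family of controlled paths\<close>

abbreviation scales :: "real \<Rightarrow> nat \<Rightarrow> nat \<Rightarrow> real \<Rightarrow> real \<Rightarrow> real \<Rightarrow> real" where
  "scales \<alpha> j l s u v \<equiv> ((v - s) powr \<alpha>) ^ j * ((v - u) powr \<alpha>) ^ l"

text \<open>
  The bound \<open>O(|v - s|\<^bsup>j \<alpha>\<^esup> |v - u|\<^bsup>l \<alpha>\<^esup>)\<close>, uniformly over \<open>0 \<le> s \<le> u \<le> v \<le> T\<close>; the natural powers
  of \<open>powr\<close> make the bound for \<open>j = l = 0\<close> plain boundedness, also on the diagonal.
\<close>
definition small ::
    "real \<Rightarrow> real \<Rightarrow> nat \<Rightarrow> nat \<Rightarrow> (real \<Rightarrow> real \<Rightarrow> real \<Rightarrow> 'b::real_normed_vector) \<Rightarrow> bool" where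
  "small \<alpha> T j l A \<longleftrightarrow> (\<exists>C\<ge>0. \<forall>s u v. 0 \<le> s \<and> s \<le> u \<and> u \<le> v \<and> v \<le> T \<longrightarrow>
     norm (A s u v) \<le> C * scales \<alpha> j l s u v)"

lemma smallI:
  assumes "0 \<le> C" "\<And>s u v. 0 \<le> s \<Longrightarrow> s \<le> u \<Longrightarrow> u \<le> v \<Longrightarrow> v \<le> T \<Longrightarrow>
     norm (A s u v) \<le> C * scales \<alpha> j l s u v"
  shows "small \<alpha> T j l A"
  using assms unfolding small_def by blast

lemma smallE:
  assumes "small \<alpha> T j l A"
  obtains C where "0 \<le> C" "\<And>s u v. 0 \<le> s \<Longrightarrow> s \<le> u \<Longrightarrow> u \<le> v \<Longrightarrow> v \<le> T \<Longrightarrow>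
     norm (A s u v) \<le> C * scales \<alpha> j l s u v"
  using assms unfolding small_def by blast

lemma small_cong:
  "(\<And>s u v. 0 \<le> s \<Longrightarrow> s \<le> u \<Longrightarrow> u \<le> v \<Longrightarrow> v \<le> T \<Longrightarrow> A s u v = B s u v) \<Longrightarrow>
   small \<alpha> T j l A \<longleftrightarrow> small \<alpha> T j l B"
  unfolding small_def by (intro ex_cong1) auto

text \<open>
  Since \<open>|v - u| \<le> |v - s| \<le> T\<close>, factors of the small scale may be traded for factors of the large
  scale, and superfluous factors may be dropped.
\<close>
lemma small_mono:
  assumes A: "small \<alpha> T j l A" and \<alpha>: "0 \<le> \<alpha>" and le: "l' \<le> l" "j' + l' \<le> j + l"
  shows "small \<alpha> T j' l' A"
proof -
  obtain C where C: "0 \<le> C" "\<And>s u v. 0 \<le> s \<Longrightarrow> s \<le> u \<Longrightarrow> u \<le> v \<Longrightarrow> v \<le> T \<Longrightarrow>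
     norm (A s u v) \<le> C * scales \<alpha> j l s u v"
    using A by (elim smallE) blast
  show ?thesis
  proof (rule smallI[of "C * (T powr \<alpha>) ^ (j + l - (j' + l'))"])
    fix s u v assume suv: "0 \<le> s" "s \<le> u" "u \<le> v" "v \<le> T"
    define h g H where "h = (v - s) powr \<alpha>" and "g = (v - u) powr \<alpha>" and "H = T powr \<alpha>"
    have gh: "0 \<le> g" "g \<le> h" "h \<le> H"
      using suv \<alpha> by (auto simp: h_def g_def H_def intro!: powr_mono2)
    have "norm (A s u v) \<le> C * (h ^ j * g ^ l)" using C(2)[OF suv] by (simp add: h_def g_def)
    also have "g ^ l = g ^ (l - l') * g ^ l'" using le by (simp flip: power_add)
    also have "C * (h ^ j * (g ^ (l - l') * g ^ l')) \<le> C * (h ^ j * (h ^ (l - l') * g ^ l'))"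
      using gh C by (intro mult_left_mono mult_right_mono power_mono) auto
    also have "\<dots> = C * (h ^ (j + (l - l')) * g ^ l')" by (simp add: power_add)
    also have "j + (l - l') = j' + (j + l - (j' + l'))" using le by simp
    also have "C * (h ^ \<dots> * g ^ l') \<le> C * ((h ^ j' * H ^ (j + l - (j' + l'))) * g ^ l')"
      using gh C unfolding power_add by (intro mult_left_mono mult_right_mono power_mono) auto
    finally show "norm (A s u v) \<le> C * H ^ (j + l - (j' + l')) * (h ^ j' * g ^ l')" by (simp add: mult_ac)
  qed (use C in auto)
qed

lemma small_add:
  assumes "small \<alpha> T j l A" "small \<alpha> T j l B"
  shows "small \<alpha> T j l (\<lambda>s u v. A s u v + B s u v)"
proof -
  obtain C where C: "0 \<le> C" "\<And>s u v. 0 \<le> s \<Longrightarrow> s \<le> u \<Longrightarrow> u \<le> v \<Longrightarrow> v \<le> T \<Longrightarrow>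
     norm (A s u v) \<le> C * scales \<alpha> j l s u v"
    using assms(1) by (elim smallE) blast
  obtain D where D: "0 \<le> D" "\<And>s u v. 0 \<le> s \<Longrightarrow> s \<le> u \<Longrightarrow> u \<le> v \<Longrightarrow> v \<le> T \<Longrightarrow>
     norm (B s u v) \<le> D * scales \<alpha> j l s u v"
    using assms(2) by (elim smallE) blast
  show ?thesis
    by (rule smallI[of "C + D"])
      (use C(1) D(1) in \<open>auto simp: distrib_right intro!: norm_triangle_mono C(2) D(2)\<close>)
qed

text \<open>Any product-like operation adds the exponents.\<close>
lemma small_bounded_product:
  assumes A: "small \<alpha> T j l A" and B: "small \<alpha> T j' l' B"
    and op: "\<And>a b. norm (f a b) \<le> K * (norm a * norm b)" and K: "0 \<le> K"
  shows "small \<alpha> T (j + j') (l + l') (\<lambda>s u v. f (A s u v) (B s u v))"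
proof -
  obtain C where C: "0 \<le> C" "\<And>s u v. 0 \<le> s \<Longrightarrow> s \<le> u \<Longrightarrow> u \<le> v \<Longrightarrow> v \<le> T \<Longrightarrow>
     norm (A s u v) \<le> C * scales \<alpha> j l s u v"
    using A by (elim smallE) blast
  obtain D where D: "0 \<le> D" "\<And>s u v. 0 \<le> s \<Longrightarrow> s \<le> u \<Longrightarrow> u \<le> v \<Longrightarrow> v \<le> T \<Longrightarrow>
     norm (B s u v) \<le> D * (((v - s) powr \<alpha>) ^ j' * ((v - u) powr \<alpha>) ^ l')"
    using B by (elim smallE) blast
  show ?thesis
  proof (rule smallI[of "K * (C * D)"])
    fix s u v assume suv: "0 \<le> s" "s \<le> u" "u \<le> v" "v \<le> T"
    have "norm (f (A s u v) (B s u v)) \<le> K * (norm (A s u v) * norm (B s u v))" by (rule op)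
    also have "\<dots> \<le> K * ((C * scales \<alpha> j l s u v)
        * (D * (((v - s) powr \<alpha>) ^ j' * ((v - u) powr \<alpha>) ^ l')))"
      using C(1) D(1) K by (intro mult_left_mono mult_mono C(2)[OF suv] D(2)[OF suv]) auto
    finally show "norm (f (A s u v) (B s u v))
        \<le> K * (C * D) * scales \<alpha> (j + j') (l + l') s u v"
      by (simp add: power_add mult_ac)
  qed (use C D K in auto)
qed

lemma small_mult:
  fixes A B :: "real \<Rightarrow> real \<Rightarrow> real \<Rightarrow> real"
  shows "small \<alpha> T j l A \<Longrightarrow> small \<alpha> T j' l' B \<Longrightarrow>
    small \<alpha> T (j + j') (l + l') (\<lambda>s u v. A s u v * B s u v)"
  by (rule small_bounded_product[where K = 1]) (auto simp: abs_mult)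

lemma small_scaleR:
  "small \<alpha> T j l A \<Longrightarrow> small \<alpha> T j' l' B \<Longrightarrow>
    small \<alpha> T (j + j') (l + l') (\<lambda>s u v. A s u v *\<^sub>R B s u v)"
  by (rule small_bounded_product[where K = 1]) auto

lemma small_blinfun_apply:
  "small \<alpha> T j l A \<Longrightarrow> small \<alpha> T j' l' B \<Longrightarrow>
    small \<alpha> T (j + j') (l + l') (\<lambda>s u v. blinfun_apply (A s u v) (B s u v))"
  by (rule small_bounded_product[where K = 1]) (auto simp: norm_blinfun)

lemma small_blinfun_compose:
  "small \<alpha> T j l A \<Longrightarrow> small \<alpha> T j' l' B \<Longrightarrow>
    small \<alpha> T (j + j') (l + l') (\<lambda>s u v. A s u v o\<^sub>L B s u v)"
  by (rule small_bounded_product[where K = 1]) (auto simp: norm_blinfun_compose)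

lemma small_at_left:
  assumes A: "small \<alpha> T j 0 (\<lambda>s u v. A s v)" and \<alpha>: "0 \<le> \<alpha>"
  shows "small \<alpha> T j 0 (\<lambda>s u v. A s u)"
proof -
  obtain C where C: "0 \<le> C" "\<And>s u v. 0 \<le> s \<Longrightarrow> s \<le> u \<Longrightarrow> u \<le> v \<Longrightarrow> v \<le> T \<Longrightarrow>
     norm (A s v) \<le> C * scales \<alpha> j 0 s u v"
    using A by (elim smallE) blast
  show ?thesis
  proof (rule smallI[OF C(1)])
    fix s u v assume suv: "0 \<le> s" "s \<le> u" "u \<le> v" "v \<le> T"
    have "norm (A s u) \<le> C * ((u - s) powr \<alpha>) ^ j" using C(2)[of s u u] suv by simp
    also have "\<dots> \<le> C * ((v - s) powr \<alpha>) ^ j"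
      using C(1) suv \<alpha> by (intro mult_left_mono power_mono powr_mono2) auto
    finally show "norm (A s u) \<le> C * scales \<alpha> j 0 s u v" by simp
  qed
qed

text \<open>For \<open>u = s\<close> the two scales coincide.\<close>
lemma small_from_start:
  assumes "small \<alpha> T j l A"
  shows "small \<alpha> T (j + l) 0 (\<lambda>s u v. A s s v)"
  using assms unfolding small_def by (auto simp: power_add)

lemma small_const: "small \<alpha> T 0 0 (\<lambda>s u v. c)"
  by (rule smallI[of "norm c"]) auto

lemma finite_holder_sup_imp_small:
  assumes A: "finite_holder_sup (real l * \<alpha>) T A" and l: "0 < l" and diag: "\<And>u. 0 \<le> u \<Longrightarrow> u \<le> T \<Longrightarrow> A u u = 0"
  shows "small \<alpha> T 0 l (\<lambda>s u v. A u v)"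
proof -
  obtain C where C: "\<And>s t. 0 \<le> s \<Longrightarrow> s < t \<Longrightarrow> t \<le> T \<Longrightarrow> norm (A s t) / (t - s) powr (real l * \<alpha>) \<le> C"
    using A unfolding finite_holder_sup_def by blast
  show ?thesis
  proof (rule smallI[of "\<bar>C\<bar>"])
    fix s u v assume suv: "0 \<le> s" "s \<le> u" "u \<le> v" "v \<le> T"
    show "norm (A u v) \<le> \<bar>C\<bar> * scales \<alpha> 0 l s u v"
    proof (cases "u = v")
      case False
      then have "norm (A u v) \<le> C * (v - u) powr (real l * \<alpha>)"
        using C[of u v] suv by (simp add: divide_le_eq)
      also have "\<dots> \<le> \<bar>C\<bar> * (v - u) powr (real l * \<alpha>)" by (intro mult_right_mono) auto
      also have "(v - u) powr (real l * \<alpha>) = ((v - u) powr \<alpha>) ^ l" 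
        using powr_power[of "v - u" \<alpha> l] False by simp
      finally show ?thesis by simp
    qed (use diag suv in simp)
  qed simp
qed

lemma holder_paths_imp_small:
  assumes f: "f \<in> holder_paths \<alpha> T"
  shows "small \<alpha> T 0 1 (\<lambda>s u v. f v - f u)"
  using f unfolding holder_paths_def by (intro finite_holder_sup_imp_small) auto

lemma holder_paths_imp_bounded:
  assumes f: "f \<in> holder_paths \<alpha> T" and \<alpha>: "0 \<le> \<alpha>"
  shows "small \<alpha> T 0 0 (\<lambda>s u v. f v)"
proof -
  obtain C where C: "0 \<le> C" "\<And>s u v. 0 \<le> s \<Longrightarrow> s \<le> u \<Longrightarrow> u \<le> v \<Longrightarrow> v \<le> T \<Longrightarrow>
     norm (f v - f u) \<le> C * scales \<alpha> 0 1 s u v"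
    using holder_paths_imp_small[OF f] by (elim smallE) blast
  show ?thesis
  proof (rule smallI[of "norm (f 0) + C * T powr \<alpha>"])
    fix s u v assume suv: "0 \<le> s" "s \<le> u" "u \<le> v" "v \<le> T"
    have "norm (f v) \<le> norm (f 0) + norm (f v - f 0)" by (rule norm_triangle_sub)
    also have "norm (f v - f 0) \<le> C * v powr \<alpha>" using C(2)[of 0 0 v] suv by simp
    also have "\<dots> \<le> C * T powr \<alpha>" using C(1) suv \<alpha> by (intro mult_left_mono powr_mono2) auto
    finally show "norm (f v) \<le> (norm (f 0) + C * T powr \<alpha>) * scales \<alpha> 0 0 s u v"
      by simp
  qed (use C in auto)
qed

locale rough_path =
  fixes \<alpha> T :: real and X :: "real \<Rightarrow> real ^ 'd::finite" and XX :: "real \<Rightarrow> real \<Rightarrow> real ^ 'd ^ 'd"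
  assumes \<alpha>: "1 / 3 < \<alpha>" and rough: "(X, XX) \<in> rough_paths \<alpha> T"
begin

lemma \<alpha>_nonneg: "0 \<le> \<alpha>" using \<alpha> by simp

lemmas small_weaken = small_mono[OF _ \<alpha>_nonneg]

lemma chen:
  "0 \<le> s \<Longrightarrow> s \<le> u \<Longrightarrow> u \<le> t \<Longrightarrow> t \<le> T \<Longrightarrow> XX s t = XX s u + XX u t + (X u - X s) \<otimes>\<^sub>v (X t - X u)"
  using rough unfolding rough_paths_def by auto

lemma small_X: "small \<alpha> T 0 1 (\<lambda>s u v. X v - X u)"
  using rough holder_paths_imp_small[of X] unfolding rough_paths_def by simp

lemma small_XX: "small \<alpha> T 0 2 (\<lambda>s u v. XX u v)"
proof (rule finite_holder_sup_imp_small)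
  show "finite_holder_sup (real 2 * \<alpha>) T XX" using rough unfolding rough_paths_def by simp
  show "XX u u = 0" if "0 \<le> u" "u \<le> T" for u
    using chen[of u u u] that by (simp add: tensor_def vec_eq_iff)
qed simp

text \<open>
  A family \<open>J s\<close> of controlled paths indexed by its starting time has order \<open>k\<close> if it behaves, on
  every scale, like an iterated integral of length \<open>k\<close> started at \<open>s\<close>: the value vanishes like
  \<open>|v - s|\<^bsup>k \<alpha>\<^esup>\<close> and each derivative or increment costs one factor \<open>|v - s|\<^bsup>\<alpha>\<^esup>\<close>. The truncated
  subtraction covers the low orders \<open>k < 2\<close>.
\<close>
definition order :: "nat \<Rightarrow> (real \<Rightarrow> real \<Rightarrow> 'd jet) \<Rightarrow> bool" where
  "order k J \<longleftrightarrow>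
     small \<alpha> T k 0 (\<lambda>s u v. val (J s v)) \<and>
     small \<alpha> T (k - 1) 0 (\<lambda>s u v. grad (J s v)) \<and>
     small \<alpha> T (k - 2) 1 (\<lambda>s u v. grad (J s v) - grad (J s u)) \<and>
     small \<alpha> T (k - 2) 2 (\<lambda>s u v. val (J s v) - val (J s u) - grad (J s u) (X v - X u))"

lemma order_cong:
  assumes "\<And>s r. 0 \<le> s \<Longrightarrow> s \<le> r \<Longrightarrow> r \<le> T \<Longrightarrow> J s r = K s r"
  shows "order k J \<longleftrightarrow> order k K"
  unfolding order_def using assms by (intro arg_cong2[where f = "(\<and>)"] small_cong) auto

lemma order_mono: "order k J \<Longrightarrow> l \<le> k \<Longrightarrow> order l J"
  unfolding order_def by (auto elim!: small_weaken)

lemma order_increment: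
  assumes J: "order k J"
  shows "small \<alpha> T (k - 1) 1 (\<lambda>s u v. val (J s v) - val (J s u))"
proof -
  have "small \<alpha> T (k - 1 + 0) (0 + 1) (\<lambda>s u v. grad (J s u) (X v - X u))"
    using J \<alpha>_nonneg unfolding order_def by (intro small_blinfun_apply small_X small_at_left) auto
  then have "small \<alpha> T (k - 1) 1 (\<lambda>s u v. grad (J s u) (X v - X u))" by simp
  moreover have "small \<alpha> T (k - 1) 1 (\<lambda>s u v. val (J s v) - val (J s u) - grad (J s u) (X v - X u))"
    using J unfolding order_def by (auto elim!: small_weaken)
  ultimately show ?thesis using small_add by fastforce
qed

lemma order_add:
  assumes "order k J" "order k K"
  shows "order k (\<lambda>s r. J s r + K s r)"
proof -
  have "small \<alpha> T (k - 2) 1 (\<lambda>s u v. (grad (J s v) - grad (J s u)) + (grad (K s v) - grad (K s u)))"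
    "small \<alpha> T (k - 2) 2 (\<lambda>s u v. (val (J s v) - val (J s u) - grad (J s u) (X v - X u))
       + (val (K s v) - val (K s u) - grad (K s u) (X v - X u)))"
    using assms unfolding order_def by (auto intro!: small_add)
  with assms show ?thesis unfolding order_def
    by (auto intro!: small_add simp: blinfun.add_left algebra_simps)
qed

lemma order_zero: "order k (\<lambda>s r. 0)"
  unfolding order_def by (auto intro!: smallI[of 0])

lemma order_sum: "(\<And>i. i \<in> I \<Longrightarrow> order k (J i)) \<Longrightarrow> order k (\<lambda>s r. \<Sum>i\<in>I. J i s r)"
  by (induction I rule: infinite_finite_induct) (auto intro: order_add order_zero)

text \<open>
  The remainder of a product is
  \<open>J\<^sub>u R\<^sup>K + K\<^sub>u R\<^sup>J + (J\<^sub>v - J\<^sub>u) (K\<^sub>v - K\<^sub>u)\<close>, and each term has the exponents of order \<open>k + l\<close>.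
\<close>
lemma order_mult:
  assumes J: "order k J" and K: "order l K"
  shows "order (k + l) (\<lambda>s r. J s r * K s r)"
proof -
  note J' = J[unfolded order_def] and K' = K[unfolded order_def]
  have Ju: "small \<alpha> T k 0 (\<lambda>s u v. val (J s u))" "small \<alpha> T (k - 1) 0 (\<lambda>s u v. grad (J s u))"
    using J' by (auto intro!: small_at_left \<alpha>_nonneg)
  have Ku: "small \<alpha> T l 0 (\<lambda>s u v. val (K s u))" "small \<alpha> T (l - 1) 0 (\<lambda>s u v. grad (K s u))"
    using K' by (auto intro!: small_at_left \<alpha>_nonneg)
  have v: "small \<alpha> T (k + l) 0 (\<lambda>s u v. val (J s v * K s v))"
    using small_mult[of \<alpha> T k 0 "\<lambda>s u v. val (J s v)" l 0 "\<lambda>s u v. val (K s v)"] J' K' by simp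
  have g: "small \<alpha> T (k + l - 1) 0 (\<lambda>s u v. grad (J s v * K s v))"
    unfolding jet_simps
  proof (rule small_add)
    have "small \<alpha> T (k + (l - 1)) (0 + 0) (\<lambda>s u v. val (J s v) *\<^sub>R grad (K s v))"
      by (intro small_scaleR) (use J' K' in auto)
    then show "small \<alpha> T (k + l - 1) 0 (\<lambda>s u v. val (J s v) *\<^sub>R grad (K s v))"
      by (rule small_weaken) auto
    have "small \<alpha> T (l + (k - 1)) (0 + 0) (\<lambda>s u v. val (K s v) *\<^sub>R grad (J s v))"
      by (intro small_scaleR) (use J' K' in auto)
    then show "small \<alpha> T (k + l - 1) 0 (\<lambda>s u v. val (K s v) *\<^sub>R grad (J s v))"
      by (rule small_weaken) auto
  qed
  have gi: "small \<alpha> T (k + l - 2) 1 (\<lambda>s u v.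
      val (J s v) *\<^sub>R (grad (K s v) - grad (K s u)) + (val (J s v) - val (J s u)) *\<^sub>R grad (K s u)
    + (val (K s v) *\<^sub>R (grad (J s v) - grad (J s u)) + (val (K s v) - val (K s u)) *\<^sub>R grad (J s u)))"
  proof (intro small_add)
    have "small \<alpha> T (k + (l - 2)) (0 + 1) (\<lambda>s u v. val (J s v) *\<^sub>R (grad (K s v) - grad (K s u)))"
      by (intro small_scaleR) (use J' K' in auto)
    then show "small \<alpha> T (k + l - 2) 1 (\<lambda>s u v. val (J s v) *\<^sub>R (grad (K s v) - grad (K s u)))"
      by (rule small_weaken) auto
    have "small \<alpha> T (l + (k - 2)) (0 + 1) (\<lambda>s u v. val (K s v) *\<^sub>R (grad (J s v) - grad (J s u)))"
      by (intro small_scaleR) (use J' K' in auto)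
    then show "small \<alpha> T (k + l - 2) 1 (\<lambda>s u v. val (K s v) *\<^sub>R (grad (J s v) - grad (J s u)))"
      by (rule small_weaken) auto
    have "small \<alpha> T (k - 1 + (l - 1)) (1 + 0) (\<lambda>s u v. (val (J s v) - val (J s u)) *\<^sub>R grad (K s u))"
      by (intro small_scaleR order_increment J Ku)
    then show "small \<alpha> T (k + l - 2) 1 (\<lambda>s u v. (val (J s v) - val (J s u)) *\<^sub>R grad (K s u))"
      by (rule small_weaken) auto
    have "small \<alpha> T (l - 1 + (k - 1)) (1 + 0) (\<lambda>s u v. (val (K s v) - val (K s u)) *\<^sub>R grad (J s u))"
      by (intro small_scaleR order_increment K Ju)
    then show "small \<alpha> T (k + l - 2) 1 (\<lambda>s u v. (val (K s v) - val (K s u)) *\<^sub>R grad (J s u))"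
      by (rule small_weaken) auto
  qed
  have R: "small \<alpha> T (k + l - 2) 2 (\<lambda>s u v.
      val (J s u) * (val (K s v) - val (K s u) - grad (K s u) (X v - X u))
    + val (K s u) * (val (J s v) - val (J s u) - grad (J s u) (X v - X u))
    + (val (J s v) - val (J s u)) * (val (K s v) - val (K s u)))"
  proof (intro small_add)
    have "small \<alpha> T (k + (l - 2)) (0 + 2) (\<lambda>s u v. val (J s u) * (val (K s v) - val (K s u) - grad (K s u) (X v - X u)))"
      by (intro small_mult) (use Ju K' in auto)
    then show "small \<alpha> T (k + l - 2) 2 (\<lambda>s u v. val (J s u) * (val (K s v) - val (K s u) - grad (K s u) (X v - X u)))"
      by (rule small_weaken) auto
    have "small \<alpha> T (l + (k - 2)) (0 + 2) (\<lambda>s u v. val (K s u) * (val (J s v) - val (J s u) - grad (J s u) (X v - X u)))"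
      by (intro small_mult) (use Ku J' in auto)
    then show "small \<alpha> T (k + l - 2) 2 (\<lambda>s u v. val (K s u) * (val (J s v) - val (J s u) - grad (J s u) (X v - X u)))"
      by (rule small_weaken) auto
    have "small \<alpha> T (k - 1 + (l - 1)) (1 + 1) (\<lambda>s u v. (val (J s v) - val (J s u)) * (val (K s v) - val (K s u)))"
      by (intro small_mult order_increment J K)
    then show "small \<alpha> T (k + l - 2) 2 (\<lambda>s u v. (val (J s v) - val (J s u)) * (val (K s v) - val (K s u)))"
      by (rule small_weaken) auto
  qed
  show ?thesis unfolding order_def
  proof (intro conjI v g)
    show "small \<alpha> T (k + l - 2) 1 (\<lambda>s u v. grad (J s v * K s v) - grad (J s u * K s u))"
      using gi by (subst small_cong) (auto simp: algebra_simps)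
    show "small \<alpha> T (k + l - 2) 2 (\<lambda>s u v.
        val (J s v * K s v) - val (J s u * K s u) - grad (J s u * K s u) (X v - X u))"
      using R by (subst small_cong) (auto simp: algebra_simps blinfun.add_left blinfun.scaleR_left)
  qed
qed

lemma order_of_real:
  "small \<alpha> T 0 0 (\<lambda>s u v. c s) \<Longrightarrow> order 0 (\<lambda>s r. of_real (c s))"
  unfolding order_def by (auto intro!: smallI[of 0])

lemma order_scale:
  assumes "small \<alpha> T 0 0 (\<lambda>s u v. c s)" "order k J"
  shows "order k (\<lambda>s r. c s *\<^sub>R J s r)"
  using order_mult[OF order_of_real assms(2), of c] assms(1) by (simp add: scaleR_conv_of_real)

lemma order_one: "order 0 (\<lambda>s r. 1)"
  using order_of_real[of "\<lambda>_. 1"] by (simp add: small_const)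

lemma order_prod_mset:
  "(\<And>x. x \<in># M \<Longrightarrow> order (n x) (J x)) \<Longrightarrow> order (\<Sum>x\<in>#M. n x) (\<lambda>s r. \<Prod>x\<in>#M. J x s r)"
  by (induction M) (auto intro: order_mult order_one)

lemma order_prod_list:
  "(\<And>x. x \<in> set xs \<Longrightarrow> order (n x) (J x)) \<Longrightarrow> order (\<Sum>x\<leftarrow>xs. n x) (\<lambda>s r. \<Prod>x\<leftarrow>xs. J x s r)"
  by (induction xs) (auto intro: order_mult order_one)

text \<open>
  Telescoping: one factor \<open>P i\<close> is exchanged for \<open>Q i\<close> at a time.
\<close>
lemma order_prod_list_diff:
  assumes "\<And>i. order 0 (P i)" "\<And>i. order 0 (Q i)" "\<And>i. order k (\<lambda>s r. P i s r - Q i s r)"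
  shows "order k (\<lambda>s r. (\<Prod>i\<leftarrow>is. P i s r) - (\<Prod>i\<leftarrow>is. Q i s r))"
proof (induction "is")
  case (Cons i "is")
  have "order (0 + k) (\<lambda>s r. P i s r * ((\<Prod>i\<leftarrow>is. P i s r) - (\<Prod>i\<leftarrow>is. Q i s r)))"
    by (intro order_mult assms Cons)
  moreover have "order (k + (\<Sum>i\<leftarrow>is. 0)) (\<lambda>s r. (P i s r - Q i s r) * (\<Prod>i\<leftarrow>is. Q i s r))"
    by (intro order_mult order_prod_list assms)
  ultimately have "order k (\<lambda>s r. P i s r * ((\<Prod>i\<leftarrow>is. P i s r) - (\<Prod>i\<leftarrow>is. Q i s r))
     + (P i s r - Q i s r) * (\<Prod>i\<leftarrow>is. Q i s r))"
    by (intro order_add) simp_all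
  then show ?case by (simp add: algebra_simps)
qed (simp add: order_zero)

lemma controlled_imp_order:
  assumes "(Y, Y') \<in> controlled_paths \<alpha> T X"
  shows "order 0 (\<lambda>s r. Jet (Y r) (Y' r))"
  using assms holder_paths_imp_small[of Y' \<alpha> T] unfolding controlled_paths_def order_def
  by (auto intro!: holder_paths_imp_bounded \<alpha>_nonneg finite_holder_sup_imp_small)

lemma order_from_start:
  assumes J: "order 0 (\<lambda>s. w)"
  shows "order 1 (\<lambda>s r. w r - of_real (val (w s)))"
proof -
  have "small \<alpha> T (0 - 1 + 1) 0 (\<lambda>s u v. val (w v) - val (w s))"
    using small_from_start[OF order_increment[OF J]] by simp
  then show ?thesis using J unfolding order_def by simp
qed

end

section \<open>Rough integration raises the order by one\<close>

definition pairing ::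
    "((real ^ 'd::finite) \<Rightarrow>\<^sub>L real) \<Rightarrow> ((real ^ 'd) \<Rightarrow>\<^sub>L real) \<Rightarrow> real ^ 'd ^ 'd \<Rightarrow> real" where
  "pairing a b M = (\<Sum>i\<in>UNIV. \<Sum>j\<in>UNIV. M $ i $ j * (a (axis i 1) * b (axis j 1)))"

lemma diamond_mult_right: "diamond (Blinfun blinfun_mult_right o\<^sub>L a) b M = pairing a b M"
  by (simp add: diamond_def pairing_def bounded_linear_Blinfun_apply bounded_linear_blinfun_mult_right
      blinfun_mult_right.rep_eq)

lemma pairing_tensor: "pairing a b (x \<otimes>\<^sub>v y) = a x * b y"
  by (simp add: diamond_tensor bounded_linear_Blinfun_apply bounded_linear_blinfun_mult_right
      blinfun_mult_right.rep_eq flip: diamond_mult_right)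

lemma pairing_add_right: "pairing a b (M + N) = pairing a b M + pairing a b N"
  by (simp add: pairing_def distrib_right sum.distrib)

lemma pairing_diff_left: "pairing (a - a') b M = pairing a b M - pairing a' b M"
  by (simp add: pairing_def blinfun.diff_left algebra_simps sum_subtractf)

lemma pairing_diff_mid: "pairing a (b - b') M = pairing a b M - pairing a b' M"
  by (simp add: pairing_def blinfun.diff_left algebra_simps sum_subtractf)

lemma pairing_add_left: "pairing (a + a') b M = pairing a b M + pairing a' b M"
  by (simp add: pairing_def blinfun.add_left algebra_simps sum.distrib)

lemma pairing_scaleR_left: "pairing (c *\<^sub>R a) b M = c * pairing a b M"
  by (simp add: pairing_def blinfun.scaleR_left sum_distrib_left mult_ac)

lemma pairing_bound:
  fixes M :: "real ^ 'd ^ 'd"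
  shows "\<bar>pairing a b M\<bar> \<le> real (CARD('d::finite) * CARD('d)) * (norm a * norm b * norm M)"
proof -
  have "\<bar>pairing a b M\<bar> \<le> (\<Sum>i\<in>(UNIV::'d set). \<Sum>j\<in>(UNIV::'d set). norm a * norm b * norm M)"
    unfolding pairing_def
  proof (intro order_trans[OF sum_abs] sum_mono)
    fix i j :: 'd
    have "\<bar>M $ i $ j\<bar> \<le> norm M"
      using component_le_norm_cart[of "M $ i" j] Finite_Cartesian_Product.norm_nth_le[of M i] by linarith
    moreover have "\<bar>a (axis i 1)\<bar> \<le> norm a" "\<bar>b (axis j 1)\<bar> \<le> norm b"
      using norm_blinfun[of a "axis i 1"] norm_blinfun[of b "axis j 1"] by (simp_all add: norm_axis_1)
    ultimately have "\<bar>M $ i $ j\<bar> * (\<bar>a (axis i 1)\<bar> * \<bar>b (axis j 1)\<bar>) \<le> norm M * (norm a * norm b)"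
      by (intro mult_mono) auto
    then show "\<bar>M $ i $ j * (a (axis i 1) * b (axis j 1))\<bar> \<le> norm a * norm b * norm M"
      by (simp add: abs_mult mult_ac)
  qed
  then show ?thesis by (simp add: mult_ac)
qed

lemma small_dominated:
  assumes B: "small \<alpha> T j l B" and K: "0 \<le> K" and le: "\<And>s u v. norm (A s u v) \<le> K * norm (B s u v)"
  shows "small \<alpha> T j l A"
proof -
  obtain C where C: "0 \<le> C" "\<And>s u v. 0 \<le> s \<Longrightarrow> s \<le> u \<Longrightarrow> u \<le> v \<Longrightarrow> v \<le> T \<Longrightarrow>
     norm (B s u v) \<le> C * scales \<alpha> j l s u v"
    using B by (elim smallE) blast
  show ?thesis
  proof (rule smallI[of "K * C"])
    fix s u v assume suv: "0 \<le> s" "s \<le> u" "u \<le> v" "v \<le> T"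
    show "norm (A s u v) \<le> K * C * scales \<alpha> j l s u v"
      using order_trans[OF le mult_left_mono[OF C(2)[OF suv] K]] by (simp add: mult_ac)
  qed (use K C in simp)
qed

lemma small_pairing:
  fixes M :: "real \<Rightarrow> real \<Rightarrow> real \<Rightarrow> real ^ 'd::finite ^ 'd"
  assumes "small \<alpha> T j l a" "small \<alpha> T j' l' b" "small \<alpha> T j'' l'' M"
  shows "small \<alpha> T (j + j' + j'') (l + l' + l'') (\<lambda>s u v. pairing (a s u v) (b s u v) (M s u v))"
proof (rule small_dominated[where K = "real (CARD('d) * CARD('d))"])
  have norms: "small \<alpha> T j l (\<lambda>s u v. norm (a s u v))" "small \<alpha> T j' l' (\<lambda>s u v. norm (b s u v))"
    "small \<alpha> T j'' l'' (\<lambda>s u v. norm (M s u v))"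
    using assms unfolding small_def by simp_all
  show "small \<alpha> T (j + j' + j'') (l + l' + l'') (\<lambda>s u v. norm (a s u v) * norm (b s u v) * norm (M s u v))"
    by (intro small_mult norms)
qed (use pairing_bound in \<open>auto simp: abs_mult simp del: of_nat_mult\<close>)

text \<open>
  The parts of a three-point defect live on subintervals of \<open>[a, b]\<close>; their bounds are needed on the
  scales of the whole interval.
\<close>
lemma small_enlargeE:
  assumes A: "small \<alpha> T j l A" and \<alpha>: "0 \<le> \<alpha>"
  obtains C where "0 \<le> C" "\<And>s a u v b. 0 \<le> s \<Longrightarrow> s \<le> a \<Longrightarrow> a \<le> u \<Longrightarrow> u \<le> v \<Longrightarrow> v \<le> b \<Longrightarrow> b \<le> T \<Longrightarrow>
     norm (A s u v) \<le> C * scales \<alpha> j l s a b"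
proof -
  obtain C where C: "0 \<le> C" "\<And>s u v. 0 \<le> s \<Longrightarrow> s \<le> u \<Longrightarrow> u \<le> v \<Longrightarrow> v \<le> T \<Longrightarrow>
     norm (A s u v) \<le> C * scales \<alpha> j l s u v"
    using A by (elim smallE) blast
  show thesis
  proof (rule that[OF C(1)])
    fix s a u v b assume le: "0 \<le> s" "s \<le> a" "a \<le> u" "u \<le> v" "v \<le> b" "b \<le> T"
    have "norm (A s u v) \<le> C * scales \<alpha> j l s u v" using C(2) le by simp
    also have "\<dots> \<le> C * scales \<alpha> j l s a b"
      using C(1) le \<alpha> by (intro mult_left_mono mult_mono power_mono powr_mono2) auto
    finally show "norm (A s u v) \<le> C * scales \<alpha> j l s a b" .
  qed
qed

text \<open>The local approximation \<open>j\<^sub>u w\<^bsub>u,v\<^esub> + (j'\<^sub>u \<diamondop> w'\<^sub>u) XX\<^bsub>u,v\<^esub>\<close> of a scalar rough integral.\<close>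
definition germ ::
    "(real \<Rightarrow> real \<Rightarrow> real ^ 'd ^ 'd) \<Rightarrow> (real \<Rightarrow> 'd::finite jet) \<Rightarrow> (real \<Rightarrow> 'd jet) \<Rightarrow> real \<Rightarrow> real \<Rightarrow> real" where
  "germ XX w j u v = val (j u) * (val (w v) - val (w u)) + pairing (grad (j u)) (grad (w u)) (XX u v)"

definition has_rint ::
    "(real \<Rightarrow> real \<Rightarrow> real ^ 'd ^ 'd) \<Rightarrow> (real \<Rightarrow> 'd::finite jet) \<Rightarrow> (real \<Rightarrow> 'd jet) \<Rightarrow> real \<Rightarrow> real \<Rightarrow> real \<Rightarrow> bool" where
  "has_rint XX w j s t I \<longleftrightarrow> (germ_sum (germ XX w j) \<longlongrightarrow> I) (mesh_filter s t)"

definition rint ::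
    "(real \<Rightarrow> real \<Rightarrow> real ^ 'd ^ 'd) \<Rightarrow> (real \<Rightarrow> 'd::finite jet) \<Rightarrow> (real \<Rightarrow> 'd jet) \<Rightarrow> real \<Rightarrow> real \<Rightarrow> real" where
  "rint XX w j s t = Lim (mesh_filter s t) (germ_sum (germ XX w j))"

lemma rint_unique: "has_rint XX w j s t I \<Longrightarrow> s \<le> t \<Longrightarrow> rint XX w j s t = I"
  unfolding has_rint_def rint_def using tendsto_Lim mesh_filter_neq_bot by blast

lemma has_rint_add:
  assumes "has_rint XX w j s t I" "has_rint XX w k s t J"
  shows "has_rint XX w (\<lambda>r. j r + k r) s t (I + J)"
proof -
  have eq: "germ_sum (germ XX w (\<lambda>r. j r + k r)) = (\<lambda>P. germ_sum (germ XX w j) P + germ_sum (germ XX w k) P)"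
  proof
    have "germ XX w (\<lambda>r. j r + k r) u v = germ XX w j u v + germ XX w k u v" for u v
      by (simp add: germ_def pairing_add_left algebra_simps)
    then show "germ_sum (germ XX w (\<lambda>r. j r + k r)) P = germ_sum (germ XX w j) P + germ_sum (germ XX w k) P" for P
      unfolding germ_sum_def by (simp add: case_prod_unfold sum_list_addf)
  qed
  show ?thesis using assms unfolding has_rint_def eq by (intro tendsto_add)
qed

lemma has_rint_scale:
  assumes "has_rint XX w j s t I"
  shows "has_rint XX w (\<lambda>r. c *\<^sub>R j r) s t (c * I)"
proof -
  have eq: "germ_sum (germ XX w (\<lambda>r. c *\<^sub>R j r)) = (\<lambda>P. c * germ_sum (germ XX w j) P)"
  proof
    have "germ XX w (\<lambda>r. c *\<^sub>R j r) u v = c * germ XX w j u v" for u v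
      by (simp add: germ_def pairing_scaleR_left algebra_simps)
    then show "germ_sum (germ XX w (\<lambda>r. c *\<^sub>R j r)) P = c * germ_sum (germ XX w j) P" for P
      unfolding germ_sum_def by (simp add: case_prod_unfold sum_list_const_mult)
  qed
  show ?thesis using assms unfolding has_rint_def eq by (intro tendsto_mult_left)
qed

lemma has_rint_zero: "has_rint XX w (\<lambda>r. 0) s t 0"
proof -
  have eq: "germ_sum (germ XX w (\<lambda>r. 0)) = (\<lambda>P. 0)"
    unfolding germ_sum_def germ_def by (simp add: pairing_def case_prod_unfold)
  show ?thesis unfolding has_rint_def eq by simp
qed

lemma has_rint_sum:
  "(\<And>i. i \<in> S \<Longrightarrow> has_rint XX w (j i) s t (I i)) \<Longrightarrow> has_rint XX w (\<lambda>r. \<Sum>i\<in>S. j i r) s t (\<Sum>i\<in>S. I i)"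
  by (induction S rule: infinite_finite_induct) (auto intro: has_rint_add has_rint_zero)

context rough_path
begin

lemma orderD:
  assumes "order k J"
  shows "small \<alpha> T k 0 (\<lambda>s u v. val (J s v))"
    and "small \<alpha> T (k - 1) 0 (\<lambda>s u v. grad (J s v))"
    and "small \<alpha> T (k - 2) 1 (\<lambda>s u v. grad (J s v) - grad (J s u))"
    and "small \<alpha> T (k - 2) 2 (\<lambda>s u v. val (J s v) - val (J s u) - grad (J s u) (X v - X u))"
  using assms unfolding order_def by blast+

text \<open>
  The defect of additivity of the germ is, by Chen's relation,
  \<open>- R\<^sup>j\<^bsub>a,m\<^esub> w\<^bsub>m,b\<^esub> - j'\<^sub>a X\<^bsub>a,m\<^esub> (R\<^sup>w\<^bsub>m,b\<^esub> + (w'\<^sub>m - w'\<^sub>a) X\<^bsub>m,b\<^esub>) - (j'\<^sub>m \<diamondop> w'\<^sub>m - j'\<^sub>a \<diamondop> w'\<^sub>a) XX\<^bsub>m,b\<^esub>\<close>,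
  of third order in \<open>|b - a|\<^bsup>\<alpha>\<^esup>\<close>.
\<close>
lemma germ_defect:
  assumes w: "order 0 (\<lambda>s. w)" and J: "order k J"
  obtains K where "0 \<le> K"
    "\<And>s a m b. 0 \<le> s \<Longrightarrow> s \<le> a \<Longrightarrow> a \<le> m \<Longrightarrow> m \<le> b \<Longrightarrow> b \<le> T \<Longrightarrow>
      \<bar>germ XX w (J s) a b - germ XX w (J s) a m - germ XX w (J s) m b\<bar>
        \<le> K * scales \<alpha> (k - 2) 3 s a b"
proof -
  define D where "D = real (CARD('d) * CARD('d))"
  have D: "0 \<le> D" by (simp add: D_def)
  have grad_small: "small \<alpha> T (k - 2) 0 (\<lambda>s u v. grad (J s v))"
    by (rule small_weaken[where j = "k - 1" and l = 0]) (use orderD(2)[OF J] in auto)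
  obtain C1 where C1: "0 \<le> C1" "\<And>s a u v b. 0 \<le> s \<Longrightarrow> s \<le> a \<Longrightarrow> a \<le> u \<Longrightarrow> u \<le> v \<Longrightarrow> v \<le> b \<Longrightarrow> b \<le> T \<Longrightarrow>
     norm (val (J s v) - val (J s u) - grad (J s u) (X v - X u)) \<le> C1 * scales \<alpha> (k - 2) 2 s a b"
    by (rule small_enlargeE[OF orderD(4)[OF J] \<alpha>_nonneg]) blast
  obtain C2 where C2: "0 \<le> C2" "\<And>s a u v b. 0 \<le> s \<Longrightarrow> s \<le> a \<Longrightarrow> a \<le> u \<Longrightarrow> u \<le> v \<Longrightarrow> v \<le> b \<Longrightarrow> b \<le> T \<Longrightarrow>
     norm (val (w v) - val (w u)) \<le> C2 * scales \<alpha> (0 - 1) 1 s a b"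
    by (rule small_enlargeE[OF order_increment[OF w] \<alpha>_nonneg]) blast
  obtain C3 where C3: "0 \<le> C3" "\<And>s a u v b. 0 \<le> s \<Longrightarrow> s \<le> a \<Longrightarrow> a \<le> u \<Longrightarrow> u \<le> v \<Longrightarrow> v \<le> b \<Longrightarrow> b \<le> T \<Longrightarrow>
     norm (grad (J s v)) \<le> C3 * scales \<alpha> (k - 2) 0 s a b"
    by (rule small_enlargeE[OF grad_small \<alpha>_nonneg]) blast
  obtain C4 where C4: "0 \<le> C4" "\<And>s a u v b. 0 \<le> s \<Longrightarrow> s \<le> a \<Longrightarrow> a \<le> u \<Longrightarrow> u \<le> v \<Longrightarrow> v \<le> b \<Longrightarrow> b \<le> T \<Longrightarrow>
     norm (X v - X u) \<le> C4 * scales \<alpha> 0 1 s a b"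
    by (rule small_enlargeE[OF small_X \<alpha>_nonneg]) blast
  obtain C5 where C5: "0 \<le> C5" "\<And>s a u v b. 0 \<le> s \<Longrightarrow> s \<le> a \<Longrightarrow> a \<le> u \<Longrightarrow> u \<le> v \<Longrightarrow> v \<le> b \<Longrightarrow> b \<le> T \<Longrightarrow>
     norm (val (w v) - val (w u) - grad (w u) (X v - X u)) \<le> C5 * scales \<alpha> (0 - 2) 2 s a b"
    by (rule small_enlargeE[OF orderD(4)[OF w] \<alpha>_nonneg]) blast
  obtain C6 where C6: "0 \<le> C6" "\<And>s a u v b. 0 \<le> s \<Longrightarrow> s \<le> a \<Longrightarrow> a \<le> u \<Longrightarrow> u \<le> v \<Longrightarrow> v \<le> b \<Longrightarrow> b \<le> T \<Longrightarrow>
     norm (grad (w v) - grad (w u)) \<le> C6 * scales \<alpha> (0 - 2) 1 s a b"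
    by (rule small_enlargeE[OF orderD(3)[OF w] \<alpha>_nonneg]) blast
  obtain C7 where C7: "0 \<le> C7" "\<And>s a u v b. 0 \<le> s \<Longrightarrow> s \<le> a \<Longrightarrow> a \<le> u \<Longrightarrow> u \<le> v \<Longrightarrow> v \<le> b \<Longrightarrow> b \<le> T \<Longrightarrow>
     norm (grad (J s v) - grad (J s u)) \<le> C7 * scales \<alpha> (k - 2) 1 s a b"
    by (rule small_enlargeE[OF orderD(3)[OF J] \<alpha>_nonneg]) blast
  obtain C8 where C8: "0 \<le> C8" "\<And>s a u v b. 0 \<le> s \<Longrightarrow> s \<le> a \<Longrightarrow> a \<le> u \<Longrightarrow> u \<le> v \<Longrightarrow> v \<le> b \<Longrightarrow> b \<le> T \<Longrightarrow>
     norm (grad (w v)) \<le> C8 * scales \<alpha> (0 - 1) 0 s a b"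
    by (rule small_enlargeE[OF orderD(2)[OF w] \<alpha>_nonneg]) blast
  obtain C9 where C9: "0 \<le> C9" "\<And>s a u v b. 0 \<le> s \<Longrightarrow> s \<le> a \<Longrightarrow> a \<le> u \<Longrightarrow> u \<le> v \<Longrightarrow> v \<le> b \<Longrightarrow> b \<le> T \<Longrightarrow>
     norm (XX u v) \<le> C9 * scales \<alpha> 0 2 s a b"
    by (rule small_enlargeE[OF small_XX \<alpha>_nonneg]) blast
  define K where "K = C1 * C2 + C3 * C4 * (C5 + C6 * C4) + D * (C7 * C8 * C9) + D * (C3 * C6 * C9)"
  show thesis
  proof (rule that[of K])
    show "0 \<le> K" using C1 C2 C3 C4 C5 C6 C7 C8 C9 D by (simp add: K_def)
    fix s a m b assume le: "0 \<le> s" "s \<le> a" "a \<le> m" "m \<le> b" "b \<le> T"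
    define H g where "H = ((b - s) powr \<alpha>) ^ (k - 2)" and "g = (b - a) powr \<alpha>"
    have pos: "0 \<le> H" "0 \<le> g" by (auto simp: H_def g_def)
    define Rj where "Rj = val (J s m) - val (J s a) - grad (J s a) (X m - X a)"
    define Rw where "Rw = val (w b) - val (w m) - grad (w m) (X b - X m)"
    have b1: "\<bar>Rj\<bar> \<le> C1 * (H * g\<^sup>2)"
      using C1(2)[of s a a m b] le by (simp add: Rj_def H_def g_def)
    have b2: "\<bar>val (w b) - val (w m)\<bar> \<le> C2 * g" using C2(2)[of s a m b b] le by (simp add: g_def)
    have b3: "norm (grad (J s a)) \<le> C3 * H" using C3(2)[of s a a a b] le by (simp add: H_def)
    have b4: "norm (X m - X a) \<le> C4 * g" "norm (X b - X m) \<le> C4 * g"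
      using C4(2)[of s a a m b] C4(2)[of s a m b b] le by (simp_all add: g_def)
    have b5: "\<bar>Rw\<bar> \<le> C5 * g\<^sup>2" using C5(2)[of s a m b b] le by (simp add: Rw_def g_def)
    have b6: "norm (grad (w m) - grad (w a)) \<le> C6 * g" using C6(2)[of s a a m b] le by (simp add: g_def)
    have b7: "norm (grad (J s m) - grad (J s a)) \<le> C7 * (H * g)"
      using C7(2)[of s a a m b] le by (simp add: H_def g_def)
    have b8: "norm (grad (w m)) \<le> C8" using C8(2)[of s a a m b] le by simp
    have b9: "norm (XX m b) \<le> C9 * g\<^sup>2" using C9(2)[of s a m b b] le by (simp add: g_def)
    have id: "germ XX w (J s) a b - germ XX w (J s) a m - germ XX w (J s) m b
        = - (Rj * (val (w b) - val (w m)))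
          - grad (J s a) (X m - X a) * (Rw + (grad (w m) - grad (w a)) (X b - X m))
          - pairing (grad (J s m) - grad (J s a)) (grad (w m)) (XX m b)
          - pairing (grad (J s a)) (grad (w m) - grad (w a)) (XX m b)"
      unfolding germ_def Rj_def Rw_def chen[OF order_trans[OF le(1,2)] le(3-5)]
      by (simp add: pairing_add_right pairing_tensor pairing_diff_left pairing_diff_mid
          blinfun.diff_left algebra_simps)
    have t1: "\<bar>Rj * (val (w b) - val (w m))\<bar> \<le> (C1 * (H * g\<^sup>2)) * (C2 * g)"
      unfolding abs_mult using b1 b2 C1 pos by (intro mult_mono) auto
    have t2a: "\<bar>grad (J s a) (X m - X a)\<bar> \<le> (C3 * H) * (C4 * g)"
      using norm_blinfun[of "grad (J s a)" "X m - X a"] mult_mono[OF b3 b4(1)] C3 pos by simp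
    have "\<bar>(grad (w m) - grad (w a)) (X b - X m)\<bar> \<le> (C6 * g) * (C4 * g)"
      using norm_blinfun[of "grad (w m) - grad (w a)" "X b - X m"] mult_mono[OF b6 b4(2)] C6 pos by simp
    then have t2b: "\<bar>Rw + (grad (w m) - grad (w a)) (X b - X m)\<bar> \<le> C5 * g\<^sup>2 + (C6 * g) * (C4 * g)"
      using b5 by linarith
    have t2: "\<bar>grad (J s a) (X m - X a) * (Rw + (grad (w m) - grad (w a)) (X b - X m))\<bar>
        \<le> ((C3 * H) * (C4 * g)) * (C5 * g\<^sup>2 + (C6 * g) * (C4 * g))"
      unfolding abs_mult using t2a t2b C3 C4 pos by (intro mult_mono) auto
    have t3: "\<bar>pairing (grad (J s m) - grad (J s a)) (grad (w m)) (XX m b)\<bar>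
        \<le> D * ((C7 * (H * g)) * C8 * (C9 * g\<^sup>2))"
      using pairing_bound[of "grad (J s m) - grad (J s a)" "grad (w m)" "XX m b"] unfolding D_def[symmetric]
      by (rule order_trans) (use b7 b8 b9 C7 C8 D pos in \<open>intro mult_left_mono mult_mono, auto\<close>)
    have t4: "\<bar>pairing (grad (J s a)) (grad (w m) - grad (w a)) (XX m b)\<bar>
        \<le> D * ((C3 * H) * (C6 * g) * (C9 * g\<^sup>2))"
      using pairing_bound[of "grad (J s a)" "grad (w m) - grad (w a)" "XX m b"] unfolding D_def[symmetric]
      by (rule order_trans) (use b3 b6 b9 C3 C6 D pos in \<open>intro mult_left_mono mult_mono, auto\<close>)
    have "\<bar>germ XX w (J s) a b - germ XX w (J s) a m - germ XX w (J s) m b\<bar>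
        \<le> (C1 * (H * g\<^sup>2)) * (C2 * g) + ((C3 * H) * (C4 * g)) * (C5 * g\<^sup>2 + (C6 * g) * (C4 * g))
          + D * ((C7 * (H * g)) * C8 * (C9 * g\<^sup>2)) + D * ((C3 * H) * (C6 * g) * (C9 * g\<^sup>2))"
      unfolding id using t1 t2 t3 t4 by linarith
    also have "\<dots> = K * (H * g ^ 3)"
      by (simp add: K_def power2_eq_square power3_eq_cube algebra_simps)
    finally show "\<bar>germ XX w (J s) a b - germ XX w (J s) a m - germ XX w (J s) m b\<bar>
        \<le> K * scales \<alpha> (k - 2) 3 s a b" by (simp add: H_def g_def)
  qed
qed

text \<open>
  Sewing with exponent \<open>3 \<alpha> > 1\<close>. On intervals inside \<open>[s, v]\<close> the factor
  \<open>|b - s|\<^bsup>(k - 2) \<alpha>\<^esup>\<close> of the defect is at most \<open>|v - s|\<^bsup>(k - 2) \<alpha>\<^esup>\<close>, and it passes through the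
  sewing lemma as a constant.
\<close>
lemma rint_exists_and_close:
  assumes w: "order 0 (\<lambda>s. w)" and J: "order k J"
  shows "\<And>s u v. 0 \<le> s \<Longrightarrow> s \<le> u \<Longrightarrow> u \<le> v \<Longrightarrow> v \<le> T \<Longrightarrow> has_rint XX w (J s) u v (rint XX w (J s) u v)"
    and "small \<alpha> T (k - 2) 3 (\<lambda>s u v. rint XX w (J s) u v - germ XX w (J s) u v)"
proof -
  obtain K where K: "0 \<le> K"
    "\<And>s a m b. 0 \<le> s \<Longrightarrow> s \<le> a \<Longrightarrow> a \<le> m \<Longrightarrow> m \<le> b \<Longrightarrow> b \<le> T \<Longrightarrow>
      \<bar>germ XX w (J s) a b - germ XX w (J s) a m - germ XX w (J s) m b\<bar>
        \<le> K * scales \<alpha> (k - 2) 3 s a b"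
    using germ_defect[OF w J] by blast
  have \<theta>: "1 < 3 * \<alpha>" using \<alpha> by simp
  have cube: "(x powr \<alpha>) ^ 3 = x powr (3 * \<alpha>)" if "0 \<le> x" for x
    using powr_power[of x \<alpha> 3] \<alpha> by (cases "x = 0") auto
  let ?C = "sewing_const (3 * \<alpha>)"
  have key: "has_rint XX w (J s) u v (rint XX w (J s) u v) \<and>
      \<bar>rint XX w (J s) u v - germ XX w (J s) u v\<bar>
        \<le> ?C * K * scales \<alpha> (k - 2) 3 s u v"
    if suv: "0 \<le> s" "s \<le> u" "u \<le> v" "v \<le> T" for s u v
  proof -
    let ?K = "K * ((v - s) powr \<alpha>) ^ (k - 2)"
    have defect: "norm (germ XX w (J s) a b - germ XX w (J s) a m - germ XX w (J s) m b) \<le> ?K * (b - a) powr (3 * \<alpha>)"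
      if "u \<le> a" "a \<le> m" "m \<le> b" "b \<le> v" for a m b
    proof -
      have "norm (germ XX w (J s) a b - germ XX w (J s) a m - germ XX w (J s) m b)
          \<le> K * scales \<alpha> (k - 2) 3 s a b"
        unfolding real_norm_def using suv that by (intro K(2)) auto
      also have "\<dots> \<le> K * (((v - s) powr \<alpha>) ^ (k - 2) * ((b - a) powr \<alpha>) ^ 3)"
        using K(1) suv that \<alpha> by (intro mult_left_mono mult_right_mono power_mono powr_mono2) auto
      finally show ?thesis using that cube[of "b - a"] by (simp add: mult.assoc)
    qed
    have "0 \<le> ?K" using K(1) by simp
    obtain I where I: "(germ_sum (germ XX w (J s)) \<longlongrightarrow> I) (mesh_filter u v)"
      "norm (I - germ XX w (J s) u v) \<le> ?C * ?K * (v - u) powr (3 * \<alpha>)"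
      by (rule sewing[OF suv(3) \<theta> \<open>0 \<le> ?K\<close> defect]) blast+
    moreover have "rint XX w (J s) u v = I" using I(1) suv by (intro rint_unique) (simp add: has_rint_def)
    ultimately show ?thesis using cube[of "v - u"] suv by (simp add: has_rint_def mult.assoc)
  qed
  then show "\<And>s u v. 0 \<le> s \<Longrightarrow> s \<le> u \<Longrightarrow> u \<le> v \<Longrightarrow> v \<le> T \<Longrightarrow> has_rint XX w (J s) u v (rint XX w (J s) u v)"
    by blast
  show "small \<alpha> T (k - 2) 3 (\<lambda>s u v. rint XX w (J s) u v - germ XX w (J s) u v)"
    by (rule smallI[of "?C * K"]) (use key K(1) sewing_const_pos[OF \<theta>] in auto)
qed

lemma rint_additive:
  assumes w: "order 0 (\<lambda>s. w)" and J: "order k J" and le: "0 \<le> s" "s \<le> a" "a \<le> u" "u \<le> v" "v \<le> T"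
  shows "rint XX w (J s) a v = rint XX w (J s) a u + rint XX w (J s) u v"
  using germ_sum_limit_additive[of a u v "germ XX w (J s)"] rint_exists_and_close(1)[OF w J] le
  unfolding has_rint_def by (meson order_trans)

text \<open>The indefinite integral \<open>\<integral>\<^sub>s j dw\<close> with its Gubinelli derivative \<open>j w'\<close>.\<close>
definition integral_jet :: "(real \<Rightarrow> 'd jet) \<Rightarrow> (real \<Rightarrow> 'd jet) \<Rightarrow> real \<Rightarrow> real \<Rightarrow> 'd jet" where
  "integral_jet w j s r = Jet (rint XX w j s r) (val (j r) *\<^sub>R grad (w r))"

text \<open>
  The increment of the integral over \<open>[u, v]\<close> is the leading term \<open>J\<^sub>u w\<^bsub>u,v\<^esub>\<close>, the second-order
  term \<open>(J'\<^sub>u \<diamondop> w'\<^sub>u) XX\<^bsub>u,v\<^esub>\<close> and the sewing error, with exponents \<open>(k, 1)\<close>, \<open>(k - 1, 2)\<close> and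
  \<open>(k - 2, 3)\<close> on the two scales. For \<open>u = s\<close> all three are of order \<open>k + 1\<close> in \<open>|v - s|\<^bsup>\<alpha>\<^esup>\<close>; after
  \<open>J\<^sub>u w'\<^sub>u X\<^bsub>u,v\<^esub>\<close> is subtracted from the leading term, all three are \<open>(k - 1, 2)\<close>.
\<close>
theorem order_integral:
  assumes w: "order 0 (\<lambda>s. w)" and J: "order k J"
  shows "order (Suc k) (\<lambda>s. integral_jet w (J s) s)"
proof -
  note w' = w[unfolded order_def, simplified] and J' = J[unfolded order_def]
  have Ju: "small \<alpha> T k 0 (\<lambda>s u v. val (J s u))" "small \<alpha> T (k - 1) 0 (\<lambda>s u v. grad (J s u))"
    using J' by (auto intro!: small_at_left \<alpha>_nonneg)
  have wu: "small \<alpha> T 0 0 (\<lambda>s u v. grad (w u))"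
    using w' by (auto intro: small_at_left[of \<alpha> T 0 "\<lambda>s. grad \<circ> w", unfolded o_def] \<alpha>_nonneg)
  have rest: "small \<alpha> T (k - 2) 3 (\<lambda>s u v. rint XX w (J s) u v - germ XX w (J s) u v)"
    by (rule rint_exists_and_close(2)[OF w J])
  have second: "small \<alpha> T (k - 1) 2 (\<lambda>s u v. pairing (grad (J s u)) (grad (w u)) (XX u v))"
    using small_pairing[OF Ju(2) wu small_XX] by (simp add: numeral_2_eq_2)
  have lead: "small \<alpha> T k 1 (\<lambda>s u v. val (J s u) * (val (w v) - val (w u)))"
    using small_mult[OF Ju(1) order_increment[OF w]] by simp
  have "small \<alpha> T (Suc k) 0 (\<lambda>s u v. (rint XX w (J s) s v - germ XX w (J s) s v)
      + pairing (grad (J s s)) (grad (w s)) (XX s v) + val (J s s) * (val (w v) - val (w s)))"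
    by (intro small_add small_weaken[OF small_from_start[OF rest]]
        small_weaken[OF small_from_start[OF second]] small_weaken[OF small_from_start[OF lead]]) auto
  then have v: "small \<alpha> T (Suc k) 0 (\<lambda>s u v. val (integral_jet w (J s) s v))"
    by (simp add: germ_def integral_jet_def)
  have g: "small \<alpha> T (Suc k - 1) 0 (\<lambda>s u v. grad (integral_jet w (J s) s v))"
    using small_scaleR[of \<alpha> T k 0 "\<lambda>s u v. val (J s v)" 0 0 "\<lambda>s u v. grad (w v)"] J' w'
    by (simp add: integral_jet_def)
  have gi1: "small \<alpha> T (Suc k - 2) 1 (\<lambda>s u v. val (J s v) *\<^sub>R (grad (w v) - grad (w u)))"
  proof (rule small_weaken)
    show "small \<alpha> T (k + 0) (0 + 1) (\<lambda>s u v. val (J s v) *\<^sub>R (grad (w v) - grad (w u)))"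
      by (intro small_scaleR) (use J' w' in auto)
  qed auto
  have gi2: "small \<alpha> T (Suc k - 2) 1 (\<lambda>s u v. (val (J s v) - val (J s u)) *\<^sub>R grad (w u))"
  proof (rule small_weaken)
    show "small \<alpha> T (k - 1 + 0) (1 + 0) (\<lambda>s u v. (val (J s v) - val (J s u)) *\<^sub>R grad (w u))"
      by (intro small_scaleR order_increment J wu)
  qed auto
  have gi: "small \<alpha> T (Suc k - 2) 1 (\<lambda>s u v. grad (integral_jet w (J s) s v) - grad (integral_jet w (J s) s u))"
    using small_add[OF gi1 gi2] by (simp add: integral_jet_def algebra_simps)
  have R1: "small \<alpha> T (Suc k - 2) 2 (\<lambda>s u v. val (J s u) * (val (w v) - val (w u) - grad (w u) (X v - X u)))"
  proof (rule small_weaken)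
    show "small \<alpha> T (k + 0) (0 + 2) (\<lambda>s u v. val (J s u) * (val (w v) - val (w u) - grad (w u) (X v - X u)))"
      by (intro small_mult Ju) (use w' in auto)
  qed auto
  have "small \<alpha> T (Suc k - 2) 2 (\<lambda>s u v. (rint XX w (J s) u v - germ XX w (J s) u v)
      + pairing (grad (J s u)) (grad (w u)) (XX u v)
      + val (J s u) * (val (w v) - val (w u) - grad (w u) (X v - X u)))"
    by (intro small_add R1 small_weaken[OF rest] small_weaken[OF second]) auto
  then have R: "small \<alpha> T (Suc k - 2) 2 (\<lambda>s u v. val (integral_jet w (J s) s v) - val (integral_jet w (J s) s u)
      - grad (integral_jet w (J s) s u) (X v - X u))"
  proof (subst small_cong)
    fix s u v assume suv: "0 \<le> s" "s \<le> u" "u \<le> v" "v \<le> T"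
    show "val (integral_jet w (J s) s v) - val (integral_jet w (J s) s u) - grad (integral_jet w (J s) s u) (X v - X u)
        = (rint XX w (J s) u v - germ XX w (J s) u v) + pairing (grad (J s u)) (grad (w u)) (XX u v)
          + val (J s u) * (val (w v) - val (w u) - grad (w u) (X v - X u))"
      using rint_additive[OF w J suv(1) order_refl suv(2-4)]
      by (simp add: integral_jet_def germ_def blinfun.scaleR_left algebra_simps)
  qed
  show ?thesis unfolding order_def using v g gi R by blast
qed

section \<open>Taylor remainders along controlled paths\<close>

text \<open>
  On \<open>[s, v]\<close> the path stays within \<open>O(|v - s|\<^bsup>\<alpha>\<^esup>)\<close> of \<open>Y s\<close>, where the remainder and its first two
  derivatives vanish to the orders \<open>k\<close>, \<open>k - 1\<close> and \<open>k - 2\<close>.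
\<close>
lemma order_taylor_rem:
  fixes f :: "'a::euclidean_space \<Rightarrow> real"
  assumes Y: "(Y, Y') \<in> controlled_paths \<alpha> T X" and f: "f \<in> Cb j" "2 \<le> j" "k \<le> j"
  shows "order k (\<lambda>s r. Jet (taylor_rem k f (Y s) (Y r)) (taylor_rem_deriv k f (Y s) (Y r) o\<^sub>L Y' r))"
proof -
  have Yh: "Y \<in> holder_paths \<alpha> T" "Y' \<in> holder_paths \<alpha> T" using Y by (auto simp: controlled_paths_def)
  have RY: "small \<alpha> T 0 2 (\<lambda>s u v. Y v - Y u - Y' u (X v - X u))"
    by (rule finite_holder_sup_imp_small) (use Y in \<open>auto simp: controlled_paths_def\<close>)
  obtain c where c: "0 \<le> c" "\<And>s a u v b. 0 \<le> s \<Longrightarrow> s \<le> a \<Longrightarrow> a \<le> u \<Longrightarrow> u \<le> v \<Longrightarrow> v \<le> b \<Longrightarrow> b \<le> T \<Longrightarrow>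
     norm (Y v - Y u) \<le> c * scales \<alpha> 0 1 s a b"
    by (rule small_enlargeE[OF holder_paths_imp_small[OF Yh(1)] \<alpha>_nonneg]) blast
  obtain C where C: "0 \<le> C"
    "\<And>x y r. norm (y - x) \<le> r \<Longrightarrow> \<bar>taylor_rem k f x y\<bar> \<le> C * r ^ k"
    "\<And>x y r h. norm (y - x) \<le> r \<Longrightarrow> \<bar>taylor_rem (k - 1) (nderiv f [h]) x y\<bar> \<le> C * r ^ (k - 1) * norm h"
    "\<And>x u v r h. norm (u - x) \<le> r \<Longrightarrow> norm (v - x) \<le> r \<Longrightarrow>
      \<bar>taylor_rem (k - 1) (nderiv f [h]) x v - taylor_rem (k - 1) (nderiv f [h]) x u\<bar>
        \<le> C * r ^ (k - 2) * norm (v - u) * norm h"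
    "\<And>x u v r. norm (u - x) \<le> r \<Longrightarrow> norm (v - x) \<le> r \<Longrightarrow>
      \<bar>taylor_rem k f x v - taylor_rem k f x u - taylor_rem (k - 1) (nderiv f [v - u]) x u\<bar>
        \<le> C * r ^ (k - 2) * norm (v - u) ^ 2"
    by (rule taylor_rem_estimates[OF f]) blast
  let ?g = "\<lambda>s r. taylor_rem k f (Y s) (Y r)" and ?D = "\<lambda>s r. taylor_rem_deriv k f (Y s) (Y r)"
  have D_apply: "?D s r h = taylor_rem (k - 1) (nderiv f [h]) (Y s) (Y r)" for s r h
    by (rule taylor_rem_deriv_apply[OF f(1)]) (use f in auto)
  have near: "norm (Y v - Y s) \<le> c * (b - s) powr \<alpha>" if "0 \<le> s" "s \<le> v" "v \<le> b" "b \<le> T" for s v b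
    using c(2)[of s s s v b] that by simp
  have sg: "small \<alpha> T k 0 (\<lambda>s u v. ?g s v)"
  proof (rule smallI[of "C * c ^ k"])
    fix s u v assume suv: "0 \<le> s" "s \<le> u" "u \<le> v" "v \<le> T"
    show "norm (?g s v) \<le> C * c ^ k * scales \<alpha> k 0 s u v"
      using C(2)[OF near[of s v v]] suv by (simp add: power_mult_distrib mult_ac)
  qed (use C c in auto)
  have sD: "small \<alpha> T (k - 1) 0 (\<lambda>s u v. ?D s v)"
  proof (rule smallI[of "C * c ^ (k - 1)"])
    fix s u v assume suv: "0 \<le> s" "s \<le> u" "u \<le> v" "v \<le> T"
    have "norm (?D s v) \<le> C * (c * (v - s) powr \<alpha>) ^ (k - 1)"
      by (rule norm_blinfun_bound) (use C c C(3)[OF near[of s v v]] suv in \<open>auto simp: D_apply simp del: nderiv.simps\<close>)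
    then show "norm (?D s v) \<le> C * c ^ (k - 1) * scales \<alpha> (k - 1) 0 s u v"
      by (simp add: power_mult_distrib mult_ac)
  qed (use C c in auto)
  have sDi: "small \<alpha> T (k - 2) 1 (\<lambda>s u v. ?D s v - ?D s u)"
  proof (rule smallI[of "C * c ^ (k - 2) * c"])
    fix s u v assume suv: "0 \<le> s" "s \<le> u" "u \<le> v" "v \<le> T"
    have "norm (?D s v - ?D s u) \<le> C * (c * (v - s) powr \<alpha>) ^ (k - 2) * norm (Y v - Y u)"
      by (rule norm_blinfun_bound)
        (use C(1) c(1) C(4)[OF near[of s u v] near[of s v v]] suv in
          \<open>auto simp: D_apply blinfun.diff_left simp del: nderiv.simps\<close>)
    also have "\<dots> \<le> C * (c * (v - s) powr \<alpha>) ^ (k - 2) * (c * (v - u) powr \<alpha>)"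
      using C(1) c(1) c(2)[of u u u v v] suv by (intro mult_left_mono) auto
    finally show "norm (?D s v - ?D s u) \<le> C * c ^ (k - 2) * c * scales \<alpha> (k - 2) 1 s u v"
      by (simp add: power_mult_distrib mult_ac)
  qed (use C c in auto)
  have sR: "small \<alpha> T (k - 2) 2 (\<lambda>s u v. ?g s v - ?g s u - ?D s u (Y v - Y u))"
  proof (rule smallI[of "C * c ^ (k - 2) * c ^ 2"])
    fix s u v assume suv: "0 \<le> s" "s \<le> u" "u \<le> v" "v \<le> T"
    have "norm (?g s v - ?g s u - ?D s u (Y v - Y u)) \<le> C * (c * (v - s) powr \<alpha>) ^ (k - 2) * norm (Y v - Y u) ^ 2"
      unfolding D_apply real_norm_def by (rule C(5)) (use near suv in auto)
    also have "\<dots> \<le> C * (c * (v - s) powr \<alpha>) ^ (k - 2) * (c * (v - u) powr \<alpha>) ^ 2"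
      using C(1) c(1) c(2)[of u u u v v] suv by (intro mult_left_mono power_mono) auto
    finally show "norm (?g s v - ?g s u - ?D s u (Y v - Y u)) \<le> C * c ^ (k - 2) * c ^ 2 * scales \<alpha> (k - 2) 2 s u v"
      by (simp add: power_mult_distrib mult_ac)
  qed (use C c in auto)
  have sDu: "small \<alpha> T (k - 1) 0 (\<lambda>s u v. ?D s u)" by (rule small_at_left[OF sD \<alpha>_nonneg])
  have sY': "small \<alpha> T 0 0 (\<lambda>s u v. Y' v)" by (rule holder_paths_imp_bounded[OF Yh(2) \<alpha>_nonneg])
  have gr: "small \<alpha> T (k - 1) 0 (\<lambda>s u v. ?D s v o\<^sub>L Y' v)"
    using small_blinfun_compose[OF sD sY'] by simp
  have gi1: "small \<alpha> T (k - 2) 1 (\<lambda>s u v. (?D s v - ?D s u) o\<^sub>L Y' v)"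
    using small_blinfun_compose[OF sDi sY'] by simp
  have gi2: "small \<alpha> T (k - 2) 1 (\<lambda>s u v. ?D s u o\<^sub>L (Y' v - Y' u))"
    by (rule small_weaken[OF small_blinfun_compose[OF sDu holder_paths_imp_small[OF Yh(2)]]]) auto
  have gi: "small \<alpha> T (k - 2) 1 (\<lambda>s u v. (?D s v o\<^sub>L Y' v) - (?D s u o\<^sub>L Y' u))"
  proof -
    have "((?D s v - ?D s u) o\<^sub>L Y' v) + (?D s u o\<^sub>L (Y' v - Y' u)) = (?D s v o\<^sub>L Y' v) - (?D s u o\<^sub>L Y' u)" for s u v
      by (rule blinfun_eqI) (simp add: blinfun.diff_left blinfun.diff_right blinfun.add_left)
    then show ?thesis using small_add[OF gi1 gi2] by simp
  qed
  have "small \<alpha> T (k - 2) 2 (\<lambda>s u v. ?D s u (Y v - Y u - Y' u (X v - X u)))"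
    by (rule small_weaken[OF small_blinfun_apply[OF sDu RY]]) auto
  from small_add[OF sR this]
  have R: "small \<alpha> T (k - 2) 2 (\<lambda>s u v. ?g s v - ?g s u - (?D s u o\<^sub>L Y' u) (X v - X u))"
    by (simp add: blinfun.diff_right blinfun.add_right algebra_simps)
  show ?thesis unfolding order_def using sg gr gi R by simp
qed

end

section \<open>Lifting functions of a path to jets\<close>

text \<open>
  \<open>J\<close> is the jet of \<open>\<phi>\<close> at a point through which a path passes with derivative \<open>A\<close>. As the jet is
  determined by \<open>\<phi>\<close>, equal functions have equal jets, whichever way they are composed.
\<close>
definition lifts ::
    "('a::euclidean_space \<Rightarrow> real) \<Rightarrow> 'a \<Rightarrow> ((real ^ 'd::finite) \<Rightarrow>\<^sub>L 'a) \<Rightarrow> 'd jet \<Rightarrow> bool" where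
  "lifts \<phi> y A J \<longleftrightarrow> (\<exists>D. (\<phi> has_derivative blinfun_apply D) (at y) \<and> J = Jet (\<phi> y) (D o\<^sub>L A))"

lemma lifts_unique: "lifts \<phi> y A J \<Longrightarrow> lifts \<phi> y A K \<Longrightarrow> J = K"
  unfolding lifts_def by (metis has_derivative_unique blinfun_apply_inject)

lemma lifts_of_real: "lifts (\<lambda>z. c) y A (of_real c)"
  unfolding lifts_def by (rule exI[of _ 0]) (simp add: jet_eq_iff zero_blinfun.rep_eq)

lemma lifts_add:
  assumes "lifts \<phi> y A J" "lifts \<psi> y A K"
  shows "lifts (\<lambda>z. \<phi> z + \<psi> z) y A (J + K)"
proof -
  obtain D E where D: "(\<phi> has_derivative blinfun_apply D) (at y)" "J = Jet (\<phi> y) (D o\<^sub>L A)"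
    and E: "(\<psi> has_derivative blinfun_apply E) (at y)" "K = Jet (\<psi> y) (E o\<^sub>L A)"
    using assms unfolding lifts_def by blast
  have "((\<lambda>z. \<phi> z + \<psi> z) has_derivative blinfun_apply (D + E)) (at y)"
    using has_derivative_add[OF D(1) E(1)] by (simp add: plus_blinfun.rep_eq)
  moreover have "J + K = Jet (\<phi> y + \<psi> y) ((D + E) o\<^sub>L A)"
    using D(2) E(2) by (auto simp: jet_eq_iff intro!: blinfun_eqI simp: blinfun.add_left)
  ultimately show ?thesis unfolding lifts_def by blast
qed

lemma lifts_mult:
  assumes "lifts \<phi> y A J" "lifts \<psi> y A K"
  shows "lifts (\<lambda>z. \<phi> z * \<psi> z) y A (J * K)"
proof -
  obtain D E where D: "(\<phi> has_derivative blinfun_apply D) (at y)" "J = Jet (\<phi> y) (D o\<^sub>L A)"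
    and E: "(\<psi> has_derivative blinfun_apply E) (at y)" "K = Jet (\<psi> y) (E o\<^sub>L A)"
    using assms unfolding lifts_def by blast
  have "((\<lambda>z. \<phi> z * \<psi> z) has_derivative blinfun_apply (\<phi> y *\<^sub>R E + \<psi> y *\<^sub>R D)) (at y)"
    by (rule has_derivative_eq_rhs[OF has_derivative_mult[OF D(1) E(1)]])
      (auto simp: blinfun.add_left blinfun.scaleR_left)
  moreover have "J * K = Jet (\<phi> y * \<psi> y) ((\<phi> y *\<^sub>R E + \<psi> y *\<^sub>R D) o\<^sub>L A)"
    using D(2) E(2) by (auto simp: jet_eq_iff intro!: blinfun_eqI simp: blinfun.add_left blinfun.scaleR_left)
  ultimately show ?thesis unfolding lifts_def by blast
qed

lemma lifts_scaleR: "lifts \<phi> y A J \<Longrightarrow> lifts (\<lambda>z. c * \<phi> z) y A (c *\<^sub>R J)"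
  using lifts_mult[OF lifts_of_real] by (simp add: scaleR_conv_of_real)

lemma lifts_sum:
  "(\<And>i. i \<in> I \<Longrightarrow> lifts (\<phi> i) y A (J i)) \<Longrightarrow> lifts (\<lambda>z. \<Sum>i\<in>I. \<phi> i z) y A (\<Sum>i\<in>I. J i)"
proof (induction I rule: infinite_finite_induct)
  case (insert i I)
  then show ?case by (simp add: lifts_add)
qed (use lifts_of_real[of 0] in simp_all)

lemma lifts_prod_list:
  "(\<And>i. i \<in> set is \<Longrightarrow> lifts (\<phi> i) y A (J i)) \<Longrightarrow> lifts (\<lambda>z. \<Prod>i\<leftarrow>is. \<phi> i z) y A (\<Prod>i\<leftarrow>is. J i)"
proof (induction "is")
  case Nil
  then show ?case using lifts_of_real[of 1] by simp
next
  case (Cons i "is")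
  then show ?case by (simp add: lifts_mult)
qed

lemma lifts_differentiable:
  assumes "\<phi> differentiable (at y)"
  shows "lifts \<phi> y A (Jet (\<phi> y) (Blinfun (frechet_derivative \<phi> (at y)) o\<^sub>L A))"
proof -
  have d: "(\<phi> has_derivative frechet_derivative \<phi> (at y)) (at y)"
    using assms by (simp add: frechet_derivative_works)
  then show ?thesis unfolding lifts_def
    by (intro exI[of _ "Blinfun (frechet_derivative \<phi> (at y))"])
      (simp add: bounded_linear_Blinfun_apply has_derivative_bounded_linear)
qed

lemma lifts_coordinate: "lifts (\<lambda>z. (z - x) \<bullet> b) y A (Jet ((y - x) \<bullet> b) (blinfun_inner_left b o\<^sub>L A))"
  unfolding lifts_def
  by (intro exI[of _ "blinfun_inner_left b"] conjI refl) (auto intro!: derivative_eq_intros)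

lemma lifts_taylor_rem:
  assumes "f \<in> Cb j" "k \<le> j" "1 \<le> j"
  shows "lifts (taylor_rem k f x) y A (Jet (taylor_rem k f x y) (taylor_rem_deriv k f x y o\<^sub>L A))"
  unfolding lifts_def
  by (intro exI[of _ "taylor_rem_deriv k f x y"] conjI refl
      has_derivative_eq_rhs[OF taylor_rem_has_derivative[OF assms]])
    (simp add: fun_eq_iff taylor_rem_deriv_apply[OF assms])

text \<open>
  Taylor's formula in coordinates, with its derivative. Both sides are jets of the same function, so
  the derivative of the polynomial part need not be computed.
\<close>
lemma jet_taylor:
  fixes f :: "'a::euclidean_space \<Rightarrow> real"
  assumes f: "f \<in> Cb j" "k \<le> j" "1 \<le> j"
  shows "Jet (f y) (Blinfun (frechet_derivative f (at y)) o\<^sub>L A)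
    = Jet (taylor_rem k f x y) (taylor_rem_deriv k f x y o\<^sub>L A)
      + (\<Sum>n<k. \<Sum>is\<in>words n Basis. (nderiv f is x / fact n) *\<^sub>R
           (\<Prod>b\<leftarrow>is. Jet ((y - x) \<bullet> b) (blinfun_inner_left b o\<^sub>L A)))"
proof (rule lifts_unique)
  show "lifts f y A (Jet (f y) (Blinfun (frechet_derivative f (at y)) o\<^sub>L A))"
    using nderiv_has_derivative[OF f(1), of "[]"] f by (intro lifts_differentiable) (auto simp: differentiable_def)
  have "f = (\<lambda>z. taylor_rem k f x z + (\<Sum>n<k. \<Sum>is\<in>words n Basis. (nderiv f is x / fact n) * (\<Prod>b\<leftarrow>is. (z - x) \<bullet> b)))"
  proof
    fix z
    have "nderiv f (replicate n (z - x)) x = (\<Sum>is\<in>words n Basis. (\<Prod>b\<leftarrow>is. (z - x) \<bullet> b) * nderiv f is x)" if "n < k" for n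
    proof -
      have "(\<Prod>(i, v)\<leftarrow>zip is (replicate n (z - x)). v \<bullet> i) = (\<Prod>b\<leftarrow>is. (z - x) \<bullet> b)" if "length is = n" for "is" :: "'a list"
        using that by (induction "is" arbitrary: n) auto
      then show ?thesis using nderiv_Basis_expansion[OF f(1), of "replicate n (z - x)"] that f(2)
        by (auto simp: words_def intro!: sum.cong)
    qed
    then show "f z = taylor_rem k f x z + (\<Sum>n<k. \<Sum>is\<in>words n Basis. (nderiv f is x / fact n) * (\<Prod>b\<leftarrow>is. (z - x) \<bullet> b))"
      by (simp add: taylor_rem_def sum_divide_distrib mult.commute)
  qed
  moreover have "lifts (\<lambda>z. taylor_rem k f x z + (\<Sum>n<k. \<Sum>is\<in>words n Basis. (nderiv f is x / fact n) * (\<Prod>b\<leftarrow>is. (z - x) \<bullet> b))) y A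
     (Jet (taylor_rem k f x y) (taylor_rem_deriv k f x y o\<^sub>L A)
      + (\<Sum>n<k. \<Sum>is\<in>words n Basis. (nderiv f is x / fact n) *\<^sub>R
           (\<Prod>b\<leftarrow>is. Jet ((y - x) \<bullet> b) (blinfun_inner_left b o\<^sub>L A))))"
    by (intro lifts_add lifts_sum lifts_scaleR lifts_prod_list lifts_coordinate lifts_taylor_rem[OF f])
  ultimately show "lifts f y A (Jet (taylor_rem k f x y) (taylor_rem_deriv k f x y o\<^sub>L A)
      + (\<Sum>n<k. \<Sum>is\<in>words n Basis. (nderiv f is x / fact n) *\<^sub>R
           (\<Prod>b\<leftarrow>is. Jet ((y - x) \<bullet> b) (blinfun_inner_left b o\<^sub>L A))))"
    by simp
qed

section \<open>Vector fields and their components\<close>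

lemma nderiv_inner:
  assumes "f \<in> Cb k"
  shows "length vs \<le> k \<Longrightarrow> nderiv (\<lambda>y. f y \<bullet> b) vs = (\<lambda>y. nderiv f vs y \<bullet> b)"
proof (induction vs)
  case (Cons v vs)
  have IH: "nderiv (\<lambda>y. f y \<bullet> b) vs = (\<lambda>y. nderiv f vs y \<bullet> b)" using Cons by simp
  have "((\<lambda>y. nderiv f vs y \<bullet> b) has_derivative (\<lambda>v. nderiv f (v # vs) y \<bullet> b)) (at y)" for y
    using nderiv_has_derivative[OF assms, of vs y] Cons.prems by (intro has_derivative_inner_left) simp
  from frechet_derivative_at[OF this, symmetric] show ?case by (simp add: IH)
qed simp

lemma Cb_inner:
  fixes f :: "'a::euclidean_space \<Rightarrow> 'b::real_inner"
  assumes f: "f \<in> Cb k"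
  shows "(\<lambda>y. f y \<bullet> b) \<in> Cb k"
  unfolding Cb_def
proof (intro CollectI conjI allI impI)
  show "nderiv (\<lambda>y. f y \<bullet> b) vs differentiable at y" if "length vs < k" for vs y
    using that has_derivative_inner_left[OF nderiv_has_derivative[OF f that]] nderiv_inner[OF f, of vs b]
    by (auto simp: differentiable_def)
  show "continuous_on UNIV (nderiv (\<lambda>y. f y \<bullet> b) vs)" if "length vs \<le> k" for vs
    using that f nderiv_inner[OF f, of vs b] by (auto simp: Cb_def intro!: continuous_intros)
  fix j assume j: "j \<le> k"
  obtain B where B: "0 \<le> B" "\<And>vs y. length vs = j \<Longrightarrow> norm (nderiv f vs y) \<le> B * (\<Prod>v\<leftarrow>vs. norm v)"
    using Cb_bound[OF f j] by blast
  have "norm (nderiv (\<lambda>y. f y \<bullet> b) vs y) \<le> (B * norm b) * (\<Prod>v\<leftarrow>vs. norm v)" if "length vs = j" for vs y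
  proof -
    have "norm (nderiv (\<lambda>y. f y \<bullet> b) vs y) \<le> norm (nderiv f vs y) * norm b"
      using nderiv_inner[OF f, of vs b] that j by (simp add: Cauchy_Schwarz_ineq2)
    also have "\<dots> \<le> (B * (\<Prod>v\<leftarrow>vs. norm v)) * norm b" by (intro mult_right_mono B that norm_ge_zero)
    finally show ?thesis by (simp add: mult_ac)
  qed
  then show "\<exists>B. \<forall>vs y. length vs = j \<longrightarrow> norm (nderiv (\<lambda>y. f y \<bullet> b) vs y) \<le> B * (\<Prod>v\<leftarrow>vs. norm v)" by blast
qed

lemma nderiv_bounded:
  fixes gs :: "('a::euclidean_space \<Rightarrow> 'a) list"
  assumes f: "f \<in> Cb k" and gs: "length gs \<le> k" "\<And>g. g \<in> set gs \<Longrightarrow> \<exists>C. \<forall>y. norm (g y) \<le> C"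
  shows "\<exists>C. \<forall>y. norm (nderiv f (map (\<lambda>g. g y) gs) y) \<le> C"
proof -
  have prod: "\<exists>C. \<forall>y. (\<Prod>v\<leftarrow>map (\<lambda>g. g y) gs. norm v) \<le> C"
    using gs(2)
  proof (induction gs)
    case (Cons g gs)
    obtain C D where C: "\<And>y. norm (g y) \<le> C" and D: "\<And>y. (\<Prod>v\<leftarrow>map (\<lambda>g. g y) gs. norm v) \<le> D"
      using Cons by fastforce
    have "0 \<le> C" using C[of undefined] norm_ge_zero order_trans by blast
    then have "norm (g y) * (\<Prod>v\<leftarrow>map (\<lambda>g. g y) gs. norm v) \<le> C * D" for y
      by (intro mult_mono C D prod_list_nonneg) auto
    then show ?case by auto
  qed auto
  then obtain C where C: "\<And>y. (\<Prod>v\<leftarrow>map (\<lambda>g. g y) gs. norm v) \<le> C" by blast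
  obtain B where B: "0 \<le> B" "\<And>vs y. length vs = length gs \<Longrightarrow> norm (nderiv f vs y) \<le> B * (\<Prod>v\<leftarrow>vs. norm v)"
    using Cb_bound[OF f gs(1)] by blast
  have "norm (nderiv f (map (\<lambda>g. g y) gs) y) \<le> B * C" for y
    using B(2)[of "map (\<lambda>g. g y) gs" y] mult_left_mono[OF C[of y] B(1)] by simp
  then show ?thesis by blast
qed

lemma vfield_apply: "blinfun_apply (vfield F y) z = (\<Sum>a\<in>UNIV. z $ a *\<^sub>R F a y)"
  unfolding vfield_def
  by (subst bounded_linear_Blinfun_apply)
    (auto intro!: bounded_linear_sum bounded_linear_scaleR_left[THEN bounded_linear_compose] bounded_linear_vec_nth)

lemma vfield_derivative_apply:
  fixes F :: "'m::finite \<Rightarrow> real ^ 'e::finite \<Rightarrow> real ^ 'e"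
  assumes F: "\<And>a. F a differentiable (at y)"
  shows "blinfun_apply (blinfun_apply (Blinfun (frechet_derivative (vfield F) (at y))) h) z
    = (\<Sum>a\<in>UNIV. z $ a *\<^sub>R frechet_derivative (F a) (at y) h)"
proof -
  \<comment> \<open>\<open>vfield F y\<close> is a sum of fixed bounded linear images \<open>E a\<close> of the vectors \<open>F a y\<close>.\<close>
  define E where "E a x = blinfun_scaleR_left x o\<^sub>L Blinfun (\<lambda>z. z $ a)" for a :: 'm and x :: "real ^ 'e"
  have E_apply: "E a x z = z $ a *\<^sub>R x" for a x z
    by (simp add: E_def bounded_linear_Blinfun_apply bounded_linear_vec_nth)
  have E: "bounded_linear (E a)" for a
    unfolding E_def
    by (rule bounded_linear_compose[OF bounded_bilinear.bounded_linear_left[OF bounded_bilinear_blinfun_compose]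
        bounded_linear_blinfun_scaleR_left])
  have eq: "vfield F = (\<lambda>y. \<Sum>a\<in>UNIV. E a (F a y))"
    by (intro ext blinfun_eqI) (simp add: vfield_apply blinfun.sum_left E_apply)
  have "(vfield F has_derivative (\<lambda>h. \<Sum>a\<in>UNIV. E a (frechet_derivative (F a) (at y) h))) (at y)"
    unfolding eq using F
    by (intro has_derivative_sum bounded_linear.has_derivative[OF E]) (simp add: frechet_derivative_works)
  note this[THEN frechet_derivative_at] this[THEN has_derivative_bounded_linear]
  then show ?thesis
    by (simp add: bounded_linear_Blinfun_apply blinfun.sum_left E_apply flip: \<open>_ = frechet_derivative (vfield F) (at y)\<close>)
qed

section \<open>Rough integrals in terms of jets\<close>

lemma rough_sum_scalar:
  "rough_sum XX (scalar_integrand H) W = germ_sum (germ XX (jet_at W) (jet_at H))"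
  unfolding rough_sum_def scalar_integrand_def germ_sum_def germ_def jet_at_def
  by (auto simp: fun_eq_iff case_prod_unfold diamond_mult_right blinfun_mult_right.rep_eq)

lemma rough_integral_scalar:
  "rough_integral XX s t (scalar_integrand H) W = rint XX (jet_at W) (jet_at H) s t"
  by (simp add: rough_integral_def rint_def rough_sum_scalar)

lemma jet_at_component:
  "jet_at (component (Z, Z') a) r = Jet (Z r $ a) (Blinfun (\<lambda>z. z $ a) o\<^sub>L Z' r)"
  by (simp add: jet_at_def component_def)

lemma diamond_inner: "diamond A B M \<bullet> b = (\<Sum>i\<in>UNIV. \<Sum>j\<in>UNIV. M $ i $ j * (A (axis i 1) (B (axis j 1)) \<bullet> b))"
  by (simp add: diamond_def inner_sum_left)

text \<open>
  In each component of the target space, the sums for the integral of \<open>F(Y)\<close> against \<open>Z\<close> are those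
  of scalar integrals against the components of \<open>Z\<close>; hence the scalar theory is enough.
\<close>
lemma rough_sum_vfield_inner:
  fixes F :: "'m::finite \<Rightarrow> real ^ 'e::finite \<Rightarrow> real ^ 'e"
  assumes F: "\<And>a y. F a differentiable (at y)"
  shows "rough_sum XX (vfield_path F (Y, Y')) (Z, Z') P \<bullet> b
    = (\<Sum>a\<in>UNIV. germ_sum (germ XX (jet_at (component (Z, Z') a))
        (\<lambda>r. Jet (F a (Y r) \<bullet> b) (Blinfun (frechet_derivative (\<lambda>y. F a y \<bullet> b) (at (Y r))) o\<^sub>L Y' r))) P)"
proof -
  have fd: "frechet_derivative (\<lambda>y. F a y \<bullet> b) (at y) h = frechet_derivative (F a) (at y) h \<bullet> b"
    and bl: "bounded_linear (frechet_derivative (\<lambda>y. F a y \<bullet> b) (at y))" for a y h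
  proof -
    have d: "((\<lambda>y. F a y \<bullet> b) has_derivative (\<lambda>h. frechet_derivative (F a) (at y) h \<bullet> b)) (at y)"
      using F[of a y] by (intro has_derivative_inner_left) (simp add: frechet_derivative_works)
    show "frechet_derivative (\<lambda>y. F a y \<bullet> b) (at y) h = frechet_derivative (F a) (at y) h \<bullet> b"
      using frechet_derivative_at[OF d] by metis
    show "bounded_linear (frechet_derivative (\<lambda>y. F a y \<bullet> b) (at y))"
      using frechet_derivative_at[OF d] has_derivative_bounded_linear[OF d] by simp
  qed
  have cell: "(blinfun_apply (vfield F (Y u)) (Z v - Z u)
      + diamond (Blinfun (frechet_derivative (vfield F) (at (Y u))) o\<^sub>L Y' u) (Z' u) (XX u v)) \<bullet> b
     = (\<Sum>a\<in>UNIV. germ XX (jet_at (component (Z, Z') a))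
        (\<lambda>r. Jet (F a (Y r) \<bullet> b) (Blinfun (frechet_derivative (\<lambda>y. F a y \<bullet> b) (at (Y r))) o\<^sub>L Y' r)) u v)" for u v
  proof -
    have "diamond (Blinfun (frechet_derivative (vfield F) (at (Y u))) o\<^sub>L Y' u) (Z' u) (XX u v) \<bullet> b
        = (\<Sum>i\<in>UNIV. \<Sum>j\<in>UNIV. \<Sum>a\<in>UNIV. XX u v $ i $ j *
            ((frechet_derivative (F a) (at (Y u)) (Y' u (axis i 1)) \<bullet> b) * Z' u (axis j 1) $ a))"
      using F by (simp add: diamond_inner vfield_derivative_apply inner_sum_left sum_distrib_left mult_ac)
    also have "\<dots> = (\<Sum>a\<in>UNIV. pairing (Blinfun (frechet_derivative (\<lambda>y. F a y \<bullet> b) (at (Y u))) o\<^sub>L Y' u)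
        (Blinfun (\<lambda>z. z $ a) o\<^sub>L Z' u) (XX u v))"
      by (subst sum.swap, subst (2) sum.swap, subst sum.swap)
        (simp add: pairing_def bounded_linear_Blinfun_apply bl fd bounded_linear_vec_nth,
         rule sum.cong[OF refl], rule sum.swap)
    finally show ?thesis
      by (simp add: germ_def jet_at_component inner_add_left vfield_apply inner_sum_left sum.distrib mult.commute)
  qed
  have "rough_sum XX (vfield_path F (Y, Y')) (Z, Z') P \<bullet> b
      = (\<Sum>(u, v)\<leftarrow>cells P. (blinfun_apply (vfield F (Y u)) (Z v - Z u)
          + diamond (Blinfun (frechet_derivative (vfield F) (at (Y u))) o\<^sub>L Y' u) (Z' u) (XX u v)) \<bullet> b)"
  proof -
    have "(\<Sum>(u, v)\<leftarrow>c. g u v) \<bullet> b = (\<Sum>(u, v)\<leftarrow>c. g u v \<bullet> b)" for c and g :: "real \<Rightarrow> real \<Rightarrow> real ^ 'e"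
      by (induction c) (auto simp: inner_add_left)
    then show ?thesis unfolding rough_sum_def vfield_path_def by simp
  qed
  also have "\<dots> = (\<Sum>a\<in>UNIV. germ_sum (germ XX (jet_at (component (Z, Z') a))
        (\<lambda>r. Jet (F a (Y r) \<bullet> b) (Blinfun (frechet_derivative (\<lambda>y. F a y \<bullet> b) (at (Y r))) o\<^sub>L Y' r))) P)"
  proof -
    have "(\<Sum>(u, v)\<leftarrow>c. \<Sum>a\<in>UNIV. g a u v) = (\<Sum>a\<in>UNIV. \<Sum>(u, v)\<leftarrow>c. g a u v)"
      for c and g :: "'m \<Rightarrow> real \<Rightarrow> real \<Rightarrow> real"
      by (induction c) (auto simp: sum.distrib)
    then show ?thesis unfolding cell germ_sum_def .
  qed
  finally show ?thesis .
qed

lemma finite_holder_sup_bounded_image: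
  assumes A: "finite_holder_sup \<beta> T A" and le: "\<And>s t. norm (B s t) \<le> K * norm (A s t)" and K: "0 \<le> K"
  shows "finite_holder_sup \<beta> T B"
proof -
  obtain C where C: "\<And>s t. 0 \<le> s \<Longrightarrow> s < t \<Longrightarrow> t \<le> T \<Longrightarrow> norm (A s t) / (t - s) powr \<beta> \<le> C"
    using A unfolding finite_holder_sup_def by blast
  have "norm (B s t) / (t - s) powr \<beta> \<le> K * C" if "0 \<le> s" "s < t" "t \<le> T" for s t
  proof -
    have "norm (B s t) / (t - s) powr \<beta> \<le> K * norm (A s t) / (t - s) powr \<beta>"
      by (intro divide_right_mono le) simp
    also have "\<dots> \<le> K * C" using mult_left_mono[OF C[OF that] K] by simp
    finally show ?thesis .
  qed
  then show ?thesis unfolding finite_holder_sup_def by blast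
qed

lemma controlled_paths_linear_image:
  fixes L :: "'v::real_normed_vector \<Rightarrow>\<^sub>L 'w::real_normed_vector"
  assumes "(Y, Y') \<in> controlled_paths \<alpha> T X"
  shows "(\<lambda>t. L (Y t), \<lambda>t. L o\<^sub>L Y' t) \<in> controlled_paths \<alpha> T X"
proof -
  have Y: "finite_holder_sup \<alpha> T (\<lambda>s t. Y t - Y s)" "finite_holder_sup \<alpha> T (\<lambda>s t. Y' t - Y' s)"
    "finite_holder_sup (2 * \<alpha>) T (\<lambda>s t. Y t - Y s - Y' s (X t - X s))"
    using assms by (auto simp: controlled_paths_def holder_paths_def)
  have compose: "(L o\<^sub>L Y' t) - (L o\<^sub>L Y' s) = L o\<^sub>L (Y' t - Y' s)" for s t
    by (rule blinfun_eqI) (simp add: blinfun.diff_left blinfun.diff_right)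
  have "finite_holder_sup \<alpha> T (\<lambda>s t. L (Y t) - L (Y s))"
    by (rule finite_holder_sup_bounded_image[OF Y(1), where K = "norm L"])
      (auto simp: norm_blinfun simp flip: blinfun.diff_right)
  moreover have "finite_holder_sup \<alpha> T (\<lambda>s t. (L o\<^sub>L Y' t) - (L o\<^sub>L Y' s))"
    unfolding compose
    by (rule finite_holder_sup_bounded_image[OF Y(2), where K = "norm L"]) (auto simp: norm_blinfun_compose)
  moreover have "finite_holder_sup (2 * \<alpha>) T (\<lambda>s t. L (Y t) - L (Y s) - (L o\<^sub>L Y' s) (X t - X s))"
    by (rule finite_holder_sup_bounded_image[OF Y(3), where K = "norm L"])
      (auto simp: norm_blinfun simp flip: blinfun.diff_right)
  ultimately show ?thesis by (simp add: controlled_paths_def holder_paths_def)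
qed

section \<open>Trees and forests\<close>

abbreviation forest_size :: "'a rtree multiset \<Rightarrow> nat" where
  "forest_size \<eta> \<equiv> \<Sum>\<tau>\<in>#\<eta>. vertices \<tau>"

definition forests_upto :: "nat \<Rightarrow> 'a rtree multiset set" where
  "forests_upto q = {\<eta>. forest_size \<eta> \<le> q}"

lemma vertices_pos: "1 \<le> vertices \<tau>"
  by (cases \<tau>) simp

lemma size_le_forest_size: "size \<eta> \<le> forest_size \<eta>"
proof (induction \<eta>)
  case (add \<tau> \<eta>)
  then show ?case using vertices_pos[of \<tau>] by simp
qed simp

lemma vertices_le_forest_size: "\<tau> \<in># \<eta> \<Longrightarrow> vertices \<tau> \<le> forest_size \<eta>"
  by (auto dest!: multi_member_split)

lemma trees_upto_0: "trees_upto 0 = {}"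
  using vertices_pos by (auto simp: trees_upto_def Suc_le_eq)

lemma trees_upto_Suc: "trees_upto (Suc q) = (\<lambda>(a, \<eta>). Node a \<eta>) ` (UNIV \<times> forests_upto q)"
proof -
  have "\<tau> \<in> (\<lambda>(a, \<eta>). Node a \<eta>) ` (UNIV \<times> forests_upto q)" if "vertices \<tau> \<le> Suc q" for \<tau> :: "'a rtree"
    using that by (cases \<tau>) (auto simp: forests_upto_def)
  then show ?thesis by (auto simp: trees_upto_def forests_upto_def)
qed

lemma finite_forests_upto: "finite (forests_upto q :: 'a::finite rtree multiset set)"
proof (rule finite_imageD)
  show "finite (Node (undefined :: 'a) ` forests_upto q)"
    by (rule finite_subset[OF _ finite_trees_upto[of "Suc q"]]) (auto simp: trees_upto_Suc)
qed (auto simp: inj_on_def)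

lemma sum_trees_upto_Suc:
  "(\<Sum>\<tau>\<in>trees_upto (Suc q). g \<tau>) = (\<Sum>a\<in>UNIV. \<Sum>\<eta>\<in>forests_upto q. g (Node a \<eta>))"
proof -
  have "inj_on (\<lambda>(a, \<eta>). Node a \<eta>) (UNIV \<times> forests_upto q)" by (auto simp: inj_on_def)
  then show ?thesis unfolding trees_upto_Suc
    by (subst sum.reindex) (simp_all add: sum.cartesian_product case_prod_unfold)
qed

lemma sum_vertices_mset: "(\<Sum>\<tau>\<leftarrow>\<tau>s. vertices \<tau>) = forest_size (mset \<tau>s)"
  by (induction \<tau>s) auto

text \<open>
  The lists of trees with at most \<open>q\<close> vertices in total, sorted by their length on one side and by
  the forest that they enumerate on the other.
\<close>
lemma sum_words_by_forest:
  fixes g :: "'a::finite rtree list \<Rightarrow> 'r::comm_monoid_add"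
  shows "(\<Sum>n<Suc q. \<Sum>\<tau>s\<in>{\<tau>s \<in> words n (trees_upto q). forest_size (mset \<tau>s) \<le> q}. g \<tau>s)
    = (\<Sum>\<eta>\<in>forests_upto q. \<Sum>\<tau>s\<in>permutations_of_multiset \<eta>. g \<tau>s)"
proof -
  let ?W = "\<lambda>n. {\<tau>s \<in> words n (trees_upto q :: 'a rtree set). forest_size (mset \<tau>s) \<le> q}"
  let ?L = "{\<tau>s :: 'a rtree list. forest_size (mset \<tau>s) \<le> q}"
  have fin: "finite (?W n)" for n
    by (rule finite_subset[OF _ finite_words[OF finite_trees_upto[of q]]]) auto
  have "\<tau>s \<in> (\<Union>n\<in>{..<Suc q}. ?W n)" if "forest_size (mset \<tau>s) \<le> q" for \<tau>s :: "'a rtree list"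
  proof -
    have "length \<tau>s < Suc q" using size_le_forest_size[of "mset \<tau>s"] that by simp
    moreover have "\<tau>s \<in> words (length \<tau>s) (trees_upto q)"
      using vertices_le_forest_size[of _ "mset \<tau>s"] that
      by (force simp: words_def trees_upto_def)
    ultimately show ?thesis using that by blast
  qed
  then have L: "(\<Union>n\<in>{..<Suc q}. ?W n) = ?L" by auto
  have "(\<Sum>n<Suc q. \<Sum>\<tau>s\<in>?W n. g \<tau>s) = (\<Sum>\<tau>s\<in>(\<Union>n\<in>{..<Suc q}. ?W n). g \<tau>s)"
    by (rule sum.UNION_disjoint[symmetric]) (use fin in \<open>auto simp: words_def\<close>)
  also have "(\<Union>n\<in>{..<Suc q}. ?W n) = (\<Union>\<eta>\<in>forests_upto q. permutations_of_multiset \<eta>)"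
    unfolding L by (auto simp: permutations_of_multiset_def forests_upto_def)
  also have "(\<Sum>\<tau>s\<in>(\<Union>\<eta>\<in>forests_upto q. permutations_of_multiset \<eta>). g \<tau>s)
      = (\<Sum>\<eta>\<in>forests_upto q. \<Sum>\<tau>s\<in>permutations_of_multiset \<eta>. g \<tau>s)"
    by (rule sum.UNION_disjoint) (auto simp: finite_forests_upto dest!: permutations_of_multisetD)
  finally show ?thesis .
qed

text \<open>
  A forest \<open>\<eta>\<close> with multiplicities \<open>m\<^sub>j\<close> has \<open>|\<eta>|! / \<Prod> m\<^sub>j!\<close> enumerations, which turns the factor
  \<open>1 / |\<eta>|!\<close> of Taylor's formula into the reciprocal of the symmetry factor.
\<close>
lemma symfac_Node_reciprocal:
  "real (card (permutations_of_multiset \<eta>)) / fact (size \<eta>) * (\<Prod>\<rho>\<in>#\<eta>. 1 / real (symfac \<rho>))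
    = 1 / real (symfac (Node a \<eta>))"
proof -
  have "real (card (permutations_of_multiset \<eta>)) * (\<Prod>\<rho>\<in>set_mset \<eta>. fact (count \<eta> \<rho>)) = fact (size \<eta>)"
  proof -
    have "card (permutations_of_multiset \<eta>) * (\<Prod>\<rho>\<in>set_mset \<eta>. fact (count \<eta> \<rho>)) = fact (size \<eta>)"
      using card_permutations_of_multiset[of \<eta>] by simp
    from arg_cong[OF this, of real] show ?thesis by simp
  qed
  moreover have "(\<Prod>\<rho>\<in>set_mset \<eta>. fact (count \<eta> \<rho>) :: real) \<noteq> 0" by simp
  ultimately have "real (card (permutations_of_multiset \<eta>)) / fact (size \<eta>) = 1 / (\<Prod>\<rho>\<in>set_mset \<eta>. fact (count \<eta> \<rho>))"
    by (simp add: field_simps)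
  moreover have "(\<Prod>\<rho>\<in>#\<eta>. 1 / real (symfac \<rho>)) = 1 / (\<Prod>\<rho>\<in>set_mset \<eta>. real (symfac \<rho>) ^ count \<eta> \<rho>)"
    by (simp add: image_prod_mset_multiplicity power_divide prod_dividef)
  ultimately show ?thesis by (simp add: prod.distrib)
qed

section \<open>The expansion of the vector field along the solution\<close>

text \<open>
  The composition of a homogeneous Taylor term, written in coordinates, with sums over \<open>S\<close>. Multiplying
  out gives words in \<open>S\<close>, and for a fixed word the sum over the coordinates reassembles the derivative
  in the directions \<open>v \<tau>\<close>.
\<close>
lemma nderiv_word_expansion:
  fixes f :: "'a::euclidean_space \<Rightarrow> real" and z :: "'x \<Rightarrow> 'r::{comm_ring_1, real_algebra_1}"
  assumes f: "f \<in> Cb k" and n: "n \<le> k"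
  shows "(\<Sum>is\<in>words n Basis. nderiv f is x *\<^sub>R (\<Prod>b\<leftarrow>is. \<Sum>\<tau>\<in>S. (v \<tau> \<bullet> b * c \<tau>) *\<^sub>R z \<tau>))
    = (\<Sum>\<tau>s\<in>words n S. (nderiv f (map v \<tau>s) x * (\<Prod>\<tau>\<leftarrow>\<tau>s. c \<tau>)) *\<^sub>R (\<Prod>\<tau>\<leftarrow>\<tau>s. z \<tau>))"
proof -
  have split: "(\<Prod>(b, \<tau>)\<leftarrow>zip is \<tau>s. (v \<tau> \<bullet> b * c \<tau>) *\<^sub>R z \<tau>)
      = ((\<Prod>(b, u)\<leftarrow>zip is (map v \<tau>s). u \<bullet> b) * (\<Prod>\<tau>\<leftarrow>\<tau>s. c \<tau>)) *\<^sub>R (\<Prod>\<tau>\<leftarrow>\<tau>s. z \<tau>)"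
    if "length is = length \<tau>s" for "is" \<tau>s
    using that by (induction "is" \<tau>s rule: list_induct2) (auto simp: mult_ac)
  have "(\<Sum>is\<in>words n Basis. nderiv f is x *\<^sub>R (\<Prod>b\<leftarrow>is. \<Sum>\<tau>\<in>S. (v \<tau> \<bullet> b * c \<tau>) *\<^sub>R z \<tau>))
      = (\<Sum>is\<in>words n Basis. \<Sum>\<tau>s\<in>words n S.
           (((\<Prod>(b, u)\<leftarrow>zip is (map v \<tau>s). u \<bullet> b) * nderiv f is x) * (\<Prod>\<tau>\<leftarrow>\<tau>s. c \<tau>)) *\<^sub>R (\<Prod>\<tau>\<leftarrow>\<tau>s. z \<tau>))"
  proof (rule sum.cong[OF refl])
    fix "is" :: "'a list" assume "is": "is \<in> words n Basis"
    have "(\<Prod>b\<leftarrow>is. \<Sum>\<tau>\<in>S. (v \<tau> \<bullet> b * c \<tau>) *\<^sub>R z \<tau>) = (\<Sum>\<tau>s\<in>words n S. \<Prod>(b, \<tau>)\<leftarrow>zip is \<tau>s. (v \<tau> \<bullet> b * c \<tau>) *\<^sub>R z \<tau>)"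
      using "is" by (simp add: prod_list_sum_eq_sum_words words_def)
    also have "\<dots> = (\<Sum>\<tau>s\<in>words n S. ((\<Prod>(b, u)\<leftarrow>zip is (map v \<tau>s). u \<bullet> b) * (\<Prod>\<tau>\<leftarrow>\<tau>s. c \<tau>)) *\<^sub>R (\<Prod>\<tau>\<leftarrow>\<tau>s. z \<tau>))"
      using "is" by (intro sum.cong refl split) (simp add: words_def)
    finally show "nderiv f is x *\<^sub>R (\<Prod>b\<leftarrow>is. \<Sum>\<tau>\<in>S. (v \<tau> \<bullet> b * c \<tau>) *\<^sub>R z \<tau>)
        = (\<Sum>\<tau>s\<in>words n S.
           (((\<Prod>(b, u)\<leftarrow>zip is (map v \<tau>s). u \<bullet> b) * nderiv f is x) * (\<Prod>\<tau>\<leftarrow>\<tau>s. c \<tau>)) *\<^sub>R (\<Prod>\<tau>\<leftarrow>\<tau>s. z \<tau>))"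
      by (simp add: scaleR_sum_right mult_ac)
  qed
  also have "\<dots> = (\<Sum>\<tau>s\<in>words n S. ((\<Sum>is\<in>words n Basis. (\<Prod>(b, u)\<leftarrow>zip is (map v \<tau>s). u \<bullet> b) * nderiv f is x)
      * (\<Prod>\<tau>\<leftarrow>\<tau>s. c \<tau>)) *\<^sub>R (\<Prod>\<tau>\<leftarrow>\<tau>s. z \<tau>))"
    by (subst sum.swap) (simp add: sum_distrib_right scaleR_sum_left)
  also have "\<dots> = (\<Sum>\<tau>s\<in>words n S. (nderiv f (map v \<tau>s) x * (\<Prod>\<tau>\<leftarrow>\<tau>s. c \<tau>)) *\<^sub>R (\<Prod>\<tau>\<leftarrow>\<tau>s. z \<tau>))"
    using n by (intro sum.cong refl) (subst nderiv_Basis_expansion[OF f], auto simp: words_def)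
  finally show ?thesis .
qed

locale rough_equation = rough_path \<alpha> T X XX
  for \<alpha> T :: real and X :: "real \<Rightarrow> real ^ 'd::finite" and XX :: "real \<Rightarrow> real \<Rightarrow> real ^ 'd ^ 'd" +
  fixes p :: nat
    and Z :: "real \<Rightarrow> real ^ 'm::finite" and Z' :: "real \<Rightarrow> (real ^ 'd) \<Rightarrow>\<^sub>L (real ^ 'm)"
    and F :: "'m \<Rightarrow> real ^ 'e::finite \<Rightarrow> real ^ 'e"
    and Y :: "real \<Rightarrow> real ^ 'e" and Y' :: "real \<Rightarrow> (real ^ 'd) \<Rightarrow>\<^sub>L (real ^ 'e)"
    and y0 :: "real ^ 'e"
  assumes p: "1 \<le> p"
    and Z: "(Z, Z') \<in> controlled_paths \<alpha> T X"
    and F: "\<And>a. F a \<in> Cb (p + 1)"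
    and solution: "rde_solution \<alpha> T X XX F (Z, Z') y0 (Y, Y')"
begin

lemma Y: "(Y, Y') \<in> controlled_paths \<alpha> T X"
  and Y_integral: "t \<in> {0..T} \<Longrightarrow> Y t = y0 + rough_integral XX 0 t (vfield_path F (Y, Y')) (Z, Z')"
  and Y'_field: "t \<in> {0..T} \<Longrightarrow> Y' t = vfield F (Y t) o\<^sub>L Z' t"
  using solution by (auto simp: rde_solution_def)

lemma F_inner: "(\<lambda>y. F a y \<bullet> b) \<in> Cb (p + 1)"
  by (rule Cb_inner[OF F])

definition driver :: "'m \<Rightarrow> real \<Rightarrow> 'd jet" where
  "driver a = jet_at (component (Z, Z') a)"

definition tree_jet :: "real \<Rightarrow> 'm rtree \<Rightarrow> real \<Rightarrow> 'd jet" where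
  "tree_jet s \<tau> = jet_at (tree_coeff XX (Z, Z') s \<tau>)"

definition forest_jet :: "real \<Rightarrow> 'm rtree multiset \<Rightarrow> real \<Rightarrow> 'd jet" where
  "forest_jet s \<eta> r = (\<Prod>\<rho>\<in>#\<eta>. tree_jet s \<rho> r)"

definition increment_jet :: "real ^ 'e \<Rightarrow> real \<Rightarrow> real \<Rightarrow> 'd jet" where
  "increment_jet b s r = Jet ((Y r - Y s) \<bullet> b) (blinfun_inner_left b o\<^sub>L Y' r)"

definition field_jet :: "'m \<Rightarrow> real ^ 'e \<Rightarrow> real \<Rightarrow> 'd jet" where
  "field_jet a b r = Jet (F a (Y r) \<bullet> b) (Blinfun (frechet_derivative (\<lambda>y. F a y \<bullet> b) (at (Y r))) o\<^sub>L Y' r)"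

abbreviation series_coeff :: "real ^ 'e \<Rightarrow> real \<Rightarrow> 'm rtree \<Rightarrow> real" where
  "series_coeff b s \<tau> \<equiv> elem_diff F \<tau> (Y s) \<bullet> b * (1 / real (symfac \<tau>))"

definition series_jet :: "nat \<Rightarrow> real ^ 'e \<Rightarrow> real \<Rightarrow> real \<Rightarrow> 'd jet" where
  "series_jet q b s r = (\<Sum>\<tau>\<in>trees_upto q. series_coeff b s \<tau> *\<^sub>R tree_jet s \<tau> r)"

lemma order_driver: "order 0 (\<lambda>s. driver a)"
  using controlled_imp_order[OF controlled_paths_linear_image[OF Z, of "Blinfun (\<lambda>z. z $ a)"]]
  by (simp add: driver_def jet_at_component[abs_def] bounded_linear_Blinfun_apply bounded_linear_vec_nth)

lemma jet_at_Pair: "jet_at (h, h') r = Jet (h r) (h' r)"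
  by (simp add: jet_at_def)

lemma tree_jet_Node: "tree_jet s (Node a \<eta>) = integral_jet (driver a) (forest_jet s \<eta>) s"
proof -
  let ?H = "cpath_prod (image_mset (tree_coeff XX (Z, Z') s) \<eta>)"
  have H: "jet_at ?H = forest_jet s \<eta>"
    by (rule ext) (simp add: jet_at_cpath_prod forest_jet_def tree_jet_def multiset.map_comp o_def)
  then have "fst ?H r = val (forest_jet s \<eta> r)" for r
    by (metis jet_at_def jet.sel(1))
  moreover have "snd (component (Z, Z') a) r = grad (driver a r)" for r
    by (simp add: driver_def jet_at_def)
  ultimately show ?thesis
    by (simp add: fun_eq_iff tree_jet_def jet_at_Pair Let_def integral_jet_def
        rough_integral_scalar H driver_def)
qed

lemma order_tree: "order (vertices \<tau>) (\<lambda>s. tree_jet s \<tau>)"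
proof (induction \<tau>)
  case (Node a \<eta>)
  have "order (forest_size \<eta>) (\<lambda>s r. \<Prod>\<rho>\<in>#\<eta>. tree_jet s \<rho> r)"
    by (rule order_prod_mset) (rule Node)
  then show ?case
    using order_integral[OF order_driver, of "forest_size \<eta>" "\<lambda>s. forest_jet s \<eta>"]
    by (simp add: tree_jet_Node forest_jet_def[abs_def])
qed

lemma order_forest: "order (forest_size \<eta>) (\<lambda>s. forest_jet s \<eta>)"
  unfolding forest_jet_def[abs_def] by (intro order_prod_mset order_tree)

lemma elem_diff_bounded: "vertices \<tau> \<le> p + 1 \<Longrightarrow> \<exists>C. \<forall>y. norm (elem_diff F \<tau> y) \<le> C"
proof (induction \<tau>)
  case (Node a \<eta>)
  define gs where "gs = (SOME gs. mset gs = image_mset (elem_diff F) \<eta>)"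
  have gs: "mset gs = image_mset (elem_diff F) \<eta>"
    unfolding gs_def by (rule someI_ex) (rule ex_mset)
  have "length gs = size \<eta>" using arg_cong[OF gs, of size] by simp
  then have len: "length gs \<le> p + 1" using size_le_forest_size[of \<eta>] Node.prems by simp
  have "\<exists>C. \<forall>y. norm (nderiv (F a) (map (\<lambda>g. g y) gs) y) \<le> C"
  proof (rule nderiv_bounded[OF F len])
    fix g assume "g \<in> set gs"
    then have "g \<in># image_mset (elem_diff F) \<eta>" by (simp flip: gs)
    then obtain \<tau> where "\<tau> \<in># \<eta>" "g = elem_diff F \<tau>" by auto
    then show "\<exists>C. \<forall>y. norm (g y) \<le> C"
      using Node vertices_le_forest_size[of \<tau> \<eta>] by auto
  qed
  then show ?case by (simp add: gs_def)
qed

text \<open>By symmetry of the derivatives, any enumeration of the branches may be used.\<close>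
lemma elem_diff_inner:
  assumes "mset \<tau>s = \<eta>" "length \<tau>s \<le> p + 1"
  shows "elem_diff F (Node a \<eta>) y \<bullet> b = nderiv (\<lambda>y. F a y \<bullet> b) (map (\<lambda>\<tau>. elem_diff F \<tau> y) \<tau>s) y"
proof -
  define gs where "gs = (SOME gs. mset gs = image_mset (elem_diff F) \<eta>)"
  have gs: "mset gs = image_mset (elem_diff F) \<eta>"
    unfolding gs_def by (rule someI_ex) (rule ex_mset)
  have len: "length gs = length \<tau>s" using arg_cong[OF gs, of size] assms(1) by (metis size_image_mset size_mset)
  have "elem_diff F (Node a \<eta>) y \<bullet> b = nderiv (\<lambda>y. F a y \<bullet> b) (map (\<lambda>g. g y) gs) y"
    using nderiv_inner[OF F[of a], of "map (\<lambda>g. g y) gs" b] len assms by (simp add: gs_def)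
  also have "nderiv (\<lambda>y. F a y \<bullet> b) (map (\<lambda>g. g y) gs) = nderiv (\<lambda>y. F a y \<bullet> b) (map (\<lambda>\<tau>. elem_diff F \<tau> y) \<tau>s)"
  proof (rule nderiv_permute[OF F_inner])
    show "mset (map (\<lambda>g. g y) gs) = mset (map (\<lambda>\<tau>. elem_diff F \<tau> y) \<tau>s)"
      using gs assms(1) by (auto simp: multiset.map_comp o_def)
  qed (use len assms in simp)
  finally show ?thesis .
qed

lemma small_bounded: "(\<And>s. norm (c s) \<le> C) \<Longrightarrow> small \<alpha> T 0 0 (\<lambda>s u v. c s)"
  by (rule smallI[of "\<bar>C\<bar>"]) (auto intro: order_trans[OF _ abs_ge_self])

lemma small_elem_diff:
  assumes "vertices \<tau> \<le> p + 1"
  shows "small \<alpha> T 0 0 (\<lambda>s u v. elem_diff F \<tau> (Y s) \<bullet> b * c)"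
proof -
  obtain C where "\<And>y. norm (elem_diff F \<tau> y) \<le> C" using elem_diff_bounded[OF assms] by blast
  then have "norm (elem_diff F \<tau> (Y s) \<bullet> b * c) \<le> C * norm b * \<bar>c\<bar>" for s
    using Cauchy_Schwarz_ineq2[of "elem_diff F \<tau> (Y s)" b]
    by (auto simp: abs_mult intro!: mult_right_mono elim!: order_trans)
  then show ?thesis by (rule small_bounded)
qed

lemma order_series:
  assumes "q \<le> p"
  shows "order 0 (series_jet q b)"
  unfolding series_jet_def[abs_def]
proof (intro order_sum order_scale small_elem_diff)
  fix \<tau> :: "'m rtree" assume "\<tau> \<in> trees_upto q"
  then show "vertices \<tau> \<le> p + 1" using assms by (simp add: trees_upto_def)
  show "order 0 (\<lambda>s r. tree_jet s \<tau> r)" using order_mono[OF order_tree] by simp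
qed

lemma order_increment_jet: "order 1 (increment_jet b)"
proof -
  have "order 0 (\<lambda>s r. Jet (Y r \<bullet> b) (blinfun_inner_left b o\<^sub>L Y' r))"
    using controlled_imp_order[OF controlled_paths_linear_image[OF Y, of "blinfun_inner_left b"]] by simp
  from order_from_start[OF this] show ?thesis
    by (rule order_cong[THEN iffD1, rotated]) (simp add: increment_jet_def jet_eq_iff inner_diff_left)
qed

lemma field_jet_taylor:
  assumes "k \<le> p + 1"
  shows "field_jet a b r = Jet (taylor_rem k (\<lambda>y. F a y \<bullet> b) (Y s) (Y r)) (taylor_rem_deriv k (\<lambda>y. F a y \<bullet> b) (Y s) (Y r) o\<^sub>L Y' r)
      + (\<Sum>n<k. \<Sum>is\<in>words n Basis. (nderiv (\<lambda>y. F a y \<bullet> b) is (Y s) / fact n) *\<^sub>R (\<Prod>i\<leftarrow>is. increment_jet i s r))"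
  unfolding field_jet_def increment_jet_def by (rule jet_taylor[OF F_inner assms]) simp

lemma order_field: "order 0 (\<lambda>s. field_jet a b)"
proof -
  have "order 0 (\<lambda>s r. Jet (taylor_rem 0 (\<lambda>y. F a y \<bullet> b) (Y s) (Y r)) (taylor_rem_deriv 0 (\<lambda>y. F a y \<bullet> b) (Y s) (Y r) o\<^sub>L Y' r))"
    by (rule order_taylor_rem[OF Y F_inner]) (use p in auto)
  moreover have "field_jet a b r = Jet (taylor_rem 0 (\<lambda>y. F a y \<bullet> b) (Y s) (Y r)) (taylor_rem_deriv 0 (\<lambda>y. F a y \<bullet> b) (Y s) (Y r) o\<^sub>L Y' r)" for s r
    using field_jet_taylor[of 0 a b r s] by simp
  ultimately show ?thesis by simp
qed

text \<open>
  If the truncated series of order \<open>q\<close> approximates the solution up to order \<open>q + 1\<close>, then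
  composing it with the vector field and discarding the forests with more than \<open>q\<close> vertices
  does so too.
\<close>
lemma order_field_expansion:
  assumes q: "q < p" and IH: "\<And>b. order (Suc q) (\<lambda>s r. increment_jet b s r - series_jet q b s r)"
  shows "order (Suc q) (\<lambda>s r. field_jet a b r
    - (\<Sum>\<eta>\<in>forests_upto q. series_coeff b s (Node a \<eta>) *\<^sub>R forest_jet s \<eta> r))"
proof -
  define f where "f = (\<lambda>y. F a y \<bullet> b)"
  have f: "f \<in> Cb (p + 1)" unfolding f_def by (rule F_inner)
  define v where "v s \<tau> = elem_diff F \<tau> (Y s)" for s \<tau>
  define rem where "rem s r = Jet (taylor_rem (Suc q) f (Y s) (Y r)) (taylor_rem_deriv (Suc q) f (Y s) (Y r) o\<^sub>L Y' r)" for s r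
  \<comment> \<open>Coefficient and jet of the term that belongs to a word of trees.\<close>
  define cw where "cw s \<tau>s = nderiv f (map (v s) \<tau>s) (Y s) * (\<Prod>\<tau>\<leftarrow>\<tau>s. 1 / real (symfac \<tau>)) / fact (length \<tau>s)"
    for s and \<tau>s :: "'m rtree list"
  define zw where "zw s \<tau>s r = (\<Prod>\<tau>\<leftarrow>\<tau>s. tree_jet s \<tau> r)" for s and \<tau>s :: "'m rtree list" and r
  let ?S = "trees_upto q :: 'm rtree set"
  let ?small = "\<lambda>n. {\<tau>s \<in> words n ?S. forest_size (mset \<tau>s) \<le> q}"
  let ?large = "\<lambda>n. {\<tau>s \<in> words n ?S. \<not> forest_size (mset \<tau>s) \<le> q}"
  have o_rem: "order (Suc q) rem"
    unfolding rem_def[abs_def] by (rule order_taylor_rem[OF Y f]) (use p q in auto)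
  have o_diff: "order (Suc q) (\<lambda>s r. \<Sum>n<Suc q. \<Sum>is\<in>words n Basis. (nderiv f is (Y s) / fact n) *\<^sub>R
      ((\<Prod>i\<leftarrow>is. increment_jet i s r) - (\<Prod>i\<leftarrow>is. series_jet q i s r)))"
  proof (intro order_sum order_scale order_prod_list_diff IH)
    show "order 0 (increment_jet i)" for i using order_mono[OF order_increment_jet] by simp
    show "order 0 (series_jet q i)" for i using q by (intro order_series) simp
    fix n and "is" :: "(real ^ 'e) list" assume n: "n \<in> {..<Suc q}" and "is": "is \<in> words n Basis"
    have "length is \<le> p + 1" using n "is" q by (auto simp: words_def)
    then obtain B where B: "\<And>y. norm (nderiv f is y) \<le> B * (\<Prod>v\<leftarrow>is. norm v)"
      using Cb_bound[OF f] by metis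
    have "norm (nderiv f is (Y s) / fact n) \<le> B * (\<Prod>v\<leftarrow>is. norm v) / fact n" for s
      using B[of "Y s"] by (simp add: divide_right_mono)
    then show "small \<alpha> T 0 0 (\<lambda>s u v. nderiv f is (Y s) / fact n)" by (rule small_bounded)
  qed
  have o_large: "order (Suc q) (\<lambda>s r. \<Sum>n<Suc q. \<Sum>\<tau>s\<in>?large n. cw s \<tau>s *\<^sub>R zw s \<tau>s r)"
  proof (intro order_sum order_scale)
    fix n and \<tau>s :: "'m rtree list" assume n: "n \<in> {..<Suc q}" and \<tau>s: "\<tau>s \<in> ?large n"
    have len: "length \<tau>s \<le> p + 1" and vert: "\<And>\<tau>. \<tau> \<in> set \<tau>s \<Longrightarrow> vertices \<tau> \<le> p + 1"
      and large: "Suc q \<le> (\<Sum>\<tau>\<leftarrow>\<tau>s. vertices \<tau>)"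
      using n \<tau>s q by (auto simp: words_def trees_upto_def sum_vertices_mset)
    show "order (Suc q) (\<lambda>s. zw s \<tau>s)"
      unfolding zw_def[abs_def] by (rule order_mono[OF order_prod_list large]) (rule order_tree)
    have "\<exists>C. \<forall>y. norm (nderiv f (map (\<lambda>g. g y) (map (elem_diff F) \<tau>s)) y) \<le> C"
      by (rule nderiv_bounded[OF f]) (use len vert elem_diff_bounded in auto)
    then obtain C where C: "\<And>y. norm (nderiv f (map (\<lambda>\<tau>. elem_diff F \<tau> y) \<tau>s) y) \<le> C"
      by (auto simp: o_def)
    have "norm (cw s \<tau>s) \<le> C * \<bar>\<Prod>\<tau>\<leftarrow>\<tau>s. 1 / real (symfac \<tau>)\<bar> / fact (length \<tau>s)" for s
      using C[of "Y s"] unfolding cw_def v_def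
      by (auto simp: abs_mult intro!: divide_right_mono mult_right_mono)
    then show "small \<alpha> T 0 0 (\<lambda>s u v. cw s \<tau>s)" by (rule small_bounded)
  qed
  have series_powers: "(\<Sum>is\<in>words n Basis. (nderiv f is (Y s) / fact n) *\<^sub>R (\<Prod>i\<leftarrow>is. series_jet q i s r))
      = (\<Sum>\<tau>s\<in>?small n. cw s \<tau>s *\<^sub>R zw s \<tau>s r) + (\<Sum>\<tau>s\<in>?large n. cw s \<tau>s *\<^sub>R zw s \<tau>s r)"
    if n: "n < Suc q" for n s r
  proof -
    have "(\<Sum>is\<in>words n Basis. (nderiv f is (Y s) / fact n) *\<^sub>R (\<Prod>i\<leftarrow>is. series_jet q i s r))
        = (1 / fact n) *\<^sub>R (\<Sum>is\<in>words n Basis. nderiv f is (Y s) *\<^sub>R (\<Prod>i\<leftarrow>is. series_jet q i s r))"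
      by (simp add: scaleR_sum_right)
    also have "(\<Sum>is\<in>words n Basis. nderiv f is (Y s) *\<^sub>R (\<Prod>i\<leftarrow>is. series_jet q i s r))
        = (\<Sum>\<tau>s\<in>words n ?S. (nderiv f (map (v s) \<tau>s) (Y s) * (\<Prod>\<tau>\<leftarrow>\<tau>s. 1 / real (symfac \<tau>))) *\<^sub>R (\<Prod>\<tau>\<leftarrow>\<tau>s. tree_jet s \<tau> r))"
      unfolding series_jet_def v_def by (rule nderiv_word_expansion[OF f]) (use n q in simp)
    also have "(1 / fact n) *\<^sub>R \<dots> = (\<Sum>\<tau>s\<in>words n ?S. cw s \<tau>s *\<^sub>R zw s \<tau>s r)"
      unfolding scaleR_sum_right cw_def zw_def by (intro sum.cong refl) (simp add: words_def)
    also have "words n ?S = ?small n \<union> ?large n" by auto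
    also have "(\<Sum>\<tau>s\<in>\<dots>. cw s \<tau>s *\<^sub>R zw s \<tau>s r)
        = (\<Sum>\<tau>s\<in>?small n. cw s \<tau>s *\<^sub>R zw s \<tau>s r) + (\<Sum>\<tau>s\<in>?large n. cw s \<tau>s *\<^sub>R zw s \<tau>s r)"
      using finite_words[OF finite_trees_upto[of q], of n] by (intro sum.union_disjoint) auto
    finally show ?thesis .
  qed
  have forests: "(\<Sum>n<Suc q. \<Sum>\<tau>s\<in>?small n. cw s \<tau>s *\<^sub>R zw s \<tau>s r)
      = (\<Sum>\<eta>\<in>forests_upto q. series_coeff b s (Node a \<eta>) *\<^sub>R forest_jet s \<eta> r)"
    for s r
    unfolding sum_words_by_forest
  proof (rule sum.cong[OF refl])
    fix \<eta> :: "'m rtree multiset" assume \<eta>: "\<eta> \<in> forests_upto q"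
    have to_mset: "(\<Prod>\<tau>\<leftarrow>\<tau>s. g \<tau>) = (\<Prod>\<tau>\<in>#mset \<tau>s. g \<tau>)" for g :: "'m rtree \<Rightarrow> 'r::comm_monoid_mult" and \<tau>s
      by (induction \<tau>s) auto
    have "cw s \<tau>s *\<^sub>R zw s \<tau>s r
        = (elem_diff F (Node a \<eta>) (Y s) \<bullet> b * (\<Prod>\<rho>\<in>#\<eta>. 1 / real (symfac \<rho>)) / fact (size \<eta>)) *\<^sub>R forest_jet s \<eta> r"
      if "\<tau>s \<in> permutations_of_multiset \<eta>" for \<tau>s
    proof -
      have \<tau>s: "mset \<tau>s = \<eta>" using that by (rule permutations_of_multisetD)
      have len: "length \<tau>s = size \<eta>" using \<tau>s by (metis size_mset)
      have "size \<eta> \<le> p + 1" using size_le_forest_size[of \<eta>] \<eta> q by (simp add: forests_upto_def)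
      then show ?thesis using elem_diff_inner[OF \<tau>s, of a "Y s" b] len \<tau>s
        by (simp add: cw_def zw_def v_def[abs_def] f_def to_mset forest_jet_def del: elem_diff.simps)
    qed
    then have "(\<Sum>\<tau>s\<in>permutations_of_multiset \<eta>. cw s \<tau>s *\<^sub>R zw s \<tau>s r)
        = real (card (permutations_of_multiset \<eta>)) *\<^sub>R
            (elem_diff F (Node a \<eta>) (Y s) \<bullet> b * (\<Prod>\<rho>\<in>#\<eta>. 1 / real (symfac \<rho>)) / fact (size \<eta>)) *\<^sub>R forest_jet s \<eta> r"
      by (simp add: sum_constant_scaleR del: sum_constant elem_diff.simps)
    also have "\<dots> = series_coeff b s (Node a \<eta>) *\<^sub>R forest_jet s \<eta> r"
      unfolding symfac_Node_reciprocal[of \<eta> a, symmetric] by (simp add: mult_ac del: elem_diff.simps symfac.simps)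
    finally show "(\<Sum>\<tau>s\<in>permutations_of_multiset \<eta>. cw s \<tau>s *\<^sub>R zw s \<tau>s r)
        = series_coeff b s (Node a \<eta>) *\<^sub>R forest_jet s \<eta> r" .
  qed
  have "field_jet a b r
      - (\<Sum>\<eta>\<in>forests_upto q. series_coeff b s (Node a \<eta>) *\<^sub>R forest_jet s \<eta> r)
    = rem s r
      + (\<Sum>n<Suc q. \<Sum>is\<in>words n Basis. (nderiv f is (Y s) / fact n) *\<^sub>R
          ((\<Prod>i\<leftarrow>is. increment_jet i s r) - (\<Prod>i\<leftarrow>is. series_jet q i s r)))
      + (\<Sum>n<Suc q. \<Sum>\<tau>s\<in>?large n. cw s \<tau>s *\<^sub>R zw s \<tau>s r)" for s r
  proof -
    let ?P = "\<lambda>n. \<Sum>is\<in>words n Basis. (nderiv f is (Y s) / fact n) *\<^sub>R (\<Prod>i\<leftarrow>is. increment_jet i s r)"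
    let ?Q = "\<lambda>n. \<Sum>is\<in>words n Basis. (nderiv f is (Y s) / fact n) *\<^sub>R (\<Prod>i\<leftarrow>is. series_jet q i s r)"
    have "field_jet a b r = rem s r + (\<Sum>n<Suc q. ?P n)"
      using field_jet_taylor[of "Suc q" a b r s] q unfolding rem_def f_def by simp
    moreover have "(\<Sum>n<Suc q. ?Q n) = (\<Sum>n<Suc q. \<Sum>\<tau>s\<in>?small n. cw s \<tau>s *\<^sub>R zw s \<tau>s r)
        + (\<Sum>n<Suc q. \<Sum>\<tau>s\<in>?large n. cw s \<tau>s *\<^sub>R zw s \<tau>s r)"
      unfolding sum.distrib[symmetric] by (intro sum.cong refl series_powers) simp
    ultimately show ?thesis
      unfolding forests[symmetric] by (simp only: scaleR_diff_right sum_subtractf algebra_simps)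
  qed
  then show ?thesis using order_add[OF order_add[OF o_rem o_diff] o_large] by simp
qed

section \<open>The expansion of the solution\<close>

lemma F_differentiable: "F a differentiable (at y)"
  using nderiv_has_derivative[OF F[of a], of "[]" y] by (auto simp: differentiable_def)

lemma has_rint_field:
  assumes "0 \<le> s" "s \<le> t" "t \<le> T"
  shows "has_rint XX (driver a) (field_jet a b) s t (rint XX (driver a) (field_jet a b) s t)"
  using rint_exists_and_close(1)[OF order_driver order_field, of s s t] assms by simp

text \<open>
  The vector-valued rough integral converges because its components do, and its limit is identified
  componentwise; additivity moves the lower limit of integration from \<open>0\<close> to \<open>s\<close>.
\<close>
lemma solution_increment:
  assumes st: "0 \<le> s" "s \<le> t" "t \<le> T"
  shows "(Y t - Y s) \<bullet> b = (\<Sum>a\<in>UNIV. rint XX (driver a) (field_jet a b) s t)"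
proof -
  have from_0: "Y r \<bullet> b = y0 \<bullet> b + (\<Sum>a\<in>UNIV. rint XX (driver a) (field_jet a b) 0 r)"
    if r: "0 \<le> r" "r \<le> T" for r and b :: "real ^ 'e"
  proof -
    let ?S = "rough_sum XX (vfield_path F (Y, Y')) (Z, Z')"
    have lim: "((\<lambda>P. ?S P \<bullet> b) \<longlongrightarrow> (\<Sum>a\<in>UNIV. rint XX (driver a) (field_jet a b) 0 r)) (mesh_filter 0 r)" for b
    proof -
      have "?S P \<bullet> b = (\<Sum>a\<in>UNIV. germ_sum (germ XX (driver a) (field_jet a b)) P)" for P
        unfolding driver_def field_jet_def[abs_def] by (rule rough_sum_vfield_inner) (rule F_differentiable)
      then show ?thesis using has_rint_field[of 0 r] r unfolding has_rint_def by (auto intro!: tendsto_sum)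
    qed
    define L where "L = (\<Sum>b\<in>Basis. (\<Sum>a\<in>UNIV. rint XX (driver a) (field_jet a b) 0 r) *\<^sub>R b)"
    have L: "(?S \<longlongrightarrow> L) (mesh_filter 0 r)"
      by (subst tendsto_componentwise_iff) (auto simp: L_def lim)
    then have "rough_integral XX 0 r (vfield_path F (Y, Y')) (Z, Z') = L"
      unfolding rough_integral_def using mesh_filter_neq_bot[OF r(1)] by (rule tendsto_Lim[rotated])
    moreover have "L \<bullet> b = (\<Sum>a\<in>UNIV. rint XX (driver a) (field_jet a b) 0 r)"
      by (rule tendsto_unique[OF mesh_filter_neq_bot[OF r(1)] tendsto_inner[OF L tendsto_const] lim])
    ultimately show ?thesis using Y_integral[of r] r by (simp add: inner_add_left)
  qed
  have "rint XX (driver a) (field_jet a b) 0 t = rint XX (driver a) (field_jet a b) 0 s + rint XX (driver a) (field_jet a b) s t" for a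
    using rint_additive[OF order_driver order_field, of 0 0 s t] st by simp
  then show ?thesis using from_0[of t b] from_0[of s b] st
    by (simp add: inner_diff_left sum.distrib)
qed

text \<open>
  Integrating the expansion of the vector field gains one order: the integrals of the forests with
  at most \<open>q\<close> vertices are the coefficients of the trees with at most \<open>q + 1\<close> vertices.
\<close>
lemma order_series_step:
  assumes q: "q < p" and IH: "\<And>b. order (Suc q) (\<lambda>s r. increment_jet b s r - series_jet q b s r)"
  shows "order (Suc (Suc q)) (\<lambda>s r. increment_jet b s r - series_jet (Suc q) b s r)"
proof -
  define c where "c a \<eta> s = series_coeff b s (Node a \<eta>)" for a \<eta> s
  define G where "G a s r = field_jet a b r - (\<Sum>\<eta>\<in>forests_upto q. c a \<eta> s *\<^sub>R forest_jet s \<eta> r)" for a s r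
  have G: "order (Suc q) (G a)" for a
    unfolding G_def[abs_def] c_def by (rule order_field_expansion[OF q IH])
  have series: "series_jet (Suc q) b s r
      = (\<Sum>a\<in>UNIV. \<Sum>\<eta>\<in>forests_upto q. c a \<eta> s *\<^sub>R integral_jet (driver a) (forest_jet s \<eta>) s r)" for s r
    unfolding series_jet_def sum_trees_upto_Suc c_def tree_jet_Node ..
  have "increment_jet b s r - series_jet (Suc q) b s r = (\<Sum>a\<in>UNIV. integral_jet (driver a) (G a s) s r)"
    if sr: "0 \<le> s" "s \<le> r" "r \<le> T" for s r
  proof -
    have int: "rint XX (driver a) (field_jet a b) s r
        = rint XX (driver a) (G a s) s r + (\<Sum>\<eta>\<in>forests_upto q. c a \<eta> s * rint XX (driver a) (forest_jet s \<eta>) s r)" for a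
    proof (rule rint_unique)
      have "has_rint XX (driver a) (\<lambda>r. G a s r + (\<Sum>\<eta>\<in>forests_upto q. c a \<eta> s *\<^sub>R forest_jet s \<eta> r)) s r
          (rint XX (driver a) (G a s) s r + (\<Sum>\<eta>\<in>forests_upto q. c a \<eta> s * rint XX (driver a) (forest_jet s \<eta>) s r))"
        using sr by (intro has_rint_add has_rint_sum has_rint_scale rint_exists_and_close(1)[OF order_driver G]
            rint_exists_and_close(1)[OF order_driver order_forest]) auto
      then show "has_rint XX (driver a) (field_jet a b) s r
          (rint XX (driver a) (G a s) s r + (\<Sum>\<eta>\<in>forests_upto q. c a \<eta> s * rint XX (driver a) (forest_jet s \<eta>) s r))"
        by (simp add: G_def)
    qed (rule sr)
    have "blinfun_inner_left b o\<^sub>L Y' r = (\<Sum>a\<in>UNIV. val (field_jet a b r) *\<^sub>R grad (driver a r))"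
      using sr Y'_field[of r]
      by (intro blinfun_eqI) (simp add: blinfun.sum_left blinfun.scaleR_left vfield_apply inner_sum_left
          field_jet_def driver_def jet_at_component bounded_linear_Blinfun_apply bounded_linear_vec_nth mult.commute)
    moreover have "val (field_jet a b r) = val (G a s r) + (\<Sum>\<eta>\<in>forests_upto q. c a \<eta> s * val (forest_jet s \<eta> r))" for a
      by (simp add: G_def)
    ultimately show ?thesis
      unfolding series jet_eq_iff using sr
      by (simp add: increment_jet_def integral_jet_def solution_increment int sum.distrib
          scaleR_add_left scaleR_sum_left)
  qed
  moreover have "order (Suc (Suc q)) (\<lambda>s r. \<Sum>a\<in>UNIV. integral_jet (driver a) (G a s) s r)"
    by (intro order_sum order_integral order_driver G)
  ultimately show ?thesis by (subst order_cong) auto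
qed

theorem order_series_remainder:
  "q \<le> p \<Longrightarrow> order (Suc q) (\<lambda>s r. increment_jet b s r - series_jet q b s r)"
proof (induction q arbitrary: b)
  case 0
  then show ?case using order_increment_jet[of b] by (simp add: series_jet_def trees_upto_0)
next
  case (Suc q)
  then show ?case by (intro order_series_step) auto
qed

lemma series_remainder_bound:
  obtains C where "\<And>s t. 0 \<le> s \<Longrightarrow> s \<le> t \<Longrightarrow> t \<le> T \<Longrightarrow>
    norm (Y t - Y s - (\<Sum>\<tau>\<in>trees_upto p. (1 / real (symfac \<tau>) * fst (tree_coeff XX (Z, Z') s \<tau>) t) *\<^sub>R elem_diff F \<tau> (Y s)))
      \<le> C * \<bar>t - s\<bar> powr (real (p + 1) * \<alpha>)"
proof -
  define R where "R s t = Y t - Y s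
    - (\<Sum>\<tau>\<in>trees_upto p. (1 / real (symfac \<tau>) * fst (tree_coeff XX (Z, Z') s \<tau>) t) *\<^sub>R elem_diff F \<tau> (Y s))" for s t
  have R_inner: "R s t \<bullet> b = val (increment_jet b s t - series_jet p b s t)" for s t b
    by (simp add: R_def increment_jet_def series_jet_def tree_jet_def jet_at_def inner_diff_left inner_sum_left mult_ac)
  have "\<exists>C. \<forall>s t. 0 \<le> s \<and> s \<le> t \<and> t \<le> T \<longrightarrow> \<bar>R s t \<bullet> b\<bar> \<le> C * ((t - s) powr \<alpha>) ^ Suc p" for b
  proof -
    have "small \<alpha> T (Suc p) 0 (\<lambda>s u v. val (increment_jet b s v - series_jet p b s v))"
      by (rule orderD(1)[OF order_series_remainder]) simp
    then obtain C where C: "\<And>s u v. 0 \<le> s \<Longrightarrow> s \<le> u \<Longrightarrow> u \<le> v \<Longrightarrow> v \<le> T \<Longrightarrow>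
        norm (val (increment_jet b s v - series_jet p b s v)) \<le> C * scales \<alpha> (Suc p) 0 s u v"
      by (elim smallE) blast
    show ?thesis
      by (rule exI[of _ C]) (use C in \<open>auto simp: R_inner simp del: jet_simps\<close>)
  qed
  then obtain C where C: "\<And>b s t. 0 \<le> s \<Longrightarrow> s \<le> t \<Longrightarrow> t \<le> T \<Longrightarrow> \<bar>R s t \<bullet> b\<bar> \<le> C b * ((t - s) powr \<alpha>) ^ Suc p"
    by metis
  show thesis
  proof (rule that[of "\<Sum>b\<in>Basis. C b", folded R_def])
    fix s t assume st: "0 \<le> s" "s \<le> t" "t \<le> T"
    have "norm (R s t) \<le> (\<Sum>b\<in>Basis. \<bar>R s t \<bullet> b\<bar>)" by (rule norm_le_l1)
    also have "\<dots> \<le> (\<Sum>b\<in>Basis. C b * ((t - s) powr \<alpha>) ^ Suc p)" by (intro sum_mono C st)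
    also have "\<dots> = (\<Sum>b\<in>Basis. C b) * ((t - s) powr \<alpha>) ^ Suc p" by (simp add: sum_distrib_right)
    also have "((t - s) powr \<alpha>) ^ Suc p = \<bar>t - s\<bar> powr (real (p + 1) * \<alpha>)"
    proof (cases "s = t")
      case False
      then show ?thesis using powr_power[of "t - s" \<alpha> "Suc p"] st by simp
    qed simp
    finally show "norm (R s t) \<le> (\<Sum>b\<in>Basis. C b) * \<bar>t - s\<bar> powr (real (p + 1) * \<alpha>)" .
  qed
qed

end

theorem theorem3p8:
  fixes \<alpha> T :: real and p :: nat
    and X :: "real \<Rightarrow> real ^ 'd::finite" and XX :: "real \<Rightarrow> real \<Rightarrow> real ^ 'd ^ 'd"
    and Z :: "real \<Rightarrow> real ^ 'm::finite" and Z' :: "real \<Rightarrow> (real ^ 'd) \<Rightarrow>\<^sub>L (real ^ 'm)"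
    and F :: "'m \<Rightarrow> real ^ 'e::finite \<Rightarrow> real ^ 'e"
    and Y :: "real \<Rightarrow> real ^ 'e" and Y' :: "real \<Rightarrow> (real ^ 'd) \<Rightarrow>\<^sub>L (real ^ 'e)"
    and y0 :: "real ^ 'e"
  assumes "1 / 3 < \<alpha>" and "\<alpha> \<le> 1 / 2" and "0 < T"
    and "1 \<le> p" and "real (p + 1) * \<alpha> > 1"
    and "(X, XX) \<in> rough_paths \<alpha> T"
    and "(Z, Z') \<in> controlled_paths \<alpha> T X"
    and "\<And>a. F a \<in> Cb (p + 1)"
    and "rde_solution \<alpha> T X XX F (Z, Z') y0 (Y, Y')"
  shows "\<exists>R C. \<forall>s t. 0 \<le> s \<and> s \<le> t \<and> t \<le> T \<longrightarrow>
     Y t = Y s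
           + (\<Sum>\<tau>\<in>trees_upto p.
                (1 / real (symfac \<tau>) * fst (tree_coeff XX (Z, Z') s \<tau>) t) *\<^sub>R elem_diff F \<tau> (Y s))
           + R s t \<and>
     Y s + (\<Sum>\<tau>\<in>trees_upto p.
                (1 / real (symfac \<tau>) * fst (tree_coeff XX (Z, Z') s \<tau>) t) *\<^sub>R elem_diff F \<tau> (Y s))
       = B_series p (\<lambda>_. 1) F XX (Z, Z') (Y s) s t \<and>
     norm (R s t) \<le> C * \<bar>t - s\<bar> powr (real (p + 1) * \<alpha>)"
proof -
  interpret rough_equation \<alpha> T X XX p Z Z' F Y Y' y0
    by unfold_locales (use assms in auto)
  define R where "R s t = Y t - Y s
    - (\<Sum>\<tau>\<in>trees_upto p. (1 / real (symfac \<tau>) * fst (tree_coeff XX (Z, Z') s \<tau>) t) *\<^sub>R elem_diff F \<tau> (Y s))" for s t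
  obtain C where "\<And>s t. 0 \<le> s \<Longrightarrow> s \<le> t \<Longrightarrow> t \<le> T \<Longrightarrow> norm (R s t) \<le> C * \<bar>t - s\<bar> powr (real (p + 1) * \<alpha>)"
    using series_remainder_bound unfolding R_def by blast
  then show ?thesis
    by (intro exI[of _ R] exI[of _ C]) (simp add: B_series_def R_def)
qed

end
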